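(* Let $M$ be a quaternionic regular manifold of quaternionic dimension $n$ (real dimension $4n$), and let $p\in M$. Then the connected sum $M\#\mathbb{HP}^n$ is quaternionic diffeomorphic to the blow-up $Bl_p(M)$ of $M$ at $p$. Moreover, both manifolds $M\#\mathbb{HP}^n$ and $Bl_p(M)$ are quaternionic regular. (That is, both carry regular atlases, compatible with their differentiable structures, with respect to which they are quaternionic diffeomorphic.)
   Context: **Slice regularity.** $\mathbb{H}$ is the skew field of quaternions and $\mathbb{S}=\{J\in\mathbb{H}: J^2=-1\}$. Let $D\subseteq\mathbb{C}^n$ be open and invariant under complex conjugation in each variable separately, and let $\Omega_D=\{(q_1,\dots,q_n)\in\mathbb{H}^n: q_h=x_h+y_hJ_h,\ x_h,y_h\in\mathbb{R},\ J_h\in\mathbb{S},\ (x_1+y_1i,\dots,x_n+y_ni)\in D\}$. A $C^1$ stem function on $D$ is a family $F=(F_K)_{K\subseteq\{1,\dots,n\}}$ of $C^1$ functions $F_K:D\to\mathbb{H}$ such that conjugating the variable $z_h$ leaves $F_K$ unchanged if $h\notin K$ and changes $F_K$ to $-F_K$ if $h\in K$. It is holomorphic if for every $h$ and every $K\not\ni h$ one has $\partial F_K/\partial x_h=\partial F_{K\cup\{h\}}/\partial y_h$ and $\partial F_K/\partial y_h=-\partial F_{K\cup\{h\}}/\partial x_h$ on $D$, where $z_h=x_h+iy_h$. A function $f:\Omega_D\to\mathbb{H}$ is left slice regular if for some holomorphic stem function $F$ one has $f(x_1+y_1J_1,\dots,x_n+y_nJ_n)=\sum_K J_{k_1}J_{k_2}\cdots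 J_{k_s}\,F_K(x_1+y_1i,\dots,x_n+y_ni)$, where $K=\{k_1<\dots<k_s\}$; it is right slice regular if for some holomorphic stem function $F$ one has $f(x_1+y_1J_1,\dots,x_n+y_nJ_n)=\sum_K F_K(x_1+y_1i,\dots,x_n+y_ni)\,J_{k_s}\cdots J_{k_2}J_{k_1}$ (for example $q_1q_2$ is left slice regular and $q_2q_1$ is right slice regular). A differentiable map into $\mathbb{H}^m$ is slice regular if each of its components is either left or right slice regular; on an open set $W\subseteq\mathbb{H}^n$ not of the form $\Omega_D$ this means that each component is the restriction to $W$ of a left or right slice regular function on some $\Omega_D\supseteq W$. **Quaternionic regular manifolds.** A differentiable manifold of real dimension $4n$ is quaternionic regular if it admits a differentiable atlas $\{(U_i,\varphi_i)\}$, $\varphi_i:U_i\to\mathbb{H}^n$ (a regular atlas), all of whose transition functions $\varphi_j\circ\varphi_i^{-1}:\varphi_i(U_i\cap U_j)\to\varphi_j(U_i\cap U_j)$ are slice regular. A differentiable map $f$ between quaternionic regular manifolds is quaternionic regular if at each point $p$ there are charts of the given regular atlases around $p$ and $f(p)$ in which $f$ is expressed by a slice regular map. A quaternionic diffeomorphism is a diffeomorphism $f$ such that $f$ and $f^{-1}$ are quaternionic regular. **Projective space and blow-up of $\mathbb{H}^n$.** $\mathbb{HP}^n$ is the set of right vector lines $[w,q_1,\dots,q_n]=\{(w\lambda,q_1\lambda,\dots,q_n\lambda):\lambda\in\mathbb{H}\}$ of $\mathbb{H}^{n+1}$, with its usual affine charts. $Bl_0(\mathbb{H}^n)=\{((q_1,\dots,q_n),[a_1,\dots,a_n])\in\mathbb{H}^n\times\mathbb{HP}^{n-1}: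 (q_1,\dots,q_n)\in[a_1,\dots,a_n]\}$, with charts $V_i=\{a_i\neq0\}$, $\varphi_i(q,[a])=(a_1a_i^{-1},\dots,a_{i-1}a_i^{-1},q_i,a_{i+1}a_i^{-1},\dots,a_na_i^{-1})\in\mathbb{H}^n$, and $\pi_1:Bl_0(\mathbb{H}^n)\to\mathbb{H}^n$ is $\pi_1(q,[a])=q$. **Blow-up and connected sum at $p$.** Let $\mathbb{B}^n$ be the open unit ball of $\mathbb{H}^n$. Take a chart $(U,\varphi)$ of $M$ around $p$, normalized (by a translation and a real dilation of $\mathbb{H}^n$) so that $\varphi(p)=0$ and $\varphi(U)\supset\overline{\mathbb{B}^n}$. The blow-up $Bl_p(M)$ is the manifold obtained by replacing $p$ with the $\mathbb{HP}^{n-1}$ of right quaternionic lines of $T_pM\cong\mathbb{H}^n$, i.e. by gluing $M\setminus\{p\}$ and $\pi_1^{-1}(\varphi(U))\subset Bl_0(\mathbb{H}^n)$ along $U\setminus\{p\}\cong\pi_1^{-1}(\varphi(U)\setminus\{0\})$ via $\varphi^{-1}\circ\pi_1$. The connected sum $M\#\mathbb{HP}^n$ is obtained by gluing $M\setminus\varphi^{-1}(\mathbb{B}^n)$ and $\mathbb{HP}^n\setminus\{[1,q]:q\in\mathbb{B}^n\}$ along their boundaries by identifying $\varphi^{-1}(q)$ with $[1,q]$ for $|q|=1$. *)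

theory Defs
  imports "HOL-Analysis.Analysis"
begin

section \<open>Quaternions\<close>

datatype quat = Quat (qre: real) (qim1: real) (qim2: real) (qim3: real)

lemma quat_eq_iff:
  "x = y \<longleftrightarrow> qre x = qre y \<and> qim1 x = qim1 y \<and> qim2 x = qim2 y \<and> qim3 x = qim3 y"
  by (cases x; cases y) auto

instantiation quat :: real_vector
begin

definition "0 = Quat 0 0 0 0"
definition "x + y = Quat (qre x + qre y) (qim1 x + qim1 y) (qim2 x + qim2 y) (qim3 x + qim3 y)"
definition "- x = Quat (- qre x) (- qim1 x) (- qim2 x) (- qim3 x)"
definition "x - y = Quat (qre x - qre y) (qim1 x - qim1 y) (qim2 x - qim2 y) (qim3 x - qim3 y)"
definition "r *\<^sub>R x = Quat (r * qre x) (r * qim1 x) (r * qim2 x) (r * qim3 x)"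

lemmas quat_additive_defs =
  zero_quat_def plus_quat_def uminus_quat_def minus_quat_def scaleR_quat_def

instance
  by standard (simp_all add: quat_additive_defs algebra_simps)

end

instantiation quat :: real_inner
begin

definition inner_quat_def:
  "inner x y = qre x * qre y + qim1 x * qim1 y + qim2 x * qim2 y + qim3 x * qim3 y"
definition norm_quat_inner: "norm (x::quat) = sqrt (inner x x)"
definition sgn_quat_def: "sgn (x::quat) = x /\<^sub>R norm x"
definition dist_quat_def: "dist x (y::quat) = norm (x - y)"
definition uniformity_quat_def [code del]:
  "(uniformity :: (quat \<times> quat) filter) = (INF e\<in>{0 <..}. principal {(x, y). dist x y < e})"
definition open_quat_def [code del]:
  "open (U :: quat set) \<longleftrightarrow> (\<forall>x\<in>U. eventually (\<lambda>(x', y). x' = x \<longrightarrow> y \<in> U) uniformity)"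

instance
proof
  fix x y z :: quat and r :: real
  show "inner x y = inner y x" "inner (x + y) z = inner x z + inner y z"
    "inner (r *\<^sub>R x) y = r * inner x y"
    by (simp_all add: quat_additive_defs inner_quat_def algebra_simps)
  show "0 \<le> inner x x" by (simp add: inner_quat_def)
  have "inner x x = (qre x)\<^sup>2 + (qim1 x)\<^sup>2 + ((qim2 x)\<^sup>2 + (qim3 x)\<^sup>2)"
    by (simp add: inner_quat_def power2_eq_square)
  moreover have "(qre x)\<^sup>2 + (qim1 x)\<^sup>2 + ((qim2 x)\<^sup>2 + (qim3 x)\<^sup>2) = 0 \<longleftrightarrow>
      (qre x)\<^sup>2 + (qim1 x)\<^sup>2 = 0 \<and> (qim2 x)\<^sup>2 + (qim3 x)\<^sup>2 = 0"
    by (rule add_nonneg_eq_0_iff) simp_all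
  ultimately show "inner x x = 0 \<longleftrightarrow> x = 0"
    by (auto simp: quat_eq_iff zero_quat_def sum_power2_eq_zero_iff)
qed (simp_all add: norm_quat_inner sgn_quat_def dist_quat_def uniformity_quat_def open_quat_def)

end

lemma norm_quat_sq: "(norm x)\<^sup>2 = (qre x)\<^sup>2 + (qim1 x)\<^sup>2 + (qim2 x)\<^sup>2 + (qim3 x)\<^sup>2" for x :: quat
  unfolding power2_norm_eq_inner by (simp add: inner_quat_def power2_eq_square)

instantiation quat :: real_normed_div_algebra
begin

definition "1 = Quat 1 0 0 0"
definition "x * y = Quat
  (qre x * qre y - qim1 x * qim1 y - qim2 x * qim2 y - qim3 x * qim3 y)
  (qre x * qim1 y + qim1 x * qre y + qim2 x * qim3 y - qim3 x * qim2 y)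
  (qre x * qim2 y - qim1 x * qim3 y + qim2 x * qre y + qim3 x * qim1 y)
  (qre x * qim3 y + qim1 x * qim2 y - qim2 x * qim1 y + qim3 x * qre y)"
definition "inverse x = Quat (qre x) (- qim1 x) (- qim2 x) (- qim3 x) /\<^sub>R (norm x)\<^sup>2" for x :: quat
definition "x div y = x * inverse y" for x y :: quat

instance
proof
  fix x y z :: quat and r :: real
  show "x * y * z = x * (y * z)" "1 * x = x" "x * 1 = x"
    "(x + y) * z = x * z + y * z" "x * (y + z) = x * y + x * z"
    "r *\<^sub>R x * y = r *\<^sub>R (x * y)" "x * r *\<^sub>R y = r *\<^sub>R (x * y)"
    by (simp_all add: quat_additive_defs times_quat_def one_quat_def algebra_simps)
  show "(0::quat) \<noteq> 1" by (simp add: zero_quat_def one_quat_def)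
  show "inverse (0::quat) = 0" by (simp add: inverse_quat_def zero_quat_def scaleR_quat_def)
  show "x div y = x * inverse y" by (simp add: divide_quat_def)
  let ?c = "Quat (qre x) (- qim1 x) (- qim2 x) (- qim3 x)"
  have c: "?c * x = (norm x)\<^sup>2 *\<^sub>R 1" "x * ?c = (norm x)\<^sup>2 *\<^sub>R 1"
    unfolding norm_quat_sq
    by (simp_all add: times_quat_def one_quat_def scaleR_quat_def power2_eq_square algebra_simps)
  have l: "r *\<^sub>R a * b = r *\<^sub>R (a * b)" "a * r *\<^sub>R b = r *\<^sub>R (a * b)" for a b :: quat and r :: real
    by (simp_all add: scaleR_quat_def times_quat_def algebra_simps)
  assume "x \<noteq> 0"
  then show "inverse x * x = 1" "x * inverse x = 1"
    by (simp_all add: inverse_quat_def l c)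
next
  fix x y :: quat
  have "(norm (x * y))\<^sup>2 = (norm x * norm y)\<^sup>2"
    unfolding power_mult_distrib norm_quat_sq
    by (simp add: times_quat_def) algebra
  then show "norm (x * y) = norm x * norm y"
    by (simp add: power2_eq_iff_nonneg)
qed

end

instantiation quat :: euclidean_space
begin

definition Basis_quat_def: "Basis = {Quat 1 0 0 0, Quat 0 1 0 0, Quat 0 0 1 0, Quat 0 0 0 1}"

instance
proof
  show "inner u v = (if u = v then 1 else 0)" if "u \<in> Basis" "v \<in> Basis" for u v :: quat
    using that unfolding Basis_quat_def inner_quat_def by (elim insertE emptyE) simp_all
  show "(\<forall>u\<in>Basis. inner x u = 0) \<longleftrightarrow> x = 0" for x :: quat
    by (cases x) (simp add: Basis_quat_def inner_quat_def zero_quat_def)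
qed (simp_all add: Basis_quat_def)

end

definition imag_units :: "quat set" where
  "imag_units = {J. J\<^sup>2 = -1}"


type_synonym 'n qvec = "(quat, 'n) vec"
type_synonym 'n cvec = "(complex, 'n) vec"


section \<open>Slice regularity\<close>

primrec C_k_on :: "nat \<Rightarrow> 'a::real_normed_vector set \<Rightarrow> ('a \<Rightarrow> 'b::real_normed_vector) \<Rightarrow> bool" where
  "C_k_on 0 S f \<longleftrightarrow> continuous_on S f"
| "C_k_on (Suc k) S f \<longleftrightarrow> (\<forall>x\<in>S. f differentiable (at x)) \<and>
     (\<forall>v. C_k_on k S (\<lambda>x. frechet_derivative f (at x) v))"

text \<open>Used for open sets in finite-dimensional spaces only, where it is the usual notion of
  a smooth map.\<close>

definition smooth_on :: "'a::real_normed_vector set \<Rightarrow> ('a \<Rightarrow> 'b::real_normed_vector) \<Rightarrow> bool" where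
  "smooth_on S f \<longleftrightarrow> (\<forall>k. C_k_on k S f)"

text \<open>The coordinates \<open>1, \<dots>, n\<close> are indexed by a finite linearly ordered type \<open>'n\<close>; the order enters
  only through the order of the factors in \<open>J\<^bsub>k\<^sub>1\<^esub> J\<^bsub>k\<^sub>2\<^esub> \<dots> J\<^bsub>k\<^sub>s\<^esub>\<close>.\<close>

definition cnj_at :: "'n::finite \<Rightarrow> 'n cvec \<Rightarrow> 'n cvec" where
  "cnj_at h z = (\<chi> k. if k = h then cnj (z $ k) else z $ k)"

definition conj_invariant :: "'n::finite cvec set \<Rightarrow> bool" where
  "conj_invariant D \<longleftrightarrow> (\<forall>h. \<forall>z\<in>D. cnj_at h z \<in> D)"

definition complex_pt :: "('n::finite \<Rightarrow> real) \<Rightarrow> ('n \<Rightarrow> real) \<Rightarrow> 'n cvec" where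
  "complex_pt x y = (\<chi> h. Complex (x h) (y h))"

definition slice_pt :: "('n::finite \<Rightarrow> real) \<Rightarrow> ('n \<Rightarrow> real) \<Rightarrow> ('n \<Rightarrow> quat) \<Rightarrow> 'n qvec" where
  "slice_pt x y J = (\<chi> h. of_real (x h) + y h *\<^sub>R J h)"

definition Omega :: "'n::finite cvec set \<Rightarrow> 'n qvec set" where
  "Omega D = {slice_pt x y J | x y J. range J \<subseteq> imag_units \<and> complex_pt x y \<in> D}"

definition stem_function :: "'n cvec set \<Rightarrow> ('n::finite set \<Rightarrow> 'n cvec \<Rightarrow> quat) \<Rightarrow> bool" where
  "stem_function D F \<longleftrightarrow> (\<forall>K. C_k_on 1 D (F K) \<and>
     (\<forall>h. \<forall>z\<in>D. F K (cnj_at h z) = (if h \<in> K then - F K z else F K z)))"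

definition partial_x :: "'n::finite \<Rightarrow> ('n cvec \<Rightarrow> quat) \<Rightarrow> 'n cvec \<Rightarrow> quat" where
  "partial_x h f z = frechet_derivative f (at z) (axis h 1)"

definition partial_y :: "'n::finite \<Rightarrow> ('n cvec \<Rightarrow> quat) \<Rightarrow> 'n cvec \<Rightarrow> quat" where
  "partial_y h f z = frechet_derivative f (at z) (axis h \<i>)"

definition holomorphic_stem :: "'n cvec set \<Rightarrow> ('n::finite set \<Rightarrow> 'n cvec \<Rightarrow> quat) \<Rightarrow> bool" where
  "holomorphic_stem D F \<longleftrightarrow> stem_function D F \<and>
     (\<forall>h K. h \<notin> K \<longrightarrow> (\<forall>z\<in>D.
        partial_x h (F K) z = partial_y h (F (insert h K)) z \<and>
        partial_y h (F K) z = - partial_x h (F (insert h K)) z))"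

definition left_slice_regular :: "'n::{finite,linorder} cvec set \<Rightarrow> ('n qvec \<Rightarrow> quat) \<Rightarrow> bool" where
  "left_slice_regular D f \<longleftrightarrow> (\<exists>F :: 'n set \<Rightarrow> 'n cvec \<Rightarrow> quat.
     holomorphic_stem D F \<and>
     (\<forall>x y J. range J \<subseteq> imag_units \<and> complex_pt x y \<in> D \<longrightarrow>
        f (slice_pt x y J) =
          (\<Sum>K\<in>UNIV. prod_list (map J (sorted_list_of_set K)) * F K (complex_pt x y))))"

definition right_slice_regular :: "'n::{finite,linorder} cvec set \<Rightarrow> ('n qvec \<Rightarrow> quat) \<Rightarrow> bool" where
  "right_slice_regular D f \<longleftrightarrow> (\<exists>F :: 'n set \<Rightarrow> 'n cvec \<Rightarrow> quat.
     holomorphic_stem D F \<and>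
     (\<forall>x y J. range J \<subseteq> imag_units \<and> complex_pt x y \<in> D \<longrightarrow>
        f (slice_pt x y J) =
          (\<Sum>K\<in>UNIV. F K (complex_pt x y) * prod_list (map J (rev (sorted_list_of_set K))))))"

text \<open>For \<open>W = Omega D\<close> the extension \<open>g\<close> below may be taken to be the component of \<open>f\<close> itself, since
  a stem function on a larger set restricts to \<open>D\<close>.\<close>

definition slice_regular_on :: "'n::{finite,linorder} qvec set \<Rightarrow> ('n qvec \<Rightarrow> 'm::finite qvec) \<Rightarrow> bool" where
  "slice_regular_on W f \<longleftrightarrow> smooth_on W f \<and>
     (\<forall>k. \<exists>D g. open D \<and> conj_invariant D \<and> W \<subseteq> Omega D \<and>
        (left_slice_regular D g \<or> right_slice_regular D g) \<and> (\<forall>q\<in>W. f q $ k = g q))"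


section \<open>Quaternionic regular manifolds\<close>

text \<open>The underlying space of a manifold is a \<^typ>\<open>'a topology\<close>. A chart is a pair \<open>(U, \<phi>)\<close>; the
  values of \<open>\<phi>\<close> outside \<open>U\<close> are irrelevant.\<close>

type_synonym ('a, 'n) chart = "'a set \<times> ('a \<Rightarrow> 'n qvec)"

definition chart_on :: "'a topology \<Rightarrow> ('a, 'n::finite) chart \<Rightarrow> bool" where
  "chart_on T = (\<lambda>(U, \<phi>). openin T U \<and> open (\<phi> ` U) \<and>
     homeomorphic_map (subtopology T U) (top_of_set (\<phi> ` U)) \<phi>)"

text \<open>The expression \<open>\<psi> \<circ> f \<circ> \<phi>\<inverse>\<close> of a map in two charts, and the set on which it is considered.\<close>

definition coord_map :: "('a, 'n::finite) chart \<Rightarrow> ('b, 'm::finite) chart \<Rightarrow> ('a \<Rightarrow> 'b) \<Rightarrow> 'n qvec \<Rightarrow> 'm qvec" where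
  "coord_map c d f = snd d \<circ> f \<circ> inv_into (fst c) (snd c)"

definition coord_dom :: "('a, 'n::finite) chart \<Rightarrow> ('b, 'm::finite) chart \<Rightarrow> ('a \<Rightarrow> 'b) \<Rightarrow> 'n qvec set" where
  "coord_dom c d f = snd c ` {x \<in> fst c. f x \<in> fst d}"

definition smooth_atlas :: "'a topology \<Rightarrow> ('a, 'n::finite) chart set \<Rightarrow> bool" where
  "smooth_atlas T A \<longleftrightarrow> (\<forall>c\<in>A. chart_on T c) \<and> (\<Union>c\<in>A. fst c) = topspace T \<and>
     (\<forall>c\<in>A. \<forall>d\<in>A. smooth_on (coord_dom c d id) (coord_map c d id))"

definition regular_atlas :: "'a topology \<Rightarrow> ('a, 'n::{finite,linorder}) chart set \<Rightarrow> bool" where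
  "regular_atlas T A \<longleftrightarrow> smooth_atlas T A \<and>
     (\<forall>c\<in>A. \<forall>d\<in>A. slice_regular_on (coord_dom c d id) (coord_map c d id))"

definition quaternionic_regular_manifold :: "'a topology \<Rightarrow> ('a, 'n::{finite,linorder}) chart set \<Rightarrow> bool" where
  "quaternionic_regular_manifold T A \<longleftrightarrow>
     Hausdorff_space T \<and> second_countable T \<and> regular_atlas T A"

text \<open>Two atlases define the same differentiable structure.\<close>

definition smoothly_compatible :: "'a topology \<Rightarrow> ('a, 'n::finite) chart set \<Rightarrow> ('a, 'n) chart set \<Rightarrow> bool" where
  "smoothly_compatible T A B \<longleftrightarrow> smooth_atlas T A \<and> smooth_atlas T B \<and> smooth_atlas T (A \<union> B)"

definition smooth_map :: "'a topology \<Rightarrow> ('a, 'n::finite) chart set \<Rightarrow>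
    'b topology \<Rightarrow> ('b, 'm::finite) chart set \<Rightarrow> ('a \<Rightarrow> 'b) \<Rightarrow> bool" where
  "smooth_map S A T B f \<longleftrightarrow> continuous_map S T f \<and>
     (\<forall>c\<in>A. \<forall>d\<in>B. smooth_on (coord_dom c d f) (coord_map c d f))"

definition quaternionic_regular_map :: "'a topology \<Rightarrow> ('a, 'n::{finite,linorder}) chart set \<Rightarrow>
    'b topology \<Rightarrow> ('b, 'm::{finite,linorder}) chart set \<Rightarrow> ('a \<Rightarrow> 'b) \<Rightarrow> bool" where
  "quaternionic_regular_map S A T B f \<longleftrightarrow> smooth_map S A T B f \<and>
     (\<forall>p\<in>topspace S. \<exists>c\<in>A. \<exists>d\<in>B. p \<in> fst c \<and> f p \<in> fst d \<and>
        slice_regular_on (coord_dom c d f) (coord_map c d f))"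

definition quaternionic_diffeomorphic :: "'a topology \<Rightarrow> ('a, 'n::{finite,linorder}) chart set \<Rightarrow>
    'b topology \<Rightarrow> ('b, 'n) chart set \<Rightarrow> bool" where
  "quaternionic_diffeomorphic S A T B \<longleftrightarrow> (\<exists>f g. homeomorphic_maps S T f g \<and>
     quaternionic_regular_map S A T B f \<and> quaternionic_regular_map T B S A g)"


section \<open>Quotients and gluing\<close>

definition quotient_topology :: "'a topology \<Rightarrow> ('a \<Rightarrow> 'b) \<Rightarrow> 'b topology" where
  "quotient_topology X f =
     topology (\<lambda>V. V \<subseteq> f ` topspace X \<and> openin X {x \<in> topspace X. f x \<in> V})"

lemma openin_quotient_topology:
  "openin (quotient_topology X f) V \<longleftrightarrow>
     V \<subseteq> f ` topspace X \<and> openin X {x \<in> topspace X. f x \<in> V}"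
proof -
  have "istopology (\<lambda>V. V \<subseteq> f ` topspace X \<and> openin X {x \<in> topspace X. f x \<in> V})"
    unfolding istopology_def
  proof (intro conjI allI impI)
    fix V W
    assume "V \<subseteq> f ` topspace X \<and> openin X {x \<in> topspace X. f x \<in> V}"
      and "W \<subseteq> f ` topspace X \<and> openin X {x \<in> topspace X. f x \<in> W}"
    moreover have "{x \<in> topspace X. f x \<in> V \<inter> W} =
        {x \<in> topspace X. f x \<in> V} \<inter> {x \<in> topspace X. f x \<in> W}" by auto
    ultimately show "V \<inter> W \<subseteq> f ` topspace X" "openin X {x \<in> topspace X. f x \<in> V \<inter> W}"
      by auto
  next
    fix \<V>
    assume *: "\<forall>V\<in>\<V>. V \<subseteq> f ` topspace X \<and> openin X {x \<in> topspace X. f x \<in> V}"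
    have "{x \<in> topspace X. f x \<in> \<Union>\<V>} = (\<Union>V\<in>\<V>. {x \<in> topspace X. f x \<in> V})" by auto
    with * show "\<Union>\<V> \<subseteq> f ` topspace X" "openin X {x \<in> topspace X. f x \<in> \<Union>\<V>}"
      by auto
  qed
  then show ?thesis
    by (simp add: quotient_topology_def)
qed

lemma topspace_quotient_topology: "topspace (quotient_topology X f) = f ` topspace X"
proof -
  have "{x \<in> topspace X. f x \<in> f ` topspace X} = topspace X" by auto
  then have "openin (quotient_topology X f) (f ` topspace X)"
    by (simp add: openin_quotient_topology)
  then have "f ` topspace X \<subseteq> topspace (quotient_topology X f)"
    by (rule openin_subset)
  moreover have "topspace (quotient_topology X f) \<subseteq> f ` topspace X"
    using openin_topspace[of "quotient_topology X f"] unfolding openin_quotient_topology by blast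
  ultimately show ?thesis by blast
qed

definition disjoint_sum_topology :: "'a topology \<Rightarrow> 'b topology \<Rightarrow> ('a + 'b) topology" where
  "disjoint_sum_topology X Y = topology (\<lambda>W. W \<subseteq> topspace X <+> topspace Y \<and>
     openin X {x \<in> topspace X. Inl x \<in> W} \<and> openin Y {y \<in> topspace Y. Inr y \<in> W})"

lemma openin_disjoint_sum_topology:
  "openin (disjoint_sum_topology X Y) W \<longleftrightarrow> W \<subseteq> topspace X <+> topspace Y \<and>
     openin X {x \<in> topspace X. Inl x \<in> W} \<and> openin Y {y \<in> topspace Y. Inr y \<in> W}"
proof -
  have "istopology (\<lambda>W. W \<subseteq> topspace X <+> topspace Y \<and>
     openin X {x \<in> topspace X. Inl x \<in> W} \<and> openin Y {y \<in> topspace Y. Inr y \<in> W})"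
    (is "istopology ?P")
    unfolding istopology_def
  proof (intro conjI[of "\<forall>S T. ?P S \<longrightarrow> ?P T \<longrightarrow> ?P (S \<inter> T)"] allI impI)
    fix V W
    assume "?P V" "?P W"
    moreover have "{x \<in> topspace X. Inl x \<in> V \<inter> W} =
        {x \<in> topspace X. Inl x \<in> V} \<inter> {x \<in> topspace X. Inl x \<in> W}"
      "{y \<in> topspace Y. Inr y \<in> V \<inter> W} =
        {y \<in> topspace Y. Inr y \<in> V} \<inter> {y \<in> topspace Y. Inr y \<in> W}" by auto
    ultimately show "?P (V \<inter> W)" by auto
  next
    fix \<W>
    assume *: "\<forall>W\<in>\<W>. ?P W"
    have eq: "{x \<in> topspace X. Inl x \<in> \<Union>\<W>} = (\<Union>W\<in>\<W>. {x \<in> topspace X. Inl x \<in> W})"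
      "{y \<in> topspace Y. Inr y \<in> \<Union>\<W>} = (\<Union>W\<in>\<W>. {y \<in> topspace Y. Inr y \<in> W})" by auto
    show "?P (\<Union>\<W>)" unfolding eq using * by (intro conjI openin_Union) auto
  qed
  then show ?thesis
    by (simp add: disjoint_sum_topology_def)
qed

text \<open>The equivalence class of a point of the disjoint sum under the equivalence relation generated
  by \<open>Inl x \<sim> Inr y\<close> for \<open>(x, y) \<in> G\<close>.\<close>

definition glue_class :: "('a \<times> 'b) set \<Rightarrow> 'a + 'b \<Rightarrow> ('a + 'b) set" where
  "glue_class G z = (let r = (\<lambda>(x, y). (Inl x, Inr y)) ` G in (r \<union> r\<inverse>)\<^sup>* `` {z})"

definition glue_topology :: "'a topology \<Rightarrow> 'b topology \<Rightarrow> ('a \<times> 'b) set \<Rightarrow> ('a + 'b) set topology" where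
  "glue_topology X Y G = quotient_topology (disjoint_sum_topology X Y) (glue_class G)"

definition glue_left :: "('a \<times> 'b) set \<Rightarrow> 'a \<Rightarrow> ('a + 'b) set" where
  "glue_left G x = glue_class G (Inl x)"

definition glue_right :: "('a \<times> 'b) set \<Rightarrow> 'b \<Rightarrow> ('a + 'b) set" where
  "glue_right G y = glue_class G (Inr y)"

definition restrict_chart :: "'a set \<Rightarrow> ('a, 'n::finite) chart \<Rightarrow> ('a, 'n) chart" where
  "restrict_chart S = (\<lambda>(U, \<phi>). (U \<inter> S, \<phi>))"

definition push_chart :: "('a \<Rightarrow> 'b) \<Rightarrow> ('a, 'n::finite) chart \<Rightarrow> ('b, 'n) chart" where
  "push_chart \<iota> = (\<lambda>(U, \<phi>). (\<iota> ` U, \<phi> \<circ> inv_into U \<iota>))"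


section \<open>Projective space and the blow-up of the origin\<close>

definition qline :: "'m::finite qvec \<Rightarrow> 'm qvec set" where
  "qline a = {\<chi> k. a $ k * l | l. True}"

definition HP :: "'m::finite qvec set set" where
  "HP = qline ` (- {0})"

definition HP_topology :: "'m::finite qvec set topology" where
  "HP_topology = quotient_topology (top_of_set (- {0})) qline"

definition hom_coords :: "'m::finite qvec set \<Rightarrow> 'm qvec" where
  "hom_coords L = (SOME a. a \<noteq> 0 \<and> qline a = L)"

text \<open>The blow-up of the origin is a subset of \<open>\<bbbH>\<^sup>n \<times> \<bbbH>P\<^sup>n\<^sup>-\<^sup>1\<close>; the dimension of
  the index type is one more than that of the projective space.\<close>

definition Bl0 :: "('n::finite qvec \<times> 'n qvec set) set" where
  "Bl0 = {(q, L). L \<in> HP \<and> q \<in> L}"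

definition Bl0_topology :: "('n::finite qvec \<times> 'n qvec set) topology" where
  "Bl0_topology = subtopology (prod_topology euclidean HP_topology) Bl0"

definition Bl0_chart :: "'n::finite \<Rightarrow> ('n qvec \<times> 'n qvec set, 'n) chart" where
  "Bl0_chart i =
     ({(q, L) \<in> Bl0. hom_coords L $ i \<noteq> 0},
      \<lambda>(q, L). \<chi> k. if k = i then q $ i else hom_coords L $ k * inverse (hom_coords L $ i))"

text \<open>\<open>\<bbbH>P\<^sup>n\<close> is the space of lines in \<^typ>\<open>'n option qvec\<close>, the coordinate \<open>None\<close>
  being the coordinate \<open>w\<close> in \<open>[w, q\<^sub>1, \<dots>, q\<^sub>n]\<close>. In the chart \<open>q\<^sub>i \<noteq> 0\<close> the quotient
  \<open>w q\<^sub>i\<inverse>\<close> is put in the free slot \<open>i\<close>.\<close>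

definition hpoint :: "quat \<Rightarrow> 'n::finite qvec \<Rightarrow> 'n option qvec set" where
  "hpoint w q = qline (\<chi> j. case j of None \<Rightarrow> w | Some k \<Rightarrow> q $ k)"

definition HP_chart :: "'n::finite option \<Rightarrow> ('n option qvec set, 'n) chart" where
  "HP_chart j = ({L \<in> HP. hom_coords L $ j \<noteq> 0},
     \<lambda>L. \<chi> k. hom_coords L $ (if j = Some k then None else Some k) * inverse (hom_coords L $ j))"


section \<open>Blow-up at a point and connected sum with projective space\<close>

text \<open>\<open>\<phi>\<close> is a chart of \<open>A\<close> around \<open>p\<close> followed by a translation and a real dilation of \<open>\<bbbH>\<^sup>n\<close>.\<close>

definition normalized_chart :: "('a, 'n::finite) chart set \<Rightarrow> 'a \<Rightarrow> ('a, 'n) chart \<Rightarrow> bool" where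
  "normalized_chart A p c \<longleftrightarrow> (\<exists>U \<phi>\<^sub>0 r. (U, \<phi>\<^sub>0) \<in> A \<and> p \<in> U \<and> r > 0 \<and>
     c = (U, \<lambda>x. r *\<^sub>R (\<phi>\<^sub>0 x - \<phi>\<^sub>0 p)) \<and> cball 0 1 \<subseteq> snd c ` U)"

definition blowup_gluing ::
    "'a \<Rightarrow> ('a, 'n::finite) chart \<Rightarrow> ('a \<times> ('n qvec \<times> 'n qvec set)) set" where
  "blowup_gluing p = (\<lambda>(U, \<phi>). {(x, (q, L)). x \<in> U - {p} \<and> (q, L) \<in> Bl0 \<and> q = \<phi> x})"

definition blowup_topology :: "'a topology \<Rightarrow> 'a \<Rightarrow> ('a, 'n::finite) chart \<Rightarrow>
    ('a + 'n qvec \<times> 'n qvec set) set topology" where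
  "blowup_topology T p c = glue_topology
     (subtopology T (- {p}))
     (subtopology Bl0_topology {(q, L). q \<in> snd c ` fst c})
     (blowup_gluing p c)"

definition blowup_atlas :: "('a, 'n::finite) chart set \<Rightarrow> 'a \<Rightarrow> ('a, 'n) chart \<Rightarrow>
    (('a + 'n qvec \<times> 'n qvec set) set, 'n) chart set" where
  "blowup_atlas A p c =
     (\<lambda>d. push_chart (glue_left (blowup_gluing p c)) (restrict_chart (- {p}) d)) ` A \<union>
     (\<lambda>i. push_chart (glue_right (blowup_gluing p c))
            (restrict_chart {(q, L). q \<in> snd c ` fst c} (Bl0_chart i))) ` UNIV"

definition csum_gluing :: "('a, 'n::finite) chart \<Rightarrow> ('a \<times> 'n option qvec set) set" where
  "csum_gluing = (\<lambda>(U, \<phi>). {(x, hpoint 1 (\<phi> x)) | x. x \<in> U \<and> norm (\<phi> x) = 1})"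

definition csum_topology :: "'a topology \<Rightarrow> ('a, 'n::finite) chart \<Rightarrow>
    ('a + 'n option qvec set) set topology" where
  "csum_topology T c = glue_topology
     (subtopology T (- {x \<in> fst c. snd c x \<in> ball 0 1}))
     (subtopology HP_topology (- hpoint 1 ` ball 0 1))
     (csum_gluing c)"

text \<open>As for every gluing along boundaries, the differentiable structure of the connected sum is
  given by collars of the two boundary spheres (and does not depend on them up to diffeomorphism).
  We take the radial collars \<open>(s, t) \<mapsto> \<phi>\<inverse>(e\<^sup>t s)\<close> and \<open>(s, t) \<mapsto> [1, e\<^sup>t s]\<close>, where
  \<open>\<bar>s\<bar> = 1\<close> and \<open>t \<ge> 0\<close>. With the second one traversed in the opposite direction, i.e. in the
  coordinate \<open>q = e\<^sup>-\<^sup>t s\<close>, they fit together to the following parametrization of a neighbourhood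
  of the common sphere by an open subset of \<open>\<bbbH>\<^sup>n\<close>.\<close>

definition csum_collar :: "('a, 'n::finite) chart \<Rightarrow> 'n qvec \<Rightarrow> ('a + 'n option qvec set) set" where
  "csum_collar c q =
     (if norm q \<ge> 1 then glue_left (csum_gluing c) (inv_into (fst c) (snd c) q)
      else glue_right (csum_gluing c) (hpoint 1 (q /\<^sub>R (norm q)\<^sup>2)))"

definition csum_atlas :: "('a, 'n::finite) chart set \<Rightarrow> ('a, 'n) chart \<Rightarrow>
    (('a + 'n option qvec set) set, 'n) chart set" where
  "csum_atlas A c =
     (\<lambda>d. push_chart (glue_left (csum_gluing c))
            (restrict_chart (- {x \<in> fst c. snd c x \<in> cball 0 1}) d)) ` A \<union>
     (\<lambda>j. push_chart (glue_right (csum_gluing c))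
            (restrict_chart (- hpoint 1 ` cball 0 1) (HP_chart j))) ` UNIV \<union>
     {(csum_collar c ` (snd c ` fst c - {0}),
       inv_into (snd c ` fst c - {0}) (csum_collar c))}"

end

theory Submission
  imports Defs
begin

text \<open>Since any regular atlas compatible with the given differentiable structures is allowed, it suffices
  to construct one on the blow-up and a diffeomorphism from the connected sum, along which the atlas is
  pulled back. Write \<open>\<phi>\<close> for the normalized chart and \<open>\<phi>\<^sub>0\<close> for the chart of the atlas it comes from. The
  transition functions \<open>(a, q\<^sub>i) \<leftrightarrow> (a\<^sub>k q\<^sub>i, q\<^sub>i)\<close> between the charts of the blow-up and \<open>\<phi>\<close> are slice regular,
  and so is the affine change between \<open>\<phi>\<close> and \<open>\<phi>\<^sub>0\<close>, but compositions of such maps need not be. Thus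
  the atlas consists of layers, separated by spheres around \<open>p\<close>: the charts of the blow-up for
  \<open>|\<phi>| < 1/2\<close>, then \<open>\<phi>\<close> for \<open>1/4 < |\<phi>| < 3/4\<close>, then \<open>\<phi>\<^sub>0\<close> for \<open>|\<phi>| > 1/2\<close>, and the other charts for
  \<open>|\<phi>| > 3/4\<close>; only consecutive layers meet. The diffeomorphism is the identity outside of the unit ball
  and \<open>[w, a] \<mapsto> (a w\<^sup>* / |a|\<^sup>2, [a])\<close> on the complement of the ball in projective space. In the
  collar coordinates it is again the identity, and in the affine charts it has the form
  \<open>(a, w) \<mapsto> (a, w\<^sup>* / (1 + |a|\<^sup>2))\<close>.\<close>

section \<open>Smooth maps\<close>

text \<open>Why compositions break slice regularity: passing from \<open>\<phi>\<^sub>0\<close> to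
  \<open>\<phi>\<close> subtracts the quaternionic vector \<open>\<phi>\<^sub>0 p\<close>, and the
  blow-up charts contain inverses of coordinates. Together they produce
  \<open>inverse (x - b)\<close> with a constant \<open>b\<close>, which is not slice regular in
  \<open>x\<close> if \<open>b\<close> is not real. So the blow-up charts are kept away from every
  chart other than \<open>\<phi>\<close>. The radii could be any three increasing positive numbers
  below 1. Closed balls of radius at most 1 lie in the image of \<open>\<phi>\<close>; they pull
  back to compact, hence closed, subsets of the Hausdorff space, which makes the outer layers open.
  The formula of the inversion has three sources: the conjugate of \<open>w\<close> makes a right
  factor of \<open>[w, a]\<close> cancel against \<open>|a|\<close> squared; the points
  \<open>[1, q]\<close> with \<open>|q| = 1\<close> go to \<open>q\<close> itself, in agreement with
  the gluing; the hyperplane \<open>w = 0\<close> goes to the exceptional divisor. In charts it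
  contains conjugations and norms, so it is treated as a smooth map only, and slice regularity on
  the connected sum comes from the pulled-back charts.\<close>

lemma C_k_on_SucD:
  assumes "C_k_on (Suc k) S f"
  shows "x \<in> S \<Longrightarrow> (f has_derivative frechet_derivative f (at x)) (at x)"
    and "C_k_on k S (\<lambda>x. frechet_derivative f (at x) v)"
  using assms by (auto simp: frechet_derivative_works[symmetric])

lemma C_k_on_cong:
  assumes "open S" "\<And>x. x \<in> S \<Longrightarrow> f x = g x" "C_k_on k S f"
  shows "C_k_on k S g"
  using assms(2,3)
proof (induction k arbitrary: f g)
  case 0
  then show ?case using continuous_on_eq by (metis C_k_on.simps(1))
next
  case (Suc k)
  have d: "(g has_derivative frechet_derivative f (at x)) (at x)" if "x \<in> S" for x
    using has_derivative_transform_within_open[OF C_k_on_SucD(1)[OF Suc.prems(2) that] assms(1) that]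
      Suc.prems(1) by blast
  have "C_k_on k S (\<lambda>x. frechet_derivative g (at x) v)" for v
  proof (rule Suc.IH[OF _ C_k_on_SucD(2)[OF Suc.prems(2), of v]])
    show "frechet_derivative f (at x) v = frechet_derivative g (at x) v" if "x \<in> S" for x
      by (simp add: frechet_derivative_at[OF d[OF that], symmetric])
  qed
  then show ?case using d by (auto simp: differentiable_def)
qed

text \<open>Lets the closure properties below be proved from an explicit formula for the derivative.
  \<open>frechet_derivative\<close> is a choice, but it agrees with the formula by uniqueness of
  derivatives.\<close>

lemma C_k_on_SucI:
  assumes "open S" "\<And>x. x \<in> S \<Longrightarrow> (f has_derivative f' x) (at x)" "\<And>v. C_k_on k S (\<lambda>x. f' x v)"
  shows "C_k_on (Suc k) S f"
proof -
  have "C_k_on k S (\<lambda>x. frechet_derivative f (at x) v)" for v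
    by (rule C_k_on_cong[OF assms(1) _ assms(3)[of v]])
      (simp add: frechet_derivative_at[OF assms(2), symmetric])
  then show ?thesis using assms(2) by (auto simp: differentiable_def)
qed

lemma C_k_on_mono: "C_k_on (Suc k) S f \<Longrightarrow> C_k_on k S f"
proof (induction k arbitrary: f)
  case 0
  then show ?case
    by (simp add: continuous_at_imp_continuous_on differentiable_imp_continuous_within)
qed auto

lemma C_k_on_subset: "C_k_on k S f \<Longrightarrow> T \<subseteq> S \<Longrightarrow> C_k_on k T f"
  by (induction k arbitrary: f) (auto intro: continuous_on_subset)

lemma C_k_on_const: "open S \<Longrightarrow> C_k_on k S (\<lambda>x. c)"
proof (induction k arbitrary: c)
  case (Suc k)
  then show ?case by (intro C_k_on_SucI[where f' = "\<lambda>x v. 0"]) auto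
qed simp

lemma C_k_on_linear:
  assumes "bounded_linear L" "open S" "C_k_on k S f"
  shows "C_k_on k S (\<lambda>x. L (f x))"
  using assms(3)
proof (induction k arbitrary: f)
  case 0
  then show ?case using assms(1) by (simp add: bounded_linear.continuous_on)
next
  case (Suc k)
  show ?case
    by (rule C_k_on_SucI[OF assms(2) bounded_linear.has_derivative[OF assms(1)
        C_k_on_SucD(1)[OF Suc.prems]]])
      (auto intro: Suc.IH[OF C_k_on_SucD(2)[OF Suc.prems]])
qed

lemma C_k_on_id:
  assumes "open S"
  shows "C_k_on k S (\<lambda>x. x)"
proof (cases k)
  case (Suc j)
  show ?thesis unfolding Suc
    by (rule C_k_on_SucI[OF assms, where f' = "\<lambda>x v. v"]) (auto simp: C_k_on_const assms)
qed simp

lemma C_k_on_add: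
  assumes "open S" "C_k_on k S f" "C_k_on k S g"
  shows "C_k_on k S (\<lambda>x. f x + g x)"
  using assms(2,3)
proof (induction k arbitrary: f g)
  case 0
  then show ?case by (simp add: continuous_on_add)
next
  case (Suc k)
  show ?case
    by (rule C_k_on_SucI[OF assms(1) has_derivative_add[OF C_k_on_SucD(1)[OF Suc.prems(1)]
        C_k_on_SucD(1)[OF Suc.prems(2)]]])
      (auto intro: Suc.IH[OF C_k_on_SucD(2)[OF Suc.prems(1)] C_k_on_SucD(2)[OF Suc.prems(2)]])
qed

lemma C_k_on_sum:
  assumes "open S" "\<And>i. i \<in> I \<Longrightarrow> C_k_on k S (f i)"
  shows "C_k_on k S (\<lambda>x. \<Sum>i\<in>I. f i x)"
  using assms(2)
  by (induction I rule: infinite_finite_induct) (auto intro!: C_k_on_add C_k_on_const assms(1))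

text \<open>The product rule pairs each function with the derivative of the other one. The induction
  therefore also needs \<open>f\<close> and \<open>g\<close> themselves at the lower order, which
  \<open>C_k_on_mono\<close> supplies.\<close>

lemma C_k_on_bilinear:
  assumes bil: "bounded_bilinear m" and "open S" "C_k_on k S f" "C_k_on k S g"
  shows "C_k_on k S (\<lambda>x. m (f x) (g x))"
  using assms(3,4)
proof (induction k arbitrary: f g)
  case 0
  then show ?case using bounded_bilinear.continuous_on[OF bil] by auto
next
  case (Suc k)
  show ?case
    by (rule C_k_on_SucI[OF assms(2) bounded_bilinear.FDERIV[OF bil C_k_on_SucD(1)[OF Suc.prems(1)]
        C_k_on_SucD(1)[OF Suc.prems(2)]]])
      (auto intro!: C_k_on_add[OF assms(2)] Suc.IH C_k_on_SucD(2)[OF Suc.prems(1)]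
        C_k_on_SucD(2)[OF Suc.prems(2)] C_k_on_mono[OF Suc.prems(1)] C_k_on_mono[OF Suc.prems(2)])
qed

text \<open>The derivative in direction \<open>v\<close> is
  \<open>- (inverse x * v * inverse x)\<close>, a product of inverses and a constant, so each order
  of smoothness of the inverse yields the next one.\<close>

lemma C_k_on_inverse: "C_k_on k (- {0}) (inverse :: 'a::real_normed_div_algebra \<Rightarrow> 'a)"
proof (induction k)
  case 0
  show ?case by (auto intro!: continuous_intros)
next
  case (Suc k)
  have op: "open (- {0::'a})" by auto
  have "C_k_on k (- {0}) (\<lambda>x. - (inverse x * v * inverse x))" for v :: 'a
    by (intro C_k_on_linear[OF bounded_linear_minus[OF bounded_linear_ident] op]
        C_k_on_bilinear[OF bounded_bilinear_mult op] Suc C_k_on_const[OF op])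
  then show ?case by (intro C_k_on_SucI[OF op]) (auto intro!: has_derivative_inverse')
qed

text \<open>The chain rule evaluates the derivative of \<open>f\<close> in the varying direction
  \<open>?g x v\<close>, whereas \<open>C_k_on\<close> speaks of fixed directions. Expanding this
  direction in \<open>Basis\<close> turns the derivative into a finite sum of scalar functions times
  compositions of fixed directional derivatives with \<open>g\<close>, to which the induction
  hypothesis applies. Hence the Euclidean space in the middle.\<close>

lemma C_k_on_compose:
  fixes f :: "'b::euclidean_space \<Rightarrow> 'c::real_normed_vector" and g :: "'a::real_normed_vector \<Rightarrow> 'b"
  assumes "open S" "open T" "g ` S \<subseteq> T" "C_k_on k T f" "C_k_on k S g"
  shows "C_k_on k S (\<lambda>x. f (g x))"
  using assms(4,5)
proof (induction k arbitrary: f)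
  case 0
  then show ?case using assms(3) by (auto intro: continuous_on_compose2)
next
  case (Suc k)
  let ?f = "\<lambda>x. frechet_derivative f (at x)" and ?g = "\<lambda>x. frechet_derivative g (at x)"
  show ?case
  proof (rule C_k_on_SucI[OF assms(1)])
    fix x assume x: "x \<in> S"
    have f: "(f has_derivative ?f (g x)) (at (g x))"
      using C_k_on_SucD(1)[OF Suc.prems(1)] x assms(3) by auto
    have "((\<lambda>x. f (g x)) has_derivative (\<lambda>v. ?f (g x) (?g x v))) (at x)"
      using diff_chain_at[OF C_k_on_SucD(1)[OF Suc.prems(2) x] f] by (simp add: o_def)
    moreover have "?f (g x) (?g x v) = (\<Sum>b\<in>Basis. (?g x v \<bullet> b) *\<^sub>R ?f (g x) b)" for v
    proof -
      interpret linear "?f (g x)" using f has_derivative_linear by blast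
      show ?thesis
        by (subst (1) euclidean_representation[of "?g x v", symmetric]) (simp add: sum scaleR)
    qed
    ultimately show "((\<lambda>x. f (g x)) has_derivative
        (\<lambda>v. \<Sum>b\<in>Basis. (?g x v \<bullet> b) *\<^sub>R ?f (g x) b)) (at x)" by simp
  next
    fix v
    show "C_k_on k S (\<lambda>x. \<Sum>b\<in>Basis. (?g x v \<bullet> b) *\<^sub>R ?f (g x) b)"
      by (intro C_k_on_sum C_k_on_bilinear[OF bounded_bilinear_scaleR]
          C_k_on_linear[OF bounded_linear_inner_left] C_k_on_SucD(2)[OF Suc.prems(2)]
          Suc.IH C_k_on_SucD(2)[OF Suc.prems(1)] C_k_on_mono[OF Suc.prems(2)] assms(1))
  qed
qed

lemma smooth_on_cong:
  "open S \<Longrightarrow> smooth_on S f \<Longrightarrow> (\<And>x. x \<in> S \<Longrightarrow> f x = g x) \<Longrightarrow> smooth_on S g"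
  unfolding smooth_on_def using C_k_on_cong by blast

lemma smooth_on_subset: "smooth_on S f \<Longrightarrow> T \<subseteq> S \<Longrightarrow> smooth_on T f"
  unfolding smooth_on_def using C_k_on_subset by blast

lemma smooth_on_imp_continuous_on: "smooth_on S f \<Longrightarrow> continuous_on S f"
  unfolding smooth_on_def by (metis C_k_on.simps(1))

lemma
  assumes "open S"
  shows smooth_on_const: "smooth_on S (\<lambda>x. c)"
    and smooth_on_id: "smooth_on S (\<lambda>x. x)"
    and smooth_on_linear: "bounded_linear L \<Longrightarrow> smooth_on S f \<Longrightarrow> smooth_on S (\<lambda>x. L (f x))"
    and smooth_on_add: "smooth_on S f \<Longrightarrow> smooth_on S g \<Longrightarrow> smooth_on S (\<lambda>x. f x + g x)"
    and smooth_on_sum: "(\<And>i. i \<in> I \<Longrightarrow> smooth_on S (h i)) \<Longrightarrow> smooth_on S (\<lambda>x. \<Sum>i\<in>I. h i x)"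
    and smooth_on_bilinear: "bounded_bilinear m \<Longrightarrow> smooth_on S u \<Longrightarrow> smooth_on S v \<Longrightarrow>
      smooth_on S (\<lambda>x. m (u x) (v x))"
  unfolding smooth_on_def
  by (simp_all add: assms C_k_on_const C_k_on_id C_k_on_linear C_k_on_add C_k_on_sum C_k_on_bilinear)

lemma smooth_on_compose:
  fixes f :: "'b::euclidean_space \<Rightarrow> 'c::real_normed_vector" and g :: "'a::real_normed_vector \<Rightarrow> 'b"
  shows "open S \<Longrightarrow> open T \<Longrightarrow> g ` S \<subseteq> T \<Longrightarrow> smooth_on T f \<Longrightarrow> smooth_on S g \<Longrightarrow>
    smooth_on S (\<lambda>x. f (g x))"
  unfolding smooth_on_def using C_k_on_compose by blast

lemma smooth_on_inverse:
  fixes f :: "'a::real_normed_vector \<Rightarrow> 'b::{real_normed_div_algebra,euclidean_space}"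
  assumes "open S" "smooth_on S f" "\<And>x. x \<in> S \<Longrightarrow> f x \<noteq> 0"
  shows "smooth_on S (\<lambda>x. inverse (f x))"
proof (rule smooth_on_compose[OF assms(1) _ _ _ assms(2), where T = "- {0}" and f = inverse])
  show "smooth_on (- {0}) (inverse :: 'b \<Rightarrow> 'b)"
    unfolding smooth_on_def by (intro allI C_k_on_inverse)
qed (use assms(3) in auto)

lemma smooth_on_nth:
  fixes f :: "'a::real_normed_vector \<Rightarrow> ('b::real_normed_vector, 'n::finite) vec"
  shows "open S \<Longrightarrow> smooth_on S f \<Longrightarrow> smooth_on S (\<lambda>x. f x $ k)"
  by (rule smooth_on_linear[OF _ bounded_linear_vec_nth])

lemma smooth_on_vec:
  fixes f :: "'n::finite \<Rightarrow> 'a::real_normed_vector \<Rightarrow> 'b::euclidean_space"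
  assumes "open S" "\<And>k. smooth_on S (f k)"
  shows "smooth_on S (\<lambda>x. \<chi> k. f k x)"
proof -
  have "linear (axis k :: 'b \<Rightarrow> ('b, 'n) vec)" for k
    by (intro linearI) (auto simp: axis_def vec_eq_iff)
  then have "smooth_on S (\<lambda>x. \<Sum>k\<in>UNIV. axis k (f k x) :: ('b, 'n) vec)"
    using assms by (intro smooth_on_sum) (simp_all add: linear_conv_bounded_linear smooth_on_linear)
  then show ?thesis
    by (rule smooth_on_cong[OF assms(1)]) (auto simp: vec_eq_iff axis_def if_distrib cong: if_cong)
qed

lemmas smooth_on_mult = smooth_on_bilinear[OF _ bounded_bilinear_mult]
lemmas smooth_on_scaleR = smooth_on_bilinear[OF _ bounded_bilinear_scaleR]
lemmas smooth_on_inner = smooth_on_bilinear[OF _ bounded_bilinear_inner]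

section \<open>Slice regular maps\<close>

lemma imag_unit_sq: "J \<in> imag_units \<Longrightarrow> J * J = - 1"
  by (simp add: imag_units_def power2_eq_square)

lemma quat_slice_form: "\<exists>x y. \<exists>J\<in>imag_units. (q::quat) = of_real x + y *\<^sub>R J"
proof (cases "qim1 q = 0 \<and> qim2 q = 0 \<and> qim3 q = 0")
  case True
  \<comment> \<open>A real quaternion lies on every slice; the unit \<open>i\<close> is an arbitrary
    choice.\<close>
  have "Quat 0 1 0 0 \<in> imag_units"
    by (simp add: imag_units_def power2_eq_square times_quat_def one_quat_def uminus_quat_def)
  moreover have "q = of_real (qre q) + 0 *\<^sub>R Quat 0 1 0 0"
    using True by (simp add: of_real_def quat_eq_iff quat_additive_defs one_quat_def)
  ultimately show ?thesis by blast
next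
  case False
  \<comment> \<open>The norm of the imaginary part; dividing by it gives the imaginary unit
    \<open>J\<close>.\<close>
  define y where "y = sqrt ((qim1 q)\<^sup>2 + (qim2 q)\<^sup>2 + (qim3 q)\<^sup>2)"
  have pos: "(qim1 q)\<^sup>2 + (qim2 q)\<^sup>2 + (qim3 q)\<^sup>2 > 0"
    using False by (auto simp: add_nonneg_pos add_pos_nonneg)
  then have y: "y > 0" "y * y = (qim1 q)\<^sup>2 + (qim2 q)\<^sup>2 + (qim3 q)\<^sup>2"
    by (simp_all add: y_def)
  define J where "J = Quat 0 (qim1 q / y) (qim2 q / y) (qim3 q / y)"
  have "(qim1 q / y)\<^sup>2 + (qim2 q / y)\<^sup>2 + (qim3 q / y)\<^sup>2 = 1"
    using y pos by (simp add: power_divide add_divide_distrib[symmetric] power2_eq_square)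
  then have "J \<in> imag_units"
    by (simp add: imag_units_def J_def power2_eq_square times_quat_def one_quat_def uminus_quat_def)
  moreover have "q = of_real (qre q) + y *\<^sub>R J"
    using y(1) by (simp add: J_def of_real_def quat_eq_iff quat_additive_defs one_quat_def)
  ultimately show ?thesis by blast
qed

lemma slice_pt_cover:
  obtains x y J where "q = slice_pt x y J" "range J \<subseteq> imag_units"
proof -
  have "\<forall>h. \<exists>x y J. J \<in> imag_units \<and> q $ h = of_real x + y *\<^sub>R J"
    using quat_slice_form by blast
  then obtain x y J where "\<forall>h. J h \<in> imag_units \<and> q $ h = of_real (x h) + y h *\<^sub>R J h"
    by metis
  then show thesis by (intro that[of x y J]) (auto simp: slice_pt_def vec_eq_iff)
qed

lemma holomorphic_stemI:
  assumes D: "open D"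
    and der: "\<And>K z. z \<in> D \<Longrightarrow> (F K has_derivative F' K z) (at z)"
    and cont: "\<And>K v. continuous_on D (\<lambda>z. F' K z v)"
    and conj: "\<And>K h z. z \<in> D \<Longrightarrow> F K (cnj_at h z) = (if h \<in> K then - F K z else F K z)"
    and CR: "\<And>h K z. h \<notin> K \<Longrightarrow> z \<in> D \<Longrightarrow> F' K z (axis h 1) = F' (insert h K) z (axis h \<i>)"
      "\<And>h K z. h \<notin> K \<Longrightarrow> z \<in> D \<Longrightarrow> F' K z (axis h \<i>) = - F' (insert h K) z (axis h 1)"
  shows "holomorphic_stem D F"
proof -
  have "C_k_on 1 D (F K)" for K
    using C_k_on_SucI[OF D der, where k = 0] cont by (simp del: C_k_on.simps(2))
  moreover have "frechet_derivative (F K) (at z) = F' K z" if "z \<in> D" for K z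
    using frechet_derivative_at[OF der[OF that]] by simp
  ultimately show ?thesis
    using conj CR by (simp add: holomorphic_stem_def stem_function_def partial_x_def partial_y_def)
qed

text \<open>Functions of one quaternionic variable induced by a holomorphic function \<open>u\<close> with
  \<open>u (cnj z) = cnj (u z)\<close>; they preserve every slice \<open>\<real> + \<real>J\<close>.\<close>

definition slice_lift ::
    "complex set \<Rightarrow> (complex \<Rightarrow> complex) \<Rightarrow> (complex \<Rightarrow> complex) \<Rightarrow> quat set \<Rightarrow> (quat \<Rightarrow> quat) \<Rightarrow> bool" where
  "slice_lift E u u' Q G \<longleftrightarrow> open E \<and>
     (\<forall>z\<in>E. cnj z \<in> E \<and> (u has_field_derivative u' z) (at z) \<and> u (cnj z) = cnj (u z)) \<and>
     continuous_on E u' \<and>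
     (\<forall>x y. \<forall>J\<in>imag_units. of_real x + y *\<^sub>R J \<in> Q \<longrightarrow> Complex x y \<in> E) \<and>
     (\<forall>x y. \<forall>J\<in>imag_units. Complex x y \<in> E \<longrightarrow>
        G (of_real x + y *\<^sub>R J) = of_real (Re (u (Complex x y))) + Im (u (Complex x y)) *\<^sub>R J)"

definition slice_preserving_on :: "quat set \<Rightarrow> (quat \<Rightarrow> quat) \<Rightarrow> bool" where
  "slice_preserving_on Q G \<longleftrightarrow> (\<exists>E u u'. slice_lift E u u' Q G)"

lemma slice_liftD:
  assumes "slice_lift E u u' Q G"
  shows "open E" "z \<in> E \<Longrightarrow> cnj z \<in> E" "z \<in> E \<Longrightarrow> (u has_field_derivative u' z) (at z)"
    "z \<in> E \<Longrightarrow> u (cnj z) = cnj (u z)" "continuous_on E u'"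
    "J \<in> imag_units \<Longrightarrow> of_real x + y *\<^sub>R J \<in> Q \<Longrightarrow> Complex x y \<in> E"
    "J \<in> imag_units \<Longrightarrow> Complex x y \<in> E \<Longrightarrow>
      G (of_real x + y *\<^sub>R J) = of_real (Re (u (Complex x y))) + Im (u (Complex x y)) *\<^sub>R J"
  using assms unfolding slice_lift_def by blast+

text \<open>The underlying holomorphic function is multiplication by \<open>r\<close>, which
  commutes with complex conjugation because \<open>r\<close> is real.\<close>

lemma slice_preserving_scaleR: "slice_preserving_on UNIV (\<lambda>q. r *\<^sub>R q)"
  unfolding slice_preserving_on_def slice_lift_def
  by (rule exI[of _ UNIV], rule exI[of _ "\<lambda>z. of_real r * z"], rule exI[of _ "\<lambda>z. of_real r"])
    (auto intro!: derivative_eq_intros simp: algebra_simps of_real_def)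

lemma slice_preserving_ident: "slice_preserving_on UNIV (\<lambda>q. q)"
  using slice_preserving_scaleR[of 1] by simp

text \<open>Since \<open>J * J = - 1\<close>, the span of 1 and \<open>J\<close> is a copy of the
  complex numbers, and the quaternionic inverse of one of its elements is the complex
  inverse.\<close>

lemma slice_preserving_inverse: "slice_preserving_on (- {0}) inverse"
proof -
  have inv: "inverse (of_real x + y *\<^sub>R J) =
      of_real (Re (inverse (Complex x y))) + Im (inverse (Complex x y)) *\<^sub>R J"
    if J: "J \<in> imag_units" and z: "Complex x y \<noteq> 0" for x y and J :: quat
  proof (rule inverse_unique)
    let ?n = "x\<^sup>2 + y\<^sup>2"
    have n: "?n \<noteq> 0" using z by (simp add: Complex_eq_0 sum_power2_eq_zero_iff)
    have "(of_real x + y *\<^sub>R J) * (of_real (Re (inverse (Complex x y))) +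
        Im (inverse (Complex x y)) *\<^sub>R J) = ((x * x + y * y) / ?n) *\<^sub>R 1"
      by (simp add: of_real_def algebra_simps imag_unit_sq[OF J] add_divide_distrib scaleR_add_left)
    then show "(of_real x + y *\<^sub>R J) * (of_real (Re (inverse (Complex x y))) +
        Im (inverse (Complex x y)) *\<^sub>R J) = 1"
      using n by (simp add: power2_eq_square)
  qed
  show ?thesis
    unfolding slice_preserving_on_def slice_lift_def
  proof (rule exI[of _ "- {0}"], rule exI[of _ inverse],
      rule exI[of _ "\<lambda>z. - (inverse z ^ Suc (Suc 0))"], intro conjI)
    show "\<forall>z\<in>- {0::complex}. cnj z \<in> - {0} \<and>
        (inverse has_field_derivative - (inverse z ^ Suc (Suc 0))) (at z) \<and>
        inverse (cnj z) = cnj (inverse z)"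
      using DERIV_inverse by auto
    show "\<forall>x y. \<forall>J\<in>imag_units. of_real x + y *\<^sub>R J \<in> - {0} \<longrightarrow> Complex x y \<in> - {0}"
      by (auto simp: Complex_eq_0)
  qed (use inv in \<open>auto intro!: continuous_intros\<close>)
qed

text \<open>For a function of one variable \<open>q $ a\<close> induced by \<open>u\<close>, the
  stem component with index set \<open>K\<close> is \<open>Re u\<close> if \<open>K\<close> is empty
  and \<open>Im u\<close> if \<open>K\<close> is \<open>{a}\<close>. The Boolean argument stands for
  \<open>a \<in> K\<close>, so that all components are given by one formula.\<close>

definition part :: "bool \<Rightarrow> complex \<Rightarrow> real" where
  "part s w = (if s then Im w else Re w)"

lemma bounded_linear_part: "bounded_linear (part s)"
  by (cases s) (simp_all add: part_def[abs_def] bounded_linear_Re bounded_linear_Im)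

lemma part_cnj: "part s (cnj w) = (if s then - part s w else part s w)"
  by (simp add: part_def)

lemma part_has_derivative:
  assumes "(u has_field_derivative u') (at (z $ a))"
  shows "((\<lambda>z. part s (u (z $ a))) has_derivative (\<lambda>d. part s (u' * d $ a))) (at z)"
proof -
  have "((\<lambda>z. z $ a) has_derivative (\<lambda>d. d $ a)) (at z)"
    by (rule bounded_linear.has_derivative[OF bounded_linear_vec_nth has_derivative_ident])
  from has_derivative_compose[OF this assms[unfolded has_field_derivative_def]]
  show ?thesis by (intro bounded_linear.has_derivative[OF bounded_linear_part]) simp
qed

lemma continuous_on_part:
  "continuous_on S f \<Longrightarrow> continuous_on S (\<lambda>z. part s (f z))"
  by (rule bounded_linear.continuous_on[OF bounded_linear_part])

lemma continuous_on_nth_compose: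
  assumes "continuous_on E u" "\<And>z. z \<in> D \<Longrightarrow> z $ a \<in> E"
  shows "continuous_on D (\<lambda>z. u (z $ a))"
  by (rule continuous_on_compose2[OF assms(1)])
    (use assms(2) in \<open>auto intro: continuous_on_component\<close>)

section \<open>Single components of slice regular maps\<close>

definition slice_component :: "'n::{finite,linorder} qvec set \<Rightarrow> ('n qvec \<Rightarrow> quat) \<Rightarrow> bool" where
  "slice_component W f \<longleftrightarrow> (\<exists>D g. open D \<and> conj_invariant D \<and> W \<subseteq> Omega D \<and>
     (left_slice_regular D g \<or> right_slice_regular D g) \<and> (\<forall>q\<in>W. f q = g q))"

lemma slice_component_subset: "slice_component W f \<Longrightarrow> V \<subseteq> W \<Longrightarrow> slice_component V f"
  unfolding slice_component_def by (elim exE, intro exI) auto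

lemma slice_regular_on_components:
  "slice_regular_on W f \<longleftrightarrow> smooth_on W f \<and> (\<forall>k. slice_component W (\<lambda>q. f q $ k))"
  by (simp add: slice_regular_on_def slice_component_def)

lemma slice_regular_on_subset: "slice_regular_on W f \<Longrightarrow> V \<subseteq> W \<Longrightarrow> slice_regular_on V f"
  unfolding slice_regular_on_components using smooth_on_subset slice_component_subset by blast

lemma slice_regular_on_cong:
  assumes "open W" "slice_regular_on W f" "\<And>q. q \<in> W \<Longrightarrow> f q = g q"
  shows "slice_regular_on W g"
  unfolding slice_regular_on_def
proof (intro conjI allI)
  show "smooth_on W g"
    using assms(2) by (auto simp: slice_regular_on_def intro: smooth_on_cong[OF assms(1) _ assms(3)])
qed (use assms(2,3) in \<open>simp add: slice_regular_on_def\<close>)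

text \<open>Serves pairs of charts with disjoint domains. The empty set is \<open>Omega {}\<close>,
  and every family is a holomorphic stem function on the empty set.\<close>

lemma slice_regular_on_empty: "slice_regular_on {} f"
proof -
  have "holomorphic_stem {} F" for F :: "'a set \<Rightarrow> 'a cvec \<Rightarrow> quat"
    by (simp add: holomorphic_stem_def stem_function_def)
  then have "left_slice_regular {} g" for g :: "'a qvec \<Rightarrow> quat"
    by (simp add: left_slice_regular_def)
  moreover have "smooth_on {} f"
    by (rule smooth_on_cong[OF _ smooth_on_const]) auto
  ultimately have "slice_component {} g" for g :: "'a qvec \<Rightarrow> quat"
    unfolding slice_component_def
    by (intro exI[of _ "{}"] exI[of _ g]) (simp_all add: conj_invariant_def)
  with \<open>smooth_on {} f\<close> show ?thesis unfolding slice_regular_on_components by blast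
qed

lemma open_vec_nth_vimage: "open E \<Longrightarrow> open {z :: ('a::topological_space, 'n::finite) vec. z $ a \<in> E}"
  using open_vimage_vec_nth by (simp add: vimage_def)

text \<open>Every point of \<open>W\<close> can be written as a slice point, so the inclusion in
  \<open>Omega D\<close> reduces to a condition on the complex coordinates.\<close>

lemma slice_componentI:
  assumes "open D" "conj_invariant D" "left_slice_regular D g \<or> right_slice_regular D g"
    and W: "\<And>x y J. range J \<subseteq> imag_units \<Longrightarrow> slice_pt x y J \<in> W \<Longrightarrow> complex_pt x y \<in> D"
  shows "slice_component W g"
proof -
  have "W \<subseteq> Omega D"
  proof
    fix q assume "q \<in> W"
    moreover obtain x y J where "q = slice_pt x y J" "range J \<subseteq> imag_units" by (rule slice_pt_cover)
    ultimately show "q \<in> Omega D" using W unfolding Omega_def by blast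
  qed
  then show ?thesis
    unfolding slice_component_def using assms(1-3) by (intro exI[of _ D] exI[of _ g]) simp
qed

text \<open>The stem function has the components \<open>Re u + c\<close> at \<open>{}\<close> and
  \<open>Im u\<close> at \<open>{a}\<close>, and 0 elsewhere; its equations of holomorphy are the
  Cauchy-Riemann equations of \<open>u\<close>. The constant \<open>c\<close> may be any quaternion:
  stem components are quaternion-valued, and \<open>c\<close> enters only the component at
  \<open>{}\<close>, which stands without a factor \<open>J\<close>.\<close>

lemma slice_component_single:
  fixes a :: "'n::{finite,linorder}"
  assumes G: "slice_preserving_on Q G" and W: "\<And>q. q \<in> W \<Longrightarrow> q $ a \<in> Q"
  shows "slice_component W (\<lambda>q. G (q $ a) + c)"
proof -
  obtain E u u' where liftG: "slice_lift E u u' Q G"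
    using G unfolding slice_preserving_on_def by blast
  note E = slice_liftD(1,2)[OF liftG] and u = slice_liftD(3-5)[OF liftG]
    and Q = slice_liftD(6)[OF liftG] and Gu = slice_liftD(7)[OF liftG]
  define D where "D = {z :: 'n cvec. z $ a \<in> E}"
  define F where "F = (\<lambda>K (z :: 'n cvec). (if K \<subseteq> {a} then of_real (part (a \<in> K) (u (z $ a))) else 0) +
    (if K = {} then c else 0))"
  define F' where "F' = (\<lambda>K (z :: 'n cvec) d. if K \<subseteq> {a} then (of_real (part (a \<in> K) (u' (z $ a) * d $ a)) :: quat) else 0)"
  have D: "open D" unfolding D_def by (rule open_vec_nth_vimage[OF E(1)])
  have inv: "conj_invariant D" using E(2) by (auto simp: D_def conj_invariant_def cnj_at_def)
  have "holomorphic_stem D F"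
  proof (rule holomorphic_stemI[OF D, where F' = F'])
    show "(F K has_derivative F' K z) (at z)" if "z \<in> D" for K z
    proof (cases "K \<subseteq> {a}")
      case True
      have "z $ a \<in> E" using that by (simp add: D_def)
      from has_derivative_add[OF has_derivative_of_real[OF part_has_derivative[OF u(1)[OF this]]]
          has_derivative_const[of "if K = {} then c else 0"]]
      show ?thesis using True unfolding F_def F'_def by simp
    qed (auto simp: F_def F'_def)
    have "continuous_on D (\<lambda>z. u' (z $ a))"
      by (rule continuous_on_nth_compose[OF u(3)]) (simp add: D_def)
    then show "continuous_on D (\<lambda>z. F' K z v)" for K v
      unfolding F'_def
      by (cases "K \<subseteq> {a}") (simp_all, intro continuous_intros continuous_on_part)
    show "F K (cnj_at h z) = (if h \<in> K then - F K z else F K z)" if "z \<in> D" for K h z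
      using that u(2)[of "z $ a"] by (auto simp: F_def D_def cnj_at_def part_cnj)
  qed (auto simp: F'_def part_def axis_def)
  moreover have "G (slice_pt x y J $ a) + c =
      (\<Sum>K\<in>UNIV. prod_list (map J (sorted_list_of_set K)) * F K (complex_pt x y))"
    if "range J \<subseteq> imag_units" "complex_pt x y \<in> D" for x y J
  proof -
    have "(\<Sum>K\<in>UNIV. prod_list (map J (sorted_list_of_set K)) * F K (complex_pt x y)) =
        (\<Sum>K\<in>{{}, {a}}. prod_list (map J (sorted_list_of_set K)) * F K (complex_pt x y))"
      by (rule sum.mono_neutral_right) (auto simp: F_def)
    also have "\<dots> = G (slice_pt x y J $ a) + c"
      using that Gu[of "J a" "x a" "y a"] range_subsetD[OF that(1)]
      by (auto simp: F_def part_def complex_pt_def slice_pt_def D_def of_real_def)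
    finally show ?thesis by simp
  qed
  ultimately have "left_slice_regular D (\<lambda>q. G (q $ a) + c)"
    unfolding left_slice_regular_def by (intro exI[of _ F]) simp
  then show ?thesis
  proof (rule slice_componentI[OF D inv disjI1])
    show "complex_pt x y \<in> D" if "range J \<subseteq> imag_units" "slice_pt x y J \<in> W" for x y J
      using Q[of "J a" "x a" "y a"] W[OF that(2)] range_subsetD[OF that(1)]
      by (simp add: D_def complex_pt_def slice_pt_def)
  qed
qed

text \<open>Expanding both factors gives the products \<open>J a * J b\<close> in this order, with
  real coefficients. If \<open>a < b\<close>, this is the order of the factors in a left slice
  regular function. If \<open>b < a\<close>, it is the reversed order, and the same stem function
  exhibits the product as right slice regular. This is where the choice between left and right is
  made, separately for each component.\<close>

lemma slice_component_product:
  fixes a b :: "'n::{finite,linorder}"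
  assumes G: "slice_preserving_on Q G" and H: "slice_preserving_on R H" and ab: "a \<noteq> b"
    and W: "\<And>q. q \<in> W \<Longrightarrow> q $ a \<in> Q" "\<And>q. q \<in> W \<Longrightarrow> q $ b \<in> R"
  shows "slice_component W (\<lambda>q. G (q $ a) * H (q $ b))"
proof -
  obtain E u u' where liftG: "slice_lift E u u' Q G"
    using G unfolding slice_preserving_on_def by blast
  note E = slice_liftD(1,2)[OF liftG] and u = slice_liftD(3-5)[OF liftG]
    and Q = slice_liftD(6)[OF liftG] and Gu = slice_liftD(7)[OF liftG]
  obtain E' v v' where liftH: "slice_lift E' v v' R H"
    using H unfolding slice_preserving_on_def by blast
  note E' = slice_liftD(1,2)[OF liftH] and v = slice_liftD(3-5)[OF liftH]
    and R = slice_liftD(6)[OF liftH] and Hv = slice_liftD(7)[OF liftH]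
  define D where "D = {z :: 'n cvec. z $ a \<in> E \<and> z $ b \<in> E'}"
  define F where "F = (\<lambda>K (z :: 'n cvec). if K \<subseteq> {a, b}
    then of_real (part (a \<in> K) (u (z $ a)) * part (b \<in> K) (v (z $ b))) else (0 :: quat))"
  define F' where "F' = (\<lambda>K (z :: 'n cvec) d. if K \<subseteq> {a, b}
    then of_real (part (a \<in> K) (u (z $ a)) * part (b \<in> K) (v' (z $ b) * d $ b) +
      part (a \<in> K) (u' (z $ a) * d $ a) * part (b \<in> K) (v (z $ b))) else (0 :: quat))"
  have D: "open D"
    unfolding D_def by (intro open_Collect_conj open_vec_nth_vimage E(1) E'(1))
  have inv: "conj_invariant D" using E(2) E'(2) by (auto simp: D_def conj_invariant_def cnj_at_def)
  have stem: "holomorphic_stem D F"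
  proof (rule holomorphic_stemI[OF D, where F' = F'])
    show "(F K has_derivative F' K z) (at z)" if "z \<in> D" for K z
    proof (cases "K \<subseteq> {a, b}")
      case True
      have "z $ a \<in> E" "z $ b \<in> E'" using that by (auto simp: D_def)
      from has_derivative_of_real[OF has_derivative_mult[OF
            part_has_derivative[OF u(1)[OF this(1)]] part_has_derivative[OF v(1)[OF this(2)]]]]
      show ?thesis using True unfolding F_def F'_def by simp
    qed (simp add: F_def F'_def)
    have cu: "continuous_on E u" and cv: "continuous_on E' v"
      using DERIV_isCont[OF u(1)] DERIV_isCont[OF v(1)] by (auto intro: continuous_at_imp_continuous_on)
    have "continuous_on D (\<lambda>z. u (z $ a))" "continuous_on D (\<lambda>z. v (z $ b))"
      "continuous_on D (\<lambda>z. u' (z $ a))" "continuous_on D (\<lambda>z. v' (z $ b))"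
      by (rule continuous_on_nth_compose[OF cu] continuous_on_nth_compose[OF cv]
          continuous_on_nth_compose[OF u(3)] continuous_on_nth_compose[OF v(3)]; simp add: D_def)+
    then show "continuous_on D (\<lambda>z. F' K z v)" for K v
      unfolding F'_def by (cases "K \<subseteq> {a, b}") (simp_all, intro continuous_intros continuous_on_part)
    show "F K (cnj_at h z) = (if h \<in> K then - F K z else F K z)" if "z \<in> D" for K h z
      using that u(2)[of "z $ a"] v(2)[of "z $ b"] ab by (auto simp: F_def D_def cnj_at_def part_cnj)
  qed (use ab in \<open>auto simp: F'_def part_def axis_def\<close>)
  have val: "G (slice_pt x y J $ a) * H (slice_pt x y J $ b) =
      J a * J b * F {a, b} (complex_pt x y) + J a * F {a} (complex_pt x y) +
      J b * F {b} (complex_pt x y) + F {} (complex_pt x y)"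
    if "range J \<subseteq> imag_units" "complex_pt x y \<in> D" for x y J
  proof -
    have "G (slice_pt x y J $ a) = of_real (Re (u (Complex (x a) (y a)))) + Im (u (Complex (x a) (y a))) *\<^sub>R J a"
      "H (slice_pt x y J $ b) = of_real (Re (v (Complex (x b) (y b)))) + Im (v (Complex (x b) (y b))) *\<^sub>R J b"
      using that Gu[of "J a" "x a" "y a"] Hv[of "J b" "x b" "y b"] range_subsetD[OF that(1)]
      by (auto simp: complex_pt_def slice_pt_def D_def)
    then show ?thesis
      using ab by (simp add: F_def part_def complex_pt_def of_real_def algebra_simps)
  qed
  have supp: "(\<Sum>K\<in>UNIV. h K) = h {a, b} + h {a} + h {b} + h {}"
    if "\<And>K. \<not> K \<subseteq> {a, b} \<Longrightarrow> h K = 0" for h :: "'n set \<Rightarrow> quat"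
  proof -
    have "(\<Sum>K\<in>UNIV. h K) = (\<Sum>K\<in>Pow {a, b}. h K)"
      by (rule sum.mono_neutral_right) (use that in auto)
    also have "Pow {a, b} = {{a, b}, {a}, {b}, {}}"
      by (auto simp: Pow_insert)
    also have "sum h {{a, b}, {a}, {b}, {}} = h {a, b} + h {a} + h {b} + h {}"
      using ab by (auto simp: insert_eq_iff doubleton_eq_iff add.assoc)
    finally show ?thesis .
  qed
  have F0: "F K z = 0" if "\<not> K \<subseteq> {a, b}" for K z using that by (simp add: F_def)
  \<comment> \<open>The stem components are real, so it does not matter on which side of the
    imaginary units they stand.\<close>
  have com: "F K z * w = w * F K z" for K z w
    by (simp add: F_def of_real_def)
  have "left_slice_regular D (\<lambda>q. G (q $ a) * H (q $ b)) \<or> right_slice_regular D (\<lambda>q. G (q $ a) * H (q $ b))"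
  proof (cases "a < b")
    case True
    then have "sorted_list_of_set {a, b} = [a, b]"
      by (intro sorted_distinct_set_unique) auto
    then have "left_slice_regular D (\<lambda>q. G (q $ a) * H (q $ b))"
      unfolding left_slice_regular_def using stem
      by (intro exI[of _ F]) (auto simp: supp F0 val)
    then show ?thesis ..
  next
    case False
    then have "sorted_list_of_set {a, b} = [b, a]"
      using ab by (intro sorted_distinct_set_unique) auto
    then have "right_slice_regular D (\<lambda>q. G (q $ a) * H (q $ b))"
      unfolding right_slice_regular_def using stem
      by (intro exI[of _ F]) (auto simp: supp F0 val com)
    then show ?thesis ..
  qed
  then show ?thesis
  proof (rule slice_componentI[OF D inv])
    show "complex_pt x y \<in> D" if "range J \<subseteq> imag_units" "slice_pt x y J \<in> W" for x y J
      using Q[of "J a" "x a" "y a"] R[of "J b" "x b" "y b"] W[OF that(2)] range_subsetD[OF that(1)]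
      by (simp add: D_def complex_pt_def slice_pt_def)
  qed
qed

section \<open>Charts and atlases\<close>

text \<open>Domain and image of a chart are open, so relative openness can be replaced by openness
  in the ambient spaces. Later verifications use this form, without subspace topologies.\<close>

lemma chart_on_iff:
  "chart_on T c \<longleftrightarrow> openin T (fst c) \<and> inj_on (snd c) (fst c) \<and>
     (\<forall>N. open N \<longrightarrow> openin T {x \<in> fst c. snd c x \<in> N}) \<and>
     (\<forall>V. openin T V \<and> V \<subseteq> fst c \<longrightarrow> open (snd c ` V))" (is "_ \<longleftrightarrow> ?R")
proof (cases "openin T (fst c)")
  case op: True
  have top: "topspace (subtopology T (fst c)) = fst c"
    using openin_subset[OF op] by (auto simp: topspace_subtopology)
  have cont: "continuous_map (subtopology T (fst c)) euclidean (snd c) \<longleftrightarrow>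
      (\<forall>N. open N \<longrightarrow> openin T {x \<in> fst c. snd c x \<in> N})"
  proof -
    have "{x \<in> topspace T. x \<in> fst c \<and> P x} = {x \<in> fst c. P x}" for P
      using openin_subset[OF op] by auto
    then show ?thesis using op by (auto simp: continuous_map_def top openin_open_subtopology)
  qed
  show ?thesis
  proof
    assume "chart_on T c"
    then have o: "open (snd c ` fst c)"
      and h: "homeomorphic_map (subtopology T (fst c)) (top_of_set (snd c ` fst c)) (snd c)"
      by (simp_all add: chart_on_def case_prod_unfold)
    have "open (snd c ` V)" if "openin T V" "V \<subseteq> fst c" for V
    proof -
      have "openin (subtopology T (fst c)) V" using op that by (simp add: openin_open_subtopology)
      then have "openin (top_of_set (snd c ` fst c)) (snd c ` V)"
        using homeomorphic_imp_open_map[OF h] by (simp add: open_map_def)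
      then show ?thesis using o by (simp add: openin_open_eq)
    qed
    moreover have "continuous_map (subtopology T (fst c)) euclidean (snd c)"
      using homeomorphic_imp_continuous_map[OF h] by (simp add: continuous_map_in_subtopology)
    ultimately show ?R
      using op cont homeomorphic_imp_injective_map[OF h, unfolded top] by simp
  next
    assume R: ?R
    have o: "open (snd c ` fst c)" using R op by blast
    have "homeomorphic_map (subtopology T (fst c)) (top_of_set (snd c ` fst c)) (snd c)"
    proof (rule bijective_open_imp_homeomorphic_map)
      show "continuous_map (subtopology T (fst c)) (top_of_set (snd c ` fst c)) (snd c)"
        using R cont by (simp add: continuous_map_in_subtopology top)
      show "open_map (subtopology T (fst c)) (top_of_set (snd c ` fst c)) (snd c)"
        unfolding open_map_def using R op o by (auto simp: openin_open_subtopology openin_open_eq)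
    qed (use R top in \<open>simp_all del: topspace_subtopology\<close>)
    then show "chart_on T c" using op o by (simp add: chart_on_def case_prod_unfold)
  qed
qed (simp add: chart_on_def case_prod_unfold)

lemma chart_onD:
  assumes "chart_on T c"
  shows "openin T (fst c)" "inj_on (snd c) (fst c)"
    "open N \<Longrightarrow> openin T {x \<in> fst c. snd c x \<in> N}"
    "openin T V \<Longrightarrow> V \<subseteq> fst c \<Longrightarrow> open (snd c ` V)"
  using assms by (simp_all add: chart_on_iff)

lemma coord_map_apply:
  "inj_on (snd c) (fst c) \<Longrightarrow> x \<in> fst c \<Longrightarrow> coord_map c d f (snd c x) = snd d (f x)"
  by (simp add: coord_map_def)

lemma coord_domI: "x \<in> fst c \<Longrightarrow> f x \<in> fst d \<Longrightarrow> snd c x \<in> coord_dom c d f"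
  by (simp add: coord_dom_def)

lemma open_coord_dom:
  assumes c: "chart_on S c" and d: "chart_on X d" and f: "continuous_map S X f"
  shows "open (coord_dom c d f)"
proof -
  have "openin S (fst c \<inter> {x \<in> topspace S. f x \<in> fst d})"
    by (intro openin_Int chart_onD(1)[OF c] openin_continuous_map_preimage[OF f] chart_onD(1)[OF d])
  moreover have "fst c \<inter> {x \<in> topspace S. f x \<in> fst d} = {x \<in> fst c. f x \<in> fst d}"
    using openin_subset[OF chart_onD(1)[OF c]] by auto
  ultimately show ?thesis
    unfolding coord_dom_def by (intro chart_onD(4)[OF c]) auto
qed

text \<open>Replaces the \<open>inv_into\<close> inside \<open>coord_map\<close> by a formula
  \<open>F\<close> that is checked at the points of the manifold. The transition functions of the
  concrete atlases below are all treated in this way, with \<open>W\<close> a convenient open set on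
  which \<open>F\<close> is known to be smooth or slice regular.\<close>

lemma coord_dom_map_eqI:
  assumes c: "chart_on S c"
    and F: "\<And>x. x \<in> fst c \<Longrightarrow> f x \<in> fst d \<Longrightarrow> snd c x \<in> W \<and> snd d (f x) = F (snd c x)"
  shows "coord_dom c d f \<subseteq> W" "y \<in> coord_dom c d f \<Longrightarrow> F y = coord_map c d f y"
proof -
  show "coord_dom c d f \<subseteq> W" using F by (auto simp: coord_dom_def)
  assume "y \<in> coord_dom c d f"
  then obtain x where "x \<in> fst c" "f x \<in> fst d" "y = snd c x" by (auto simp: coord_dom_def)
  then show "F y = coord_map c d f y"
    using F[of x] by (simp add: coord_map_apply[OF chart_onD(2)[OF c]])
qed

lemma smooth_coordI:
  assumes c: "chart_on S c" and d: "chart_on X d" and f: "continuous_map S X f"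
    and W: "smooth_on W F"
    and F: "\<And>x. x \<in> fst c \<Longrightarrow> f x \<in> fst d \<Longrightarrow> snd c x \<in> W \<and> snd d (f x) = F (snd c x)"
  shows "smooth_on (coord_dom c d f) (coord_map c d f)"
  by (rule smooth_on_cong[OF open_coord_dom[OF c d f] smooth_on_subset[OF W]])
    (use coord_dom_map_eqI[OF c F] in auto)

lemma slice_coordI:
  assumes c: "chart_on S c" and d: "chart_on X d" and f: "continuous_map S X f"
    and W: "slice_regular_on W F"
    and F: "\<And>x. x \<in> fst c \<Longrightarrow> f x \<in> fst d \<Longrightarrow> snd c x \<in> W \<and> snd d (f x) = F (snd c x)"
  shows "slice_regular_on (coord_dom c d f) (coord_map c d f)"
  by (rule slice_regular_on_cong[OF open_coord_dom[OF c d f] slice_regular_on_subset[OF W]])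
    (use coord_dom_map_eqI[OF c F] in auto)

lemma smooth_coord_idI:
  assumes "chart_on X c" "chart_on X d" "smooth_on W F"
    "\<And>x. x \<in> fst c \<Longrightarrow> x \<in> fst d \<Longrightarrow> snd c x \<in> W \<and> snd d x = F (snd c x)"
  shows "smooth_on (coord_dom c d id) (coord_map c d id)"
  by (rule smooth_coordI[OF assms(1,2) _ assms(3)]) (use assms(4) in \<open>simp_all add: id_def\<close>)

lemma continuous_map_chart:
  assumes "chart_on T c" "S \<subseteq> fst c"
  shows "continuous_map (subtopology T S) euclidean (snd c)"
proof -
  have U: "openin T (fst c)" by (rule chart_onD(1)[OF assms(1)])
  have "{x \<in> topspace T. x \<in> fst c \<and> snd c x \<in> N} = {x \<in> fst c. snd c x \<in> N}" for N
    using openin_subset[OF U] by auto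
  then have "continuous_map (subtopology T (fst c)) euclidean (snd c)"
    using chart_onD(3)[OF assms(1)]
    by (auto simp: continuous_map_def openin_open_subtopology[OF U])
  then show ?thesis by (rule continuous_map_from_subtopology_mono[OF _ assms(2)])
qed

lemma continuous_map_chart_inverse:
  assumes "chart_on T c"
  shows "continuous_map (top_of_set (snd c ` fst c)) T (inv_into (fst c) (snd c))"
  unfolding continuous_map_def
proof (intro conjI allI impI)
  have U: "openin T (fst c)" and inj: "inj_on (snd c) (fst c)" by (rule chart_onD[OF assms])+
  show "inv_into (fst c) (snd c) \<in> topspace (top_of_set (snd c ` fst c)) \<rightarrow> topspace T"
    using openin_subset[OF U] by (auto simp: inj)
  fix V assume V: "openin T V"
  have "{q \<in> snd c ` fst c. inv_into (fst c) (snd c) q \<in> V} = snd c ` (fst c \<inter> V)"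
    using inj by auto
  moreover have "open (snd c ` (fst c \<inter> V))"
    by (rule chart_onD(4)[OF assms openin_Int[OF U V]]) blast
  ultimately show "openin (top_of_set (snd c ` fst c))
      {q \<in> topspace (top_of_set (snd c ` fst c)). inv_into (fst c) (snd c) q \<in> V}"
    by (simp add: openin_open_eq chart_onD(4)[OF assms U])  (auto)
qed

lemma fst_restrict_chart [simp]: "fst (restrict_chart S c) = fst c \<inter> S"
  and snd_restrict_chart [simp]: "snd (restrict_chart S c) = snd c"
  by (simp_all add: restrict_chart_def case_prod_unfold)

lemma fst_push_chart [simp]: "fst (push_chart \<iota> c) = \<iota> ` fst c"
  by (simp add: push_chart_def case_prod_unfold)

lemma snd_push_chart [simp]: "inj_on \<iota> (fst c) \<Longrightarrow> x \<in> fst c \<Longrightarrow> snd (push_chart \<iota> c) (\<iota> x) = snd c x"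
  by (simp add: push_chart_def case_prod_unfold)

text \<open>Phrased with \<open>topspace X \<inter> S\<close> because the gluing pieces are cut out
  by sets such as the complement of a point in the whole type, which need not be contained in the
  space.\<close>

lemma openin_subtopology_openin:
  assumes "openin X (topspace X \<inter> S)"
  shows "openin (subtopology X S) V \<longleftrightarrow> openin X V \<and> V \<subseteq> S"
  using openin_open_subtopology[OF assms, of V] subtopology_restrict[of X S] openin_subset
  by (metis Int_subset_iff)

lemma chart_on_restrict:
  assumes c: "chart_on T c" and S: "openin T (topspace T \<inter> S)"
  shows "chart_on (subtopology T S) (restrict_chart S c)"
proof -
  have sub: "openin (subtopology T S) V \<longleftrightarrow> openin T V \<and> V \<subseteq> S" for V
    using openin_open_subtopology[OF S, of V] subtopology_restrict[of T S] openin_subset by (metis Int_subset_iff)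
  have "{x \<in> fst c \<inter> S. snd c x \<in> N} = {x \<in> fst c. snd c x \<in> N} \<inter> (topspace T \<inter> S)" for N
    using openin_subset[OF chart_onD(1)[OF c]] by auto
  moreover have "fst c \<inter> S = fst c \<inter> (topspace T \<inter> S)"
    using openin_subset[OF chart_onD(1)[OF c]] by auto
  ultimately show ?thesis
    unfolding chart_on_iff using chart_onD[OF c] S
    by (auto simp: sub intro: inj_on_subset openin_Int)
qed

lemma chart_on_push:
  assumes c: "chart_on Y c" and \<iota>: "continuous_map Y Z \<iota>" "open_map Y Z \<iota>" "inj_on \<iota> (topspace Y)"
  shows "chart_on Z (push_chart \<iota> c)"
proof -
  have U: "fst c \<subseteq> topspace Y" using openin_subset[OF chart_onD(1)[OF c]] .
  have inj: "inj_on \<iota> (fst c)" using inj_on_subset[OF \<iota>(3) U] .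
  have op: "openin Z (\<iota> ` V)" if "openin Y V" for V
    using \<iota>(2) that by (simp add: open_map_def)
  have "open (snd (push_chart \<iota> c) ` V)" if V: "openin Z V" "V \<subseteq> \<iota> ` fst c" for V
  proof -
    let ?V = "{x \<in> topspace Y. \<iota> x \<in> V} \<inter> fst c"
    have "V = \<iota> ` ?V" using V(2) U by auto
    then have "snd (push_chart \<iota> c) ` V = snd (push_chart \<iota> c) ` \<iota> ` ?V" by simp
    also have "\<dots> = snd c ` ?V"
      unfolding image_image using inj by (intro image_cong) auto
    finally show ?thesis
      using chart_onD(4)[OF c openin_Int[OF openin_continuous_map_preimage[OF \<iota>(1) V(1)] chart_onD(1)[OF c]]]
      by simp
  qed
  moreover have "{z \<in> \<iota> ` fst c. snd (push_chart \<iota> c) z \<in> N} = \<iota> ` {x \<in> fst c. snd c x \<in> N}" for N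
    using inj by auto
  moreover have "inj_on (snd (push_chart \<iota> c)) (\<iota> ` fst c)"
    using chart_onD(2)[OF c] inj by (auto simp: inj_on_def)
  ultimately show ?thesis
    unfolding chart_on_iff using op chart_onD[OF c] by simp
qed

section \<open>Charts that factor through a given atlas\<close>

definition diffeo_on ::
    "'n::finite qvec set \<Rightarrow> 'n qvec set \<Rightarrow> ('n qvec \<Rightarrow> 'n qvec) \<Rightarrow> ('n qvec \<Rightarrow> 'n qvec) \<Rightarrow> bool" where
  "diffeo_on P Q \<tau> \<sigma> \<longleftrightarrow> open P \<and> open Q \<and> smooth_on P \<tau> \<and> smooth_on Q \<sigma> \<and>
     (\<forall>y\<in>P. \<tau> y \<in> Q \<and> \<sigma> (\<tau> y) = y) \<and> (\<forall>y\<in>Q. \<sigma> y \<in> P \<and> \<tau> (\<sigma> y) = y)"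

lemma diffeo_onD:
  assumes "diffeo_on P Q \<tau> \<sigma>"
  shows "open P" "open Q" "smooth_on P \<tau>" "smooth_on Q \<sigma>"
    "\<forall>y\<in>P. \<tau> y \<in> Q \<and> \<sigma> (\<tau> y) = y" "\<forall>y\<in>Q. \<sigma> y \<in> P \<and> \<tau> (\<sigma> y) = y"
  using assms unfolding diffeo_on_def by simp_all

text \<open>On its domain \<open>e\<close> is a chart \<open>b\<close> of the other space, pulled
  back along \<open>f\<close> and followed by a diffeomorphism \<tau> of open coordinate sets. The
  latter is required because several charts below agree with a chart of the blow-up only up to an
  affine map, an inversion or \<open>to_HP\<close>.\<close>

definition subordinate :: "'a topology \<Rightarrow> ('a \<Rightarrow> 'b) \<Rightarrow> ('b, 'n::finite) chart set \<Rightarrow> ('a, 'n) chart \<Rightarrow> bool" where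
  "subordinate S f B e \<longleftrightarrow> openin S (fst e) \<and>
     (\<exists>b\<in>B. \<exists>P Q \<tau> \<sigma>. diffeo_on P Q \<tau> \<sigma> \<and>
        (\<forall>x\<in>fst e. f x \<in> fst b \<and> snd b (f x) \<in> P \<and> snd e x = \<tau> (snd b (f x))))"

lemma subordinateE:
  assumes "subordinate S f B e"
  obtains b P Q \<tau> \<sigma> where "b \<in> B" "diffeo_on P Q \<tau> \<sigma>"
    "\<forall>x\<in>fst e. f x \<in> fst b \<and> snd b (f x) \<in> P \<and> snd e x = \<tau> (snd b (f x))"
  using assms unfolding subordinate_def by (elim conjE bexE exE)

lemma subordinateI:
  assumes "openin S (fst e)" "b \<in> B" "\<And>x. x \<in> fst e \<Longrightarrow> f x \<in> fst b \<and> snd e x = snd b (f x)"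
  shows "subordinate S f B e"
  unfolding subordinate_def diffeo_on_def using assms smooth_on_id[OF open_UNIV]
  by (intro conjI bexI[of _ b] exI[of _ "UNIV"] exI[of _ "\<lambda>y. y"]) auto

lemma subordinate_viaI:
  assumes "openin S (fst e)" "b \<in> B" "open P" "open Q" "smooth_on P \<tau>" "smooth_on Q \<sigma>"
    "\<And>y. y \<in> P \<Longrightarrow> \<tau> y \<in> Q \<and> \<sigma> (\<tau> y) = y" "\<And>y. y \<in> Q \<Longrightarrow> \<sigma> y \<in> P \<and> \<tau> (\<sigma> y) = y"
    "\<And>x. x \<in> fst e \<Longrightarrow> f x \<in> fst b \<and> snd b (f x) \<in> P \<and> snd e x = \<tau> (snd b (f x))"
  shows "subordinate S f B e"
  unfolding subordinate_def diffeo_on_def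
  by (rule conjI[OF assms(1)], rule bexI[OF _ assms(2)], rule exI[of _ P], rule exI[of _ Q],
      rule exI[of _ \<tau>], rule exI[of _ \<sigma>]) (use assms(3-) in simp)

lemma subordinate_mono:
  assumes "subordinate S f B e" "B \<subseteq> B'"
  shows "subordinate S f B' e"
proof -
  have op: "openin S (fst e)" using assms(1) by (simp add: subordinate_def)
  obtain b P Q \<tau> \<sigma> where *: "b \<in> B" "diffeo_on P Q \<tau> \<sigma>"
    "\<forall>x\<in>fst e. f x \<in> fst b \<and> snd b (f x) \<in> P \<and> snd e x = \<tau> (snd b (f x))"
    using assms(1) by (rule subordinateE)
  show ?thesis
    by (rule subordinate_viaI[OF op subsetD[OF assms(2) *(1)] diffeo_onD(1-4)[OF *(2)]])
      (use * diffeo_onD(5,6)[OF *(2)] in simp_all)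
qed

lemma chart_on_subordinate:
  assumes B: "\<And>b. b \<in> B \<Longrightarrow> chart_on X b" and f: "homeomorphic_map S X f"
    and e: "subordinate S f B e"
  shows "chart_on S e"
proof -
  obtain b P Q \<tau> \<sigma> where b: "b \<in> B" and D: "diffeo_on P Q \<tau> \<sigma>"
    and val: "\<forall>x\<in>fst e. f x \<in> fst b \<and> snd b (f x) \<in> P \<and> snd e x = \<tau> (snd b (f x))"
    using e by (rule subordinateE)
  note PQ = diffeo_onD(1,2)[OF D] and s = diffeo_onD(3,4)[OF D] and inv = diffeo_onD(5,6)[OF D]
  have op: "openin S (fst e)" using e by (simp add: subordinate_def)
  have cb: "chart_on X b" using B b .
  have top: "fst e \<subseteq> topspace S" using openin_subset[OF op] .
  have f': "continuous_map S X f" "open_map S X f" "inj_on f (topspace S)"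
    using f by (simp_all add: homeomorphic_imp_continuous_map homeomorphic_imp_open_map
        homeomorphic_imp_injective_map)
  have "inj_on (snd e) (fst e)"
  proof (rule inj_onI)
    fix x y assume xy: "x \<in> fst e" "y \<in> fst e" "snd e x = snd e y"
    then have "snd b (f x) = snd b (f y)" using val inv(1) by metis
    then have "f x = f y" using chart_onD(2)[OF cb] val xy by (auto dest: inj_onD)
    then show "x = y" using f'(3) xy top by (auto dest: inj_onD)
  qed
  moreover have "openin S {x \<in> fst e. snd e x \<in> N}" if N: "open N" for N
  proof -
    let ?N = "P \<inter> \<tau> -` N"
    have "open ?N"
      by (rule continuous_open_preimage[OF smooth_on_imp_continuous_on[OF s(1)] PQ(1) N])
    from openin_continuous_map_preimage[OF f'(1) chart_onD(3)[OF cb this]]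
    have "openin S (fst e \<inter> {x \<in> topspace S. f x \<in> {x \<in> fst b. snd b x \<in> ?N}})"
      using op by (intro openin_Int)
    also have "fst e \<inter> {x \<in> topspace S. f x \<in> {x \<in> fst b. snd b x \<in> ?N}} =
        {x \<in> fst e. snd e x \<in> N}" using val top by auto
    finally show ?thesis .
  qed
  moreover have "open (snd e ` V)" if V: "openin S V" "V \<subseteq> fst e" for V
  proof -
    have "open (snd b ` (f ` V))"
      using f'(2) V val by (intro chart_onD(4)[OF cb]) (auto simp: open_map_def)
    then have "open (Q \<inter> \<sigma> -` (snd b ` (f ` V)))"
      by (rule continuous_open_preimage[OF smooth_on_imp_continuous_on[OF s(2)] PQ(2)])
    moreover have "Q \<inter> \<sigma> -` (snd b ` (f ` V)) = snd e ` V"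
    proof (intro set_eqI iffI)
      fix y assume y: "y \<in> Q \<inter> \<sigma> -` (snd b ` (f ` V))"
      then obtain x where x: "x \<in> V" "\<sigma> y = snd b (f x)" by auto
      then have "y = snd e x" using val V(2) inv(2) y by (metis IntD1 subsetD)
      then show "y \<in> snd e ` V" using x by blast
    qed (use val V(2) inv(1) in auto)
    ultimately show ?thesis by simp
  qed
  ultimately show ?thesis unfolding chart_on_iff using op by simp
qed

text \<open>A transition function of \<open>E\<close> is the inverse \<sigma> of one coordinate
  change, then a transition function of \<open>B\<close>, then the other coordinate change
  \<open>\<tau>'\<close>. Each smooth atlas after this point that is not checked by direct
  computation is obtained here, by comparison with one that is already known.\<close>

lemma smooth_atlas_subordinate:
  assumes B: "smooth_atlas X B" and f: "homeomorphic_map S X f"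
    and E: "\<And>e. e \<in> E \<Longrightarrow> subordinate S f B e"
    and cov: "topspace S \<subseteq> (\<Union>e\<in>E. fst e)"
  shows "smooth_atlas S E"
proof -
  have cB: "chart_on X b" if "b \<in> B" for b using B that by (simp add: smooth_atlas_def)
  have cE: "chart_on S e" if "e \<in> E" for e by (rule chart_on_subordinate[OF cB f E[OF that]])
  have "smooth_on (coord_dom e e' id) (coord_map e e' id)" if ee: "e \<in> E" "e' \<in> E" for e e'
  proof -
    obtain b P Q \<tau> \<sigma> where b: "b \<in> B" and d: "diffeo_on P Q \<tau> \<sigma>"
      and val: "\<forall>x\<in>fst e. f x \<in> fst b \<and> snd b (f x) \<in> P \<and> snd e x = \<tau> (snd b (f x))"
      using E[OF ee(1)] by (rule subordinateE)
    note PQ = diffeo_onD(1,2)[OF d] and s = diffeo_onD(3,4)[OF d] and inv = diffeo_onD(5,6)[OF d]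
    obtain b' P' Q' \<tau>' \<sigma>' where b': "b' \<in> B" and d': "diffeo_on P' Q' \<tau>' \<sigma>'"
      and val': "\<forall>x\<in>fst e'. f x \<in> fst b' \<and> snd b' (f x) \<in> P' \<and> snd e' x = \<tau>' (snd b' (f x))"
      using E[OF ee(2)] by (rule subordinateE)
    note PQ' = diffeo_onD(1,2)[OF d'] and s' = diffeo_onD(3,4)[OF d']
    let ?D = "coord_dom b b' id" and ?F = "coord_map b b' id"
    have D: "open ?D" by (rule open_coord_dom[OF cB[OF b] cB[OF b']]) (simp add: id_def)
    have F: "smooth_on ?D ?F" using B b b' by (simp add: smooth_atlas_def)
    \<comment> \<open>\<open>?D'\<close> and \<open>?W\<close> consist of the points at which the
      three maps can be applied in succession.\<close>
    let ?D' = "?D \<inter> ?F -` P'"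
    let ?W = "Q \<inter> \<sigma> -` ?D'"
    have D': "open ?D'"
      by (rule continuous_open_preimage[OF smooth_on_imp_continuous_on[OF F] D PQ'(1)])
    have W: "open ?W"
      by (rule continuous_open_preimage[OF smooth_on_imp_continuous_on[OF s(2)] PQ(2) D'])
    have G0: "smooth_on ?W (\<lambda>y. ?F (\<sigma> y))"
      by (rule smooth_on_compose[OF W D _ F smooth_on_subset[OF s(2)]]) auto
    have G: "smooth_on ?W (\<lambda>y. \<tau>' (?F (\<sigma> y)))"
      by (rule smooth_on_compose[OF W PQ'(1) _ s'(1) G0]) auto
    show ?thesis
    proof (rule smooth_coordI[OF cE[OF ee(1)] cE[OF ee(2)] _ G])
      fix x assume x: "x \<in> fst e" "id x \<in> fst e'"
      then have fx: "f x \<in> fst b" "f x \<in> fst b'" using val val' by auto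
      have "\<sigma> (snd e x) = snd b (f x)" "snd e x \<in> Q" using x val inv(1) by auto
      then show "snd e x \<in> ?W \<and> snd e' (id x) = \<tau>' (?F (\<sigma> (snd e x)))"
        using x fx val' coord_map_apply[OF chart_onD(2)[OF cB[OF b]] fx(1), of b' id]
          coord_domI[of "f x" b id b'] by simp
    qed (simp add: id_def)
  qed
  moreover have "fst e \<subseteq> topspace S" if "e \<in> E" for e
    using openin_subset[OF chart_onD(1)[OF cE[OF that]]] .
  ultimately show ?thesis
    unfolding smooth_atlas_def using cE cov by blast
qed

section \<open>Transport of a regular atlas along a homeomorphism\<close>

definition pull_chart :: "'a topology \<Rightarrow> ('a \<Rightarrow> 'b) \<Rightarrow> ('b, 'n::finite) chart \<Rightarrow> ('a, 'n) chart" where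
  "pull_chart S f c = ({x \<in> topspace S. f x \<in> fst c}, snd c \<circ> f)"

lemma fst_pull_chart [simp]: "fst (pull_chart S f c) = {x \<in> topspace S. f x \<in> fst c}"
  and snd_pull_chart [simp]: "snd (pull_chart S f c) x = snd c (f x)"
  by (simp_all add: pull_chart_def)

text \<open>In pulled-back charts, \<open>f\<close>, its inverse \<open>g\<close> and the identity
  have the same coordinate expressions as the identity in the charts of \<open>C\<close>, namely the
  transition functions of \<open>C\<close>. These are slice regular by assumption, which is the
  content of \<open>reg1\<close>, \<open>reg2\<close> and \<open>reg3\<close>.\<close>

lemma quaternionic_regular_pullback:
  assumes fg: "homeomorphic_maps S X f g" and C: "quaternionic_regular_manifold X C"
  shows "quaternionic_regular_manifold S (pull_chart S f ` C)"
    and "quaternionic_diffeomorphic S (pull_chart S f ` C) X C"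
    and "e \<in> pull_chart S f ` C \<Longrightarrow> subordinate S f C e"
proof -
  have f: "continuous_map S X f" and g: "continuous_map X S g"
    and inv: "\<And>x. x \<in> topspace S \<Longrightarrow> g (f x) = x" "\<And>y. y \<in> topspace X \<Longrightarrow> f (g y) = y"
    using fg by (auto simp: homeomorphic_maps_def)
  have hf: "homeomorphic_map S X f" using fg homeomorphic_map_maps by blast
  have fX: "f x \<in> topspace X" if "x \<in> topspace S" for x
    using f that by (auto simp: continuous_map_def)
  have gS: "g y \<in> topspace S" if "y \<in> topspace X" for y
    using g that by (auto simp: continuous_map_def)
  have C': "Hausdorff_space X" "second_countable X" "smooth_atlas X C" "regular_atlas X C"
    using C by (auto simp: quaternionic_regular_manifold_def regular_atlas_def)
  have cC: "chart_on X c" and reg: "d \<in> C \<Longrightarrow> slice_regular_on (coord_dom c d id) (coord_map c d id)"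
    if "c \<in> C" for c d using C'(4) that by (simp_all add: regular_atlas_def smooth_atlas_def)
  have CX: "fst c \<subseteq> topspace X" if "c \<in> C" for c
    using openin_subset[OF chart_onD(1)[OF cC[OF that]]] .
  have cov: "\<exists>c\<in>C. y \<in> fst c" if "y \<in> topspace X" for y
    using C'(3) that by (auto simp: smooth_atlas_def)
  show sub: "subordinate S f C e" if e: "e \<in> pull_chart S f ` C" for e
  proof -
    obtain c where c: "c \<in> C" "e = pull_chart S f c" using e by blast
    show ?thesis
      by (rule subordinateI[OF _ c(1)])
        (use openin_continuous_map_preimage[OF f chart_onD(1)[OF cC[OF c(1)]]] c(2) in auto)
  qed
  have sB: "smooth_atlas S (pull_chart S f ` C)"
    by (rule smooth_atlas_subordinate[OF C'(3) hf sub]) (use fX cov in auto)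
  then have cB: "chart_on S (pull_chart S f c)" if "c \<in> C" for c
    using that by (simp add: smooth_atlas_def)
  note app = coord_map_apply[OF chart_onD(2)[OF cC]] and dom = coord_domI
  have S: "S homeomorphic_space X" using fg by (auto simp: homeomorphic_space_def)
  have reg1: "slice_regular_on (coord_dom (pull_chart S f c) (pull_chart S f d) id)
      (coord_map (pull_chart S f c) (pull_chart S f d) id)" if cd: "c \<in> C" "d \<in> C" for c d
    by (rule slice_coordI[OF cB[OF cd(1)] cB[OF cd(2)] _ reg[OF cd]])
      (use app[OF cd(1), of _ d id] dom[of _ c id d] in \<open>auto simp: id_def\<close>)
  have reg2: "slice_regular_on (coord_dom (pull_chart S f c) d f)
      (coord_map (pull_chart S f c) d f)" if cd: "c \<in> C" "d \<in> C" for c d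
    by (rule slice_coordI[OF cB[OF cd(1)] cC[OF cd(2)] f reg[OF cd]])
      (use app[OF cd(1), of _ d id] dom[of _ c id d] in auto)
  have reg3: "slice_regular_on (coord_dom c (pull_chart S f d) g)
      (coord_map c (pull_chart S f d) g)" if cd: "c \<in> C" "d \<in> C" for c d
    by (rule slice_coordI[OF cC[OF cd(1)] cB[OF cd(2)] g reg[OF cd]])
      (use app[OF cd(1), of _ d id] dom[of _ c id d] inv CX[OF cd(1)] in auto)
  have sm: "slice_regular_on W h \<Longrightarrow> smooth_on W h" for W and h :: "'c qvec \<Rightarrow> 'c qvec"
    by (simp add: slice_regular_on_def)
  show "quaternionic_regular_manifold S (pull_chart S f ` C)"
    using C'(1,2) sB reg1 homeomorphic_Hausdorff_space[OF S] homeomorphic_space_second_countability[OF S]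
    by (auto simp: quaternionic_regular_manifold_def regular_atlas_def)
  have "quaternionic_regular_map S (pull_chart S f ` C) X C f"
    unfolding quaternionic_regular_map_def smooth_map_def
  proof (intro conjI ballI f)
    fix p assume "p \<in> topspace S"
    moreover from this obtain d where "d \<in> C" "f p \<in> fst d" using cov fX by blast
    ultimately show "\<exists>c\<in>pull_chart S f ` C. \<exists>d\<in>C. p \<in> fst c \<and> f p \<in> fst d \<and>
        slice_regular_on (coord_dom c d f) (coord_map c d f)"
      using reg2 by (intro bexI[of _ "pull_chart S f d"] bexI[of _ d]) auto
  qed (use reg2 sm in auto)
  moreover have "quaternionic_regular_map X C S (pull_chart S f ` C) g"
    unfolding quaternionic_regular_map_def smooth_map_def
  proof (intro conjI ballI g)
    fix p assume "p \<in> topspace X"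
    moreover from this obtain d where "d \<in> C" "p \<in> fst d" using cov by blast
    ultimately show "\<exists>c\<in>C. \<exists>d\<in>pull_chart S f ` C. p \<in> fst c \<and> g p \<in> fst d \<and>
        slice_regular_on (coord_dom c d g) (coord_map c d g)"
      using reg3 inv gS by (intro bexI[of _ d] bexI[of _ "pull_chart S f d"]) auto
  qed (use reg3 sm in auto)
  ultimately show "quaternionic_diffeomorphic S (pull_chart S f ` C) X C"
    unfolding quaternionic_diffeomorphic_def using fg by blast
qed

section \<open>Gluing and quotient spaces\<close>

lemma image_Plus_split:
  assumes "K \<subseteq> S <+> R"
  shows "h ` K = (\<lambda>x. h (Inl x)) ` {x \<in> S. Inl x \<in> K} \<union> (\<lambda>y. h (Inr y)) ` {y \<in> R. Inr y \<in> K}"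
proof -
  have "K = Inl ` {x \<in> S. Inl x \<in> K} \<union> Inr ` {y \<in> R. Inr y \<in> K}" using assms by auto
  then have "h ` K = h ` (Inl ` {x \<in> S. Inl x \<in> K} \<union> Inr ` {y \<in> R. Inr y \<in> K})" by (rule arg_cong)
  then show ?thesis by (simp only: image_Un image_image)
qed

lemma quotient_map_glue_class:
  "quotient_map (disjoint_sum_topology X Y) (glue_topology X Y G) (glue_class G)"
  unfolding quotient_map_def glue_topology_def
  by (simp add: topspace_quotient_topology openin_quotient_topology)

lemma topspace_disjoint_sum_topology:
  "topspace (disjoint_sum_topology X Y) = topspace X <+> topspace Y"
proof -
  have "{x \<in> topspace X. Inl x \<in> topspace X <+> topspace Y} = topspace X"
    "{y \<in> topspace Y. Inr y \<in> topspace X <+> topspace Y} = topspace Y" by auto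
  then have "openin (disjoint_sum_topology X Y) (topspace X <+> topspace Y)"
    by (simp add: openin_disjoint_sum_topology)
  then have "topspace X <+> topspace Y \<subseteq> topspace (disjoint_sum_topology X Y)"
    by (rule openin_subset)
  moreover have "topspace (disjoint_sum_topology X Y) \<subseteq> topspace X <+> topspace Y"
    using openin_topspace[of "disjoint_sum_topology X Y"]
    unfolding openin_disjoint_sum_topology by (elim conjE)
  ultimately show ?thesis by (rule subset_antisym[rotated])
qed

lemma topspace_glue_topology:
  "topspace (glue_topology X Y G) = glue_left G ` topspace X \<union> glue_right G ` topspace Y"
  unfolding glue_topology_def topspace_quotient_topology topspace_disjoint_sum_topology Plus_def
    glue_left_def glue_right_def by (simp add: image_Un image_image)

lemma openin_glue_topology:
  "openin (glue_topology X Y G) V \<longleftrightarrow> V \<subseteq> topspace (glue_topology X Y G) \<and>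
     openin X {x \<in> topspace X. glue_left G x \<in> V} \<and> openin Y {y \<in> topspace Y. glue_right G y \<in> V}"
proof -
  let ?Z = "{z \<in> topspace (disjoint_sum_topology X Y). glue_class G z \<in> V}"
  have "{x \<in> topspace X. Inl x \<in> ?Z} = {x \<in> topspace X. glue_left G x \<in> V}"
    "{y \<in> topspace Y. Inr y \<in> ?Z} = {y \<in> topspace Y. glue_right G y \<in> V}"
    by (auto simp: topspace_disjoint_sum_topology glue_left_def glue_right_def)
  moreover have "openin (glue_topology X Y G) V \<longleftrightarrow> V \<subseteq> topspace (glue_topology X Y G) \<and>
      openin (disjoint_sum_topology X Y) ?Z"
    unfolding glue_topology_def openin_quotient_topology topspace_quotient_topology ..
  moreover have "?Z \<subseteq> topspace X <+> topspace Y" by (auto simp: topspace_disjoint_sum_topology)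
  ultimately show ?thesis by (simp only: openin_disjoint_sum_topology simp_thms)
qed

lemma closedin_glue_topology:
  "closedin (glue_topology X Y G) V \<longleftrightarrow> V \<subseteq> topspace (glue_topology X Y G) \<and>
     closedin X {x \<in> topspace X. glue_left G x \<in> V} \<and> closedin Y {y \<in> topspace Y. glue_right G y \<in> V}"
proof -
  let ?T = "topspace (glue_topology X Y G)"
  have "{x \<in> topspace X. glue_left G x \<in> ?T - V} = topspace X - {x \<in> topspace X. glue_left G x \<in> V}"
    "{y \<in> topspace Y. glue_right G y \<in> ?T - V} = topspace Y - {y \<in> topspace Y. glue_right G y \<in> V}"
    by (auto simp: topspace_glue_topology)
  then show ?thesis
    unfolding closedin_def by (auto simp: openin_glue_topology[of X Y G "?T - V"])
qed

lemma closedin_disjoint_sum_topologyD: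
  assumes "closedin (disjoint_sum_topology X Y) K"
  shows "closedin X {x \<in> topspace X. Inl x \<in> K}" "closedin Y {y \<in> topspace Y. Inr y \<in> K}"
proof -
  let ?T = "topspace (disjoint_sum_topology X Y)"
  have "{x \<in> topspace X. Inl x \<in> ?T - K} = topspace X - {x \<in> topspace X. Inl x \<in> K}"
    "{y \<in> topspace Y. Inr y \<in> ?T - K} = topspace Y - {y \<in> topspace Y. Inr y \<in> K}"
    by (auto simp: topspace_disjoint_sum_topology)
  moreover have "openin (disjoint_sum_topology X Y) (?T - K)" using assms by blast
  ultimately show "closedin X {x \<in> topspace X. Inl x \<in> K}" "closedin Y {y \<in> topspace Y. Inr y \<in> K}"
    unfolding openin_disjoint_sum_topology closedin_def by auto
qed

lemma continuous_map_disjoint_sum: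
  assumes "continuous_map X Z (\<lambda>x. h (Inl x))" "continuous_map Y Z (\<lambda>y. h (Inr y))"
  shows "continuous_map (disjoint_sum_topology X Y) Z h"
  unfolding continuous_map_def
proof (intro conjI allI impI)
  show "h \<in> topspace (disjoint_sum_topology X Y) \<rightarrow> topspace Z"
    using assms by (auto simp: continuous_map_def topspace_disjoint_sum_topology)
  fix V assume V: "openin Z V"
  let ?Z = "{z \<in> topspace (disjoint_sum_topology X Y). h z \<in> V}"
  have "{x \<in> topspace X. Inl x \<in> ?Z} = {x \<in> topspace X. h (Inl x) \<in> V}"
    "{y \<in> topspace Y. Inr y \<in> ?Z} = {y \<in> topspace Y. h (Inr y) \<in> V}"
    by (auto simp: topspace_disjoint_sum_topology)
  then show "openin (disjoint_sum_topology X Y) ?Z"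
    using openin_continuous_map_preimage[OF assms(1) V] openin_continuous_map_preimage[OF assms(2) V]
    by (auto simp: openin_disjoint_sum_topology topspace_disjoint_sum_topology)
qed

lemma continuous_map_glue_left: "continuous_map X (glue_topology X Y G) (glue_left G)"
  and continuous_map_glue_right: "continuous_map Y (glue_topology X Y G) (glue_right G)"
  unfolding continuous_map_def by (auto simp: topspace_glue_topology openin_glue_topology)

text \<open>The relation \<open>r\<close> leads only from the left summand to the right one, so
  consecutive steps go back and forth between the summands. As \<open>G\<close> is the graph of a
  partial injection, two such steps return to the starting point, and \<open>r\<close>, its converse
  and the identity together already form the equivalence relation.\<close>

lemma glue_class_eq_iff:
  assumes "single_valued G" "single_valued (G\<inverse>)"
  defines "r \<equiv> (\<lambda>(x, y). (Inl x, Inr y)) ` G"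
  shows "glue_class G z = glue_class G z' \<longleftrightarrow> z = z' \<or> (z, z') \<in> r \<or> (z', z) \<in> r"
proof -
  have step: "(u, w) \<in> Id \<union> r \<union> r\<inverse>" if "(u, v) \<in> Id \<union> r \<union> r\<inverse>" "(v, w) \<in> r \<union> r\<inverse>" for u v w
    using that assms(1,2) unfolding r_def single_valued_def by fastforce
  have "(u, v) \<in> Id \<union> r \<union> r\<inverse>" if "(u, v) \<in> (r \<union> r\<inverse>)\<^sup>*" for u v
    using that by (induction rule: rtrancl_induct) (use step in blast)+
  then have rt: "(r \<union> r\<inverse>)\<^sup>* = Id \<union> r \<union> r\<inverse>" by auto
  have "equiv UNIV ((r \<union> r\<inverse>)\<^sup>*)"
    by (rule equivI) (auto intro: refl_rtrancl sym_rtrancl sym_Un_converse trans_rtrancl)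
  then have "glue_class G z = glue_class G z' \<longleftrightarrow> (z, z') \<in> (r \<union> r\<inverse>)\<^sup>*"
    unfolding glue_class_def Let_def r_def by (rule eq_equiv_class_iff) simp_all
  then show ?thesis unfolding rt by auto
qed

lemma glue_eq_iff:
  assumes "single_valued G" "single_valued (G\<inverse>)"
  shows "glue_left G x = glue_left G x' \<longleftrightarrow> x = x'"
    and "glue_right G y = glue_right G y' \<longleftrightarrow> y = y'"
    and "glue_left G x = glue_right G y \<longleftrightarrow> (x, y) \<in> G"
    and "glue_right G y = glue_left G x \<longleftrightarrow> (x, y) \<in> G"
  unfolding glue_left_def glue_right_def glue_class_eq_iff[OF assms] by force+

text \<open>The preimage of \<open>glue_left G\<close> in its own piece gives back the open set;
  what remains is its preimage in the other piece, the set of partners under \<open>G\<close>, whose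
  openness is the last hypothesis.\<close>

lemma open_map_glue_left:
  assumes G: "single_valued G" "single_valued (G\<inverse>)"
    and op: "\<And>V. openin X V \<Longrightarrow> openin Y {y \<in> topspace Y. \<exists>x\<in>V. (x, y) \<in> G}"
  shows "open_map X (glue_topology X Y G) (glue_left G)"
  unfolding open_map_def
proof (intro allI impI)
  fix V assume V: "openin X V"
  have "{x \<in> topspace X. glue_left G x \<in> glue_left G ` V} = V"
    "{y \<in> topspace Y. glue_right G y \<in> glue_left G ` V} = {y \<in> topspace Y. \<exists>x\<in>V. (x, y) \<in> G}"
    using openin_subset[OF V] by (auto simp: image_iff glue_eq_iff[OF G])
  then show "openin (glue_topology X Y G) (glue_left G ` V)"
    using op V openin_subset[OF V] by (auto simp: openin_glue_topology topspace_glue_topology)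
qed

lemma open_map_glue_right:
  assumes G: "single_valued G" "single_valued (G\<inverse>)"
    and op: "\<And>V. openin Y V \<Longrightarrow> openin X {x \<in> topspace X. \<exists>y\<in>V. (x, y) \<in> G}"
  shows "open_map Y (glue_topology X Y G) (glue_right G)"
  unfolding open_map_def
proof (intro allI impI)
  fix V assume V: "openin Y V"
  have "{y \<in> topspace Y. glue_right G y \<in> glue_right G ` V} = V"
    "{x \<in> topspace X. glue_left G x \<in> glue_right G ` V} = {x \<in> topspace X. \<exists>y\<in>V. (x, y) \<in> G}"
    using openin_subset[OF V] by (auto simp: image_iff glue_eq_iff[OF G])
  then show "openin (glue_topology X Y G) (glue_right G ` V)"
    using op V openin_subset[OF V] by (auto simp: openin_glue_topology topspace_glue_topology)
qed

lemma separated_open_images: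
  assumes X: "Hausdorff_space X" and \<iota>: "open_map X Z \<iota>" "inj \<iota>"
    and x: "x \<in> topspace X" "y \<in> topspace X" "\<iota> x \<noteq> \<iota> y"
  shows "\<exists>U V. openin Z U \<and> openin Z V \<and> \<iota> x \<in> U \<and> \<iota> y \<in> V \<and> disjnt U V"
proof -
  have "x \<noteq> y" using x(3) by auto
  then obtain U V where "openin X U" "openin X V" "x \<in> U" "y \<in> V" "disjnt U V"
    using X x(1,2) unfolding Hausdorff_space_def by blast
  then show ?thesis
    using \<iota> by (intro exI[of _ "\<iota> ` U"] exI[of _ "\<iota> ` V"]) (auto simp: open_map_def disjnt_iff dest: injD)
qed

text \<open>Separation is only in doubt for points that are not both in one of the two pieces.\<close>

lemma Hausdorff_glue_topology:
  assumes G: "single_valued G" "single_valued (G\<inverse>)"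
    and X: "Hausdorff_space X" and Y: "Hausdorff_space Y"
    and left: "open_map X (glue_topology X Y G) (glue_left G)"
    and right: "open_map Y (glue_topology X Y G) (glue_right G)"
    and sep: "\<And>x y. x \<in> topspace X \<Longrightarrow> y \<in> topspace Y \<Longrightarrow> x \<notin> Domain G \<Longrightarrow> y \<notin> Range G \<Longrightarrow>
      \<exists>U V. openin X U \<and> openin Y V \<and> x \<in> U \<and> y \<in> V \<and> G \<inter> U \<times> V = {}"
    and dom: "G \<subseteq> topspace X \<times> topspace Y"
  shows "Hausdorff_space (glue_topology X Y G)"
proof -
  let ?Z = "glue_topology X Y G" and ?l = "glue_left G" and ?r = "glue_right G"
  let ?P = "\<lambda>u v. \<exists>U V. openin ?Z U \<and> openin ?Z V \<and> u \<in> U \<and> v \<in> V \<and> disjnt U V"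
  note eq = glue_eq_iff[OF G]
  have sym: "?P u v" if "?P v u" for u v
    using that by (elim exE conjE, intro exI conjI) (assumption | rule disjnt_sym)+
  have oL: "openin ?Z (?l ` U)" if "openin X U" for U using left that by (simp add: open_map_def)
  have oR: "openin ?Z (?r ` U)" if "openin Y U" for U using right that by (simp add: open_map_def)
  have ll: "?P (?l x) (?l x')" if "x \<in> topspace X" "x' \<in> topspace X" "?l x \<noteq> ?l x'" for x x'
    by (rule separated_open_images[OF X left _ that]) (simp add: inj_on_def eq)
  have rr: "?P (?r x) (?r x')" if "x \<in> topspace Y" "x' \<in> topspace Y" "?r x \<noteq> ?r x'" for x x'
    by (rule separated_open_images[OF Y right _ that]) (simp add: inj_on_def eq)
  have lr: "?P (?l x) (?r y)" if xy: "x \<in> topspace X" "y \<in> topspace Y" "?l x \<noteq> ?r y" for x y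
  proof -
    consider (x) y' where "(x, y') \<in> G" | (y) x' where "(x', y) \<in> G" | (n) "x \<notin> Domain G" "y \<notin> Range G"
      by blast
    then show ?thesis
    proof cases
      case x
      then have "?l x = ?r y'" "y' \<in> topspace Y" using dom by (auto simp: eq)
      then show ?thesis using rr[of y' y] xy by simp
    next
      case y
      then have "?r y = ?l x'" "x' \<in> topspace X" using dom by (auto simp: eq)
      then show ?thesis using ll[of x x'] xy by simp
    next
      case n
      then obtain U V where "openin X U" "openin Y V" "x \<in> U" "y \<in> V" "G \<inter> U \<times> V = {}"
        using sep[OF xy(1,2) n] by blast
      then show ?thesis
        by (intro exI[of _ "?l ` U"] exI[of _ "?r ` V"]) (auto simp: oL oR disjnt_iff eq)
    qed
  qed
  show ?thesis
    unfolding Hausdorff_space_def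
  proof (intro allI impI)
    fix u v assume uv: "u \<in> topspace ?Z \<and> v \<in> topspace ?Z \<and> u \<noteq> v"
    then consider (ll) x x' where "x \<in> topspace X" "x' \<in> topspace X" "u = ?l x" "v = ?l x'"
      | (rr) x x' where "x \<in> topspace Y" "x' \<in> topspace Y" "u = ?r x" "v = ?r x'"
      | (lr) x y where "x \<in> topspace X" "y \<in> topspace Y" "u = ?l x" "v = ?r y"
      | (rl) x y where "x \<in> topspace X" "y \<in> topspace Y" "v = ?l x" "u = ?r y"
      unfolding topspace_glue_topology by blast
    then show "?P u v"
    proof cases
      case ll': ll
      show ?thesis unfolding ll'(3,4) by (rule ll) (use ll' uv in simp_all)
    next
      case rr': rr
      show ?thesis unfolding rr'(3,4) by (rule rr) (use rr' uv in simp_all)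
    next
      case lr': lr
      show ?thesis unfolding lr'(3,4) by (rule lr) (use lr' uv in simp_all)
    next
      case rl
      show ?thesis unfolding rl(3,4) by (rule sym[OF lr]) (use rl uv in metis)+
    qed
  qed
qed

section \<open>Second countability\<close>

lemma second_countable_UN:
  assumes "countable I" and op: "\<And>i. i \<in> I \<Longrightarrow> openin X (U i)"
    and sc: "\<And>i. i \<in> I \<Longrightarrow> second_countable (subtopology X (U i))"
    and cov: "topspace X \<subseteq> (\<Union>i\<in>I. U i)"
  shows "second_countable X"
proof -
  have "\<exists>\<B>. countable \<B> \<and> (\<forall>V\<in>\<B>. openin X V) \<and>
      (\<forall>V x. openin X V \<and> x \<in> V \<and> x \<in> U i \<longrightarrow> (\<exists>B\<in>\<B>. x \<in> B \<and> B \<subseteq> V))" if i: "i \<in> I" for i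
  proof -
    obtain \<B> where \<B>: "countable \<B>" "\<forall>V\<in>\<B>. openin (subtopology X (U i)) V"
      "\<forall>V x. openin (subtopology X (U i)) V \<and> x \<in> V \<longrightarrow> (\<exists>B\<in>\<B>. x \<in> B \<and> B \<subseteq> V)"
      using sc[OF i] unfolding second_countable_def by blast
    have sub: "openin (subtopology X (U i)) V \<longleftrightarrow> openin X V \<and> V \<subseteq> U i" for V
      by (rule openin_open_subtopology[OF op[OF i]])
    have "\<exists>B\<in>\<B>. x \<in> B \<and> B \<subseteq> V" if V: "openin X V \<and> x \<in> V \<and> x \<in> U i" for V x
    proof -
      have "openin (subtopology X (U i)) (V \<inter> U i)" using V op[OF i] by (auto simp: sub)
      then obtain B where "B \<in> \<B>" "x \<in> B" "B \<subseteq> V \<inter> U i" using \<B>(3)[rule_format, of "V \<inter> U i" x] V by auto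
      then show ?thesis by blast
    qed
    then show ?thesis using \<B>(1,2) sub by (intro exI[of _ \<B>]) auto
  qed
  then have "\<forall>i\<in>I. \<exists>\<B>. countable \<B> \<and> (\<forall>V\<in>\<B>. openin X V) \<and>
      (\<forall>V x. openin X V \<and> x \<in> V \<and> x \<in> U i \<longrightarrow> (\<exists>B\<in>\<B>. x \<in> B \<and> B \<subseteq> V))" by (rule ballI)
  from bchoice[OF this] obtain \<B> where *: "\<forall>i\<in>I. countable (\<B> i) \<and> (\<forall>V\<in>\<B> i. openin X V) \<and>
      (\<forall>V x. openin X V \<and> x \<in> V \<and> x \<in> U i \<longrightarrow> (\<exists>B\<in>\<B> i. x \<in> B \<and> B \<subseteq> V))" ..
  have \<B>: "\<And>i. i \<in> I \<Longrightarrow> countable (\<B> i)" "\<And>i V. i \<in> I \<Longrightarrow> V \<in> \<B> i \<Longrightarrow> openin X V"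
    "\<And>i V x. i \<in> I \<Longrightarrow> openin X V \<Longrightarrow> x \<in> V \<Longrightarrow> x \<in> U i \<Longrightarrow> \<exists>B\<in>\<B> i. x \<in> B \<and> B \<subseteq> V"
    using * by simp_all
  have "\<exists>B\<in>(\<Union>i\<in>I. \<B> i). x \<in> B \<and> B \<subseteq> V" if V: "openin X V" "x \<in> V" for V x
  proof -
    obtain i where i: "i \<in> I" "x \<in> U i" using cov openin_subset[OF V(1)] V(2) by blast
    then show ?thesis using \<B>(3)[OF i(1) V i(2)] i(1) by auto
  qed
  then show ?thesis
    unfolding second_countable_def using assms(1) \<B>(1,2)
    by (intro exI[of _ "\<Union>i\<in>I. \<B> i"]) auto
qed

lemma second_countable_open_embedding:
  assumes "continuous_map Y X \<iota>" "open_map Y X \<iota>" "second_countable Y"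
  shows "second_countable (subtopology X (\<iota> ` topspace Y))"
proof (rule second_countable_open_map_image[OF _ _ _ assms(3)])
  have o: "openin X (\<iota> ` topspace Y)" using assms(2) by (simp add: open_map_def)
  show "continuous_map Y (subtopology X (\<iota> ` topspace Y)) \<iota>"
    using assms(1) by (simp add: continuous_map_in_subtopology)
  show "open_map Y (subtopology X (\<iota> ` topspace Y)) \<iota>"
    using assms(2) openin_subset unfolding open_map_def openin_open_subtopology[OF o] by blast
  show "\<iota> ` topspace Y = topspace (subtopology X (\<iota> ` topspace Y))"
    using openin_subset[OF o] by auto
qed

lemma second_countable_euclidean:
  "second_countable (euclidean :: 'a::second_countable_topology topology)"
proof -
  obtain \<B> :: "'a set set" where \<B>: "countable \<B>" "\<And>V. V \<in> \<B> \<Longrightarrow> open V"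
    "\<And>U. open U \<Longrightarrow> \<exists>\<U>. \<U> \<subseteq> \<B> \<and> U = \<Union>\<U>"
    by (rule univ_second_countable) blast
  have "\<exists>V\<in>\<B>. x \<in> V \<and> V \<subseteq> U" if "open U" "x \<in> U" for U x
    using \<B>(3)[OF that(1)] that(2) by auto
  then show ?thesis
    unfolding second_countable_def using \<B>(1,2) by (intro exI[of _ \<B>]) auto
qed

lemma second_countable_chart:
  assumes "chart_on X c"
  shows "second_countable (subtopology X (fst c))"
proof -
  have "homeomorphic_map (subtopology X (fst c)) (top_of_set (snd c ` fst c)) (snd c)"
    using assms by (simp add: chart_on_def case_prod_unfold)
  then have "subtopology X (fst c) homeomorphic_space top_of_set (snd c ` fst c)"
    by (rule homeomorphic_map_imp_homeomorphic_space)
  moreover have "second_countable (top_of_set (snd c ` fst c))"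
    by (rule second_countable_subtopology[OF second_countable_euclidean])
  ultimately show ?thesis by (simp add: homeomorphic_space_second_countability)
qed

text \<open>To be applied with \<open>X\<close> the disjoint sum of the two pieces of the connected
  sum. It has both the connected sum and the blow-up as quotients, and comparing fibres gives the
  homeomorphism without constructing its inverse by hand.\<close>

lemma quotient_maps_homeomorphic:
  assumes p: "quotient_map X Y p" and q: "quotient_map X Z q"
    and fib: "\<And>x x'. x \<in> topspace X \<Longrightarrow> x' \<in> topspace X \<Longrightarrow> p x = p x' \<longleftrightarrow> q x = q x'"
  obtains f g where "homeomorphic_maps Y Z f g" "\<And>x. x \<in> topspace X \<Longrightarrow> f (p x) = q x"
proof -
  obtain f where f: "continuous_map Y Z f" "\<And>x. x \<in> topspace X \<Longrightarrow> f (p x) = q x"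
    using quotient_map_lift_exists[OF p quotient_imp_continuous_map[OF q]] fib by metis
  obtain g where g: "continuous_map Z Y g" "\<And>x. x \<in> topspace X \<Longrightarrow> g (q x) = p x"
    using quotient_map_lift_exists[OF q quotient_imp_continuous_map[OF p]] fib by metis
  have "g (f y) = y" if y: "y \<in> topspace Y" for y
  proof -
    obtain x where "x \<in> topspace X" "y = p x" using y quotient_imp_surjective_map[OF p] by blast
    then show ?thesis using f(2) g(2) by simp
  qed
  moreover have "f (g y) = y" if y: "y \<in> topspace Z" for y
  proof -
    obtain x where "x \<in> topspace X" "y = q x" using y quotient_imp_surjective_map[OF q] by blast
    then show ?thesis using f(2) g(2) by simp
  qed
  ultimately have "homeomorphic_maps Y Z f g"
    unfolding homeomorphic_maps_def using f g by blast
  then show thesis using that f(2) by blast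
qed

section \<open>Quaternionic projective space and the blow-up of the origin\<close>

definition qcnj :: "quat \<Rightarrow> quat" where
  "qcnj x = Quat (qre x) (- qim1 x) (- qim2 x) (- qim3 x)"

lemma qcnj_mult: "qcnj (x * y) = qcnj y * qcnj x"
  by (simp add: qcnj_def times_quat_def algebra_simps)

lemma mult_qcnj: "x * qcnj x = (norm x)\<^sup>2 *\<^sub>R 1" and qcnj_mult_self: "qcnj x * x = (norm x)\<^sup>2 *\<^sub>R 1"
  unfolding norm_quat_sq
  by (simp_all add: qcnj_def times_quat_def one_quat_def scaleR_quat_def power2_eq_square algebra_simps)

lemma qcnj_qcnj [simp]: "qcnj (qcnj x) = x"
  by (simp add: qcnj_def)

lemma norm_qcnj [simp]: "norm (qcnj x) = norm x"
proof -
  have "(norm (qcnj x))\<^sup>2 = (norm x)\<^sup>2" unfolding norm_quat_sq by (simp add: qcnj_def)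
  then show ?thesis by (simp add: power2_eq_iff_nonneg)
qed

lemma qcnj_0 [simp]: "qcnj 0 = 0" and qcnj_1 [simp]: "qcnj 1 = 1"
  by (simp_all add: qcnj_def zero_quat_def one_quat_def)

lemma qcnj_eq_0 [simp]: "qcnj x = 0 \<longleftrightarrow> x = 0"
  using norm_qcnj[of x] by (metis norm_eq_zero)

lemma qcnj_scaleR: "qcnj (r *\<^sub>R x) = r *\<^sub>R qcnj x"
  by (simp add: qcnj_def scaleR_quat_def)

lemma bounded_linear_qcnj: "bounded_linear qcnj"
  by (intro linear_conv_bounded_linear[THEN iffD1] linearI)
    (simp_all add: qcnj_def scaleR_quat_def plus_quat_def)

lemma inverse_eq_qcnj: "inverse x = qcnj x /\<^sub>R (norm x)\<^sup>2" for x :: quat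
  by (simp add: inverse_quat_def qcnj_def)

definition rscale :: "'m::finite qvec \<Rightarrow> quat \<Rightarrow> 'm qvec" where
  "rscale a l = (\<chi> k. a $ k * l)"

lemma rscale_nth [simp]: "rscale a l $ k = a $ k * l"
  by (simp add: rscale_def)

lemma rscale_rscale: "rscale (rscale a l) m = rscale a (l * m)"
  by (simp add: vec_eq_iff mult.assoc)

lemma rscale_1 [simp]: "rscale a 1 = a"
  by (simp add: vec_eq_iff)

lemma rscale_0 [simp]: "rscale a 0 = 0" "rscale 0 l = 0"
  by (simp_all add: vec_eq_iff)

lemma rscale_scaleR: "rscale a (r *\<^sub>R l) = r *\<^sub>R rscale a l"
  by (simp add: vec_eq_iff)

lemma norm_rscale: "norm (rscale a l) = norm a * norm l"
  by (simp add: norm_vec_def norm_mult L2_set_left_distrib)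

lemma rscale_eq_0: "rscale a l = 0 \<longleftrightarrow> a = 0 \<or> l = 0"
  by (metis mult_eq_0_iff norm_eq_zero norm_rscale)

lemma rscale_cancel: "rscale a l = rscale a m \<Longrightarrow> a \<noteq> 0 \<Longrightarrow> l = m"
  by (auto simp: vec_eq_iff)

lemma mem_qline: "q \<in> qline a \<longleftrightarrow> (\<exists>l. q = rscale a l)"
  by (simp add: qline_def rscale_def)

lemma rscale_in_qline [simp]: "rscale a l \<in> qline a"
  by (auto simp: mem_qline)

lemma self_in_qline [simp]: "a \<in> qline a"
  using rscale_in_qline[of a 1] by simp

lemma qline_rscale:
  assumes "l \<noteq> 0"
  shows "qline (rscale a l) = qline a"
proof -
  have "rscale a m = rscale (rscale a l) (inverse l * m)" for m
    using assms by (simp add: rscale_rscale mult.assoc[symmetric])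
  then show ?thesis by (auto simp: set_eq_iff mem_qline rscale_rscale)
qed

lemma qline_eqD:
  assumes "qline a = qline b" "b \<noteq> 0"
  obtains l where "l \<noteq> 0" "b = rscale a l"
proof -
  have "b \<in> qline a" using assms(1) by simp
  then obtain l where "b = rscale a l" by (auto simp: mem_qline)
  then show thesis using that assms(2) by (auto simp: rscale_eq_0)
qed

lemma qline_eq_memI: "q \<in> qline a \<Longrightarrow> q \<noteq> 0 \<Longrightarrow> qline a = qline q"
  by (auto simp: mem_qline qline_rscale rscale_eq_0)

lemma HP_iff: "L \<in> HP \<longleftrightarrow> (\<exists>a. a \<noteq> 0 \<and> L = qline a)"
  by (auto simp: HP_def)

lemma qline_in_HP: "a \<noteq> 0 \<Longrightarrow> qline a \<in> HP"
  by (auto simp: HP_iff)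

text \<open>\<open>hom_coords\<close> is a choice, hence known only up to a right factor
  \<open>l\<close>. The two lemmas that follow collect the invariants of this factor from which the
  charts are built.\<close>

lemma hom_coords_qline:
  assumes "a \<noteq> 0"
  obtains l where "l \<noteq> 0" "hom_coords (qline a) = rscale a l"
proof -
  have "hom_coords (qline a) \<noteq> 0 \<and> qline (hom_coords (qline a)) = qline a"
    unfolding hom_coords_def by (rule someI[of _ a]) (use assms in simp)
  then show thesis by (metis qline_eqD that)
qed

lemma hom_coords_nth_eq_0: "a \<noteq> 0 \<Longrightarrow> hom_coords (qline a) $ i = 0 \<longleftrightarrow> a $ i = 0"
  by (rule hom_coords_qline) auto

lemma hom_coords_ratio:
  assumes "a \<noteq> 0"
  shows "hom_coords (qline a) $ k * inverse (hom_coords (qline a) $ i) = a $ k * inverse (a $ i)"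
proof -
  obtain l where l: "l \<noteq> 0" "hom_coords (qline a) = rscale a l" by (rule hom_coords_qline[OF assms])
  show ?thesis
  \<comment> \<open>If the denominator vanishes, both sides are 0 because
    \<open>inverse 0 = 0\<close>.\<close>
  proof (cases "a $ i = 0")
    case False
    then have "a $ k * l * inverse (a $ i * l) = a $ k * (l * inverse l) * inverse (a $ i)"
      using l by (simp only: nonzero_inverse_mult_distrib[OF False l(1)] mult.assoc)
    then show ?thesis using l by simp
  qed (simp add: l)
qed

section \<open>The topology of projective space\<close>

lemma quotient_map_qline: "quotient_map (top_of_set (- {0})) HP_topology qline"
  unfolding quotient_map_def HP_topology_def
  by (simp add: topspace_quotient_topology openin_quotient_topology)

lemma topspace_HP_topology [simp]: "topspace HP_topology = HP"
  by (simp add: HP_topology_def topspace_quotient_topology HP_def)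

lemma openin_HP_topology:
  "openin HP_topology V \<longleftrightarrow> V \<subseteq> HP \<and> open {a. a \<noteq> 0 \<and> qline a \<in> V}"
proof -
  have "openin (top_of_set (- {0})) {a \<in> - {0}. qline a \<in> V} \<longleftrightarrow> open {a. a \<noteq> 0 \<and> qline a \<in> V}"
    by (subst openin_open_eq) auto
  then show ?thesis
    by (simp add: HP_topology_def openin_quotient_topology HP_def)
qed

lemma closedin_HP_topology:
  "closedin HP_topology V \<longleftrightarrow> V \<subseteq> HP \<and> open {a. a \<noteq> 0 \<and> qline a \<notin> V}"
proof -
  have "{a. a \<noteq> 0 \<and> qline a \<in> HP - V} = {a. a \<noteq> 0 \<and> qline a \<notin> V}"
    by (auto simp: qline_in_HP)
  then show ?thesis by (auto simp: closedin_def openin_HP_topology)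
qed

text \<open>A quotient map restricts to a quotient map over open and over closed sets. The open case
  serves the charts, the closed case the complement of the ball, on which the inversion is
  defined.\<close>

lemma continuous_map_from_HP_subtopology:
  assumes V: "openin HP_topology V \<or> closedin HP_topology V"
    and h: "continuous_map (top_of_set {a. a \<noteq> 0 \<and> qline a \<in> V}) Z (\<lambda>a. h (qline a))"
  shows "continuous_map (subtopology HP_topology V) Z h"
proof -
  have "quotient_map (subtopology (top_of_set (- {0})) {a. a \<noteq> 0 \<and> qline a \<in> V}) (subtopology HP_topology V) qline"
    by (rule quotient_map_restriction[OF quotient_map_qline _ V]) auto
  moreover have "subtopology (top_of_set (- {0})) {a. a \<noteq> 0 \<and> qline a \<in> V} = top_of_set {a. a \<noteq> 0 \<and> qline a \<in> V}"
    by (simp add: subtopology_subtopology) (rule arg_cong[where f = "subtopology euclidean"], auto)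
  ultimately show ?thesis
    using h by (intro continuous_compose_quotient_map[of _ _ qline]) (auto simp: o_def)
qed

lemma continuous_map_qline:
  assumes "continuous_map Z euclidean f" "\<And>x. x \<in> topspace Z \<Longrightarrow> f x \<noteq> 0"
  shows "continuous_map Z HP_topology (\<lambda>x. qline (f x))"
proof -
  have "continuous_map Z (top_of_set (- {0})) f"
    using assms by (auto intro: continuous_map_into_subtopology)
  from continuous_map_compose[OF this quotient_imp_continuous_map[OF quotient_map_qline]]
  show ?thesis by (simp add: o_def)
qed

text \<open>Every line meets the compact unit sphere. Compactness is later the reason why the
  inversion carries closed sets to closed sets.\<close>

lemma compact_space_HP: "compact_space (HP_topology :: 'm::finite qvec set topology)"
proof -
  let ?S = "sphere 0 1 :: 'm qvec set"
  have "compactin (top_of_set (- {0})) ?S"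
    by (auto simp: compactin_subtopology)
  then have "compactin HP_topology (qline ` ?S)"
    by (rule image_compactin) (rule quotient_imp_continuous_map[OF quotient_map_qline])
  moreover have "qline ` ?S = HP"
  proof (intro set_eqI iffI)
    fix L :: "'m qvec set" assume "L \<in> HP"
    then obtain a where a: "a \<noteq> 0" "L = qline a" by (auto simp: HP_iff)
    let ?l = "inverse (norm a) *\<^sub>R 1 :: quat"
    have "norm (rscale a ?l) = 1" using a(1) by (simp add: norm_rscale)
    moreover have "L = qline (rscale a ?l)" using a by (subst qline_rscale) simp_all
    ultimately show "L \<in> qline ` ?S" by (intro image_eqI[of _ _ "rscale a ?l"]) simp_all
  qed (auto intro: qline_in_HP)
  ultimately show ?thesis by (simp add: compact_space_def)
qed

text \<open>A line is determined by the orthogonal projection onto it.\<close>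

lemma Hausdorff_space_HP: "Hausdorff_space (HP_topology :: 'm::finite qvec set topology)"
proof -
  \<comment> \<open>The matrix of the orthogonal projection onto the line of \<open>a\<close>:
    \<open>a\<close> times its conjugate transpose, divided by the squared norm.\<close>
  define M where "M = (\<lambda>a :: 'm qvec. (\<chi> j k. (a $ j * qcnj (a $ k)) /\<^sub>R (norm a)\<^sup>2) :: ((quat, 'm) vec, 'm) vec)"
  have M: "M (rscale a l) = M a" if "l \<noteq> 0" for a l
  proof -
    have "a $ j * l * qcnj (a $ k * l) = (norm l)\<^sup>2 *\<^sub>R (a $ j * qcnj (a $ k))" for j k
    proof -
      have "a $ j * l * qcnj (a $ k * l) = a $ j * (l * qcnj l) * qcnj (a $ k)"
        by (simp only: qcnj_mult mult.assoc)
      then show ?thesis by (simp add: mult_qcnj)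
    qed
    then show ?thesis
      using that by (simp add: M_def vec_eq_iff norm_rscale power_mult_distrib)
  qed
  have hM: "M (hom_coords (qline a)) = M a" if "a \<noteq> 0" for a
    using M hom_coords_qline[OF that] by metis
  have "continuous_on (- {0}) M"
    unfolding M_def
    by (intro continuous_intros continuous_on_vec_lambda bounded_linear.continuous_on[OF bounded_linear_qcnj]) auto
  then have c: "continuous_map (top_of_set (- {0})) euclidean ((\<lambda>L. M (hom_coords L)) \<circ> qline)"
    by (simp add: o_def) (rule continuous_on_cong[THEN iffD1, rotated 2], auto simp: hM)
  have "L = L'" if LL: "L \<in> HP" "L' \<in> HP" "M (hom_coords L) = M (hom_coords L')" for L L'
  proof -
    obtain a b where ab: "a \<noteq> 0" "L = qline a" "b \<noteq> 0" "L' = qline b"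
      using LL by (auto simp: HP_iff)
    then have eq: "(a $ j * qcnj (a $ k)) /\<^sub>R (norm a)\<^sup>2 = (b $ j * qcnj (b $ k)) /\<^sub>R (norm b)\<^sup>2" for j k
      using LL(3) hM by (simp add: M_def vec_eq_iff)
    obtain k where k: "a $ k \<noteq> 0" using ab(1) by (auto simp: vec_eq_iff)
    \<comment> \<open>Column \<open>k\<close> of the projection matrix is a right multiple of
      \<open>a\<close> by a factor that is not 0 because \<open>a $ k \<noteq> 0\<close>. The same
      column is a right multiple of \<open>b\<close>; dividing by the first factor expresses
      \<open>a\<close> through \<open>b\<close>.\<close>
    have "a = rscale b ((norm a)\<^sup>2 *\<^sub>R (qcnj (b $ k) /\<^sub>R (norm b)\<^sup>2) * inverse (qcnj (a $ k)))"
    proof (unfold vec_eq_iff, intro allI)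
      fix j
      have "a $ j * qcnj (a $ k) = (norm a)\<^sup>2 *\<^sub>R (b $ j * qcnj (b $ k) /\<^sub>R (norm b)\<^sup>2)"
        using arg_cong[OF eq[of j k], of "scaleR ((norm a)\<^sup>2)"] ab(1) by simp
      then have "a $ j * qcnj (a $ k) * inverse (qcnj (a $ k)) =
          (norm a)\<^sup>2 *\<^sub>R (b $ j * qcnj (b $ k) /\<^sub>R (norm b)\<^sup>2) * inverse (qcnj (a $ k))" by simp
      then show "a $ j = rscale b ((norm a)\<^sup>2 *\<^sub>R (qcnj (b $ k) /\<^sub>R (norm b)\<^sup>2) * inverse (qcnj (a $ k))) $ j"
        using k by (simp add: mult.assoc)
    qed
    then have "qline a = qline b" using ab(1) qline_rscale by (metis rscale_0(1))
    then show ?thesis using ab by simp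
  qed
  then have "inj_on (\<lambda>L. M (hom_coords L)) (topspace HP_topology)" by (auto intro: inj_onI)
  then show ?thesis
    by (rule Hausdorff_space_injective_preimage[OF Hausdorff_space_euclidean
        continuous_compose_quotient_map[OF quotient_map_qline c]])
qed

text \<open>The point of a line with \<open>i\<close>-th coordinate \<open>1\<close>; the \<open>i\<close>-th entry of \<open>y\<close> is ignored.\<close>

definition slot_one :: "'n::finite \<Rightarrow> 'n qvec \<Rightarrow> 'n qvec" where
  "slot_one i y = (\<chi> k. if k = i then 1 else y $ k)"

lemma slot_one_nth [simp]: "slot_one i y $ k = (if k = i then 1 else y $ k)"
  by (simp add: slot_one_def)

lemma slot_one_neq_0 [simp]: "slot_one i y \<noteq> 0"
  by (metis slot_one_nth zero_index zero_neq_one)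

text \<open>The projection of the blow-up to its first factor, in the coordinates of
  \<open>Bl0_chart i\<close>: slot \<open>i\<close> of \<open>y\<close> holds \<open>q $ i\<close>,
  the other slots the ratios that determine the line.\<close>

definition blow_down :: "'n::finite \<Rightarrow> 'n qvec \<Rightarrow> 'n qvec" where
  "blow_down i y = rscale (slot_one i y) (y $ i)"

definition Bl0_param :: "'n::finite \<Rightarrow> 'n qvec \<Rightarrow> 'n qvec \<times> 'n qvec set" where
  "Bl0_param i y = (blow_down i y, qline (slot_one i y))"

lemma snd_Bl0_chart:
  assumes "a \<noteq> 0"
  shows "snd (Bl0_chart i) (q, qline a) = (\<chi> k. if k = i then q $ i else a $ k * inverse (a $ i))"
  by (simp add: Bl0_chart_def hom_coords_ratio[OF assms] cong: if_cong)

lemma fst_Bl0_chart: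
  "a \<noteq> 0 \<Longrightarrow> (q, qline a) \<in> fst (Bl0_chart i) \<longleftrightarrow> q \<in> qline a \<and> a $ i \<noteq> 0"
  by (simp add: Bl0_chart_def Bl0_def hom_coords_nth_eq_0 qline_in_HP)

lemma Bl0_chart_param:
  shows "Bl0_param i y \<in> fst (Bl0_chart i)" "snd (Bl0_chart i) (Bl0_param i y) = y"
  unfolding Bl0_param_def
  by (simp_all add: fst_Bl0_chart snd_Bl0_chart blow_down_def) (simp add: vec_eq_iff)

lemma Bl0_param_chart:
  assumes "z \<in> fst (Bl0_chart i)"
  shows "Bl0_param i (snd (Bl0_chart i) z) = z"
proof -
  obtain q L where z: "z = (q, L)" by (cases z)
  then have "L \<in> HP" using assms by (auto simp: Bl0_chart_def Bl0_def)
  then obtain a where a: "a \<noteq> 0" "L = qline a" by (auto simp: HP_iff)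
  then have q: "q \<in> qline a" and i: "a $ i \<noteq> 0" using assms z by (simp_all add: fst_Bl0_chart)
  obtain l where l: "q = rscale a l" using q by (auto simp: mem_qline)
  let ?y = "snd (Bl0_chart i) z"
  have y: "?y = (\<chi> k. if k = i then q $ i else a $ k * inverse (a $ i))"
    using a by (simp add: z snd_Bl0_chart)
  have s: "slot_one i ?y = rscale a (inverse (a $ i))"
    using i by (simp add: vec_eq_iff y)
  have "rscale a l = rscale (slot_one i ?y) (?y $ i)"
    using i by (simp only: s rscale_rscale) (simp add: y l mult.assoc[symmetric])
  moreover have "qline (slot_one i ?y) = qline a" using i by (simp add: s qline_rscale)
  ultimately show ?thesis by (simp add: Bl0_param_def blow_down_def z a l)
qed

lemma Bl0_chart_cover: "z \<in> Bl0 \<Longrightarrow> \<exists>i. z \<in> fst (Bl0_chart i)"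
proof -
  assume z: "z \<in> Bl0"
  then obtain q a where a: "z = (q, qline a)" "a \<noteq> 0" "q \<in> qline a" by (auto simp: Bl0_def HP_iff)
  then obtain i where "a $ i \<noteq> 0" by (auto simp: vec_eq_iff)
  then show ?thesis using a by (auto simp: fst_Bl0_chart)
qed

lemma topspace_Bl0_topology [simp]: "topspace Bl0_topology = Bl0"
  by (auto simp: Bl0_topology_def Bl0_def)

lemma continuous_map_Bl0:
  assumes "continuous_map Z euclidean f" "continuous_map Z euclidean g"
    "\<And>x. x \<in> topspace Z \<Longrightarrow> g x \<noteq> 0 \<and> f x \<in> qline (g x)"
  shows "continuous_map Z Bl0_topology (\<lambda>x. (f x, qline (g x)))"
  unfolding Bl0_topology_def
  by (rule continuous_map_into_subtopology)
    (use assms in \<open>auto intro!: continuous_map_pairedI continuous_map_qline simp: Bl0_def qline_in_HP\<close>)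

lemma continuous_map_fst_Bl0: "continuous_map Bl0_topology euclidean fst"
  unfolding Bl0_topology_def by (intro continuous_map_from_subtopology continuous_map_fst)

lemma Hausdorff_space_Bl0: "Hausdorff_space Bl0_topology"
  unfolding Bl0_topology_def
  by (intro Hausdorff_space_subtopology) (simp add: Hausdorff_space_prod_topology Hausdorff_space_HP)

lemma continuous_slot_one: "continuous_on S (slot_one i)"
proof -
  have "continuous_on S (\<lambda>y. if k = i then 1 else y $ k)" for k
    by (cases "k = i") (auto intro!: continuous_intros)
  then show ?thesis unfolding slot_one_def by (intro continuous_on_vec_lambda)
qed

lemma continuous_blow_down: "continuous_on S (blow_down i)"
proof -
  have "continuous_on S (\<lambda>y. slot_one i y $ k * y $ i)" for k
    by (intro continuous_intros continuous_slot_one)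
  then show ?thesis unfolding blow_down_def rscale_def by (intro continuous_on_vec_lambda)
qed

lemma continuous_map_Bl0_param: "continuous_map euclidean Bl0_topology (Bl0_param i)"
  unfolding Bl0_param_def[abs_def]
  by (rule continuous_map_Bl0) (simp_all add: continuous_slot_one continuous_blow_down, simp add: blow_down_def)

text \<open>Continuity holds because ratios of homogeneous coordinates descend to the quotient. The
  inverse \<open>Bl0_param i\<close> is defined and continuous on the whole coordinate space, so the
  image of an open set under the chart is a preimage under \<open>Bl0_param i\<close>.\<close>

lemma chart_on_Bl0: "chart_on Bl0_topology (Bl0_chart i)"
proof -
  let ?V = "{L \<in> HP. hom_coords L $ i \<noteq> 0}"
  have pre: "{a. a \<noteq> 0 \<and> qline a \<in> ?V} = {a. a $ i \<noteq> 0}"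
  proof (intro set_eqI)
    show "a \<in> {a. a \<noteq> 0 \<and> qline a \<in> ?V} \<longleftrightarrow> a \<in> {a. a $ i \<noteq> 0}" for a
      by (cases "a = 0") (simp_all add: qline_in_HP hom_coords_nth_eq_0)
  qed
  have oV: "openin HP_topology ?V"
    unfolding openin_HP_topology pre by (auto intro!: open_Collect_neq continuous_intros)
  define r where "r = (\<lambda>L :: 'a qvec set. \<chi> k. hom_coords L $ k * inverse (hom_coords L $ i))"
  have r: "continuous_map (subtopology HP_topology ?V) euclidean r"
  proof (rule continuous_map_from_HP_subtopology)
    have "continuous_on {a. a $ i \<noteq> 0} (\<lambda>a :: 'a qvec. \<chi> k. a $ k * inverse (a $ i))"
      by (intro continuous_on_vec_lambda continuous_intros) auto
    moreover have "(\<chi> k. a $ k * inverse (a $ i)) = r (qline a)" if "a \<in> {a. a $ i \<noteq> 0}" for a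
    proof -
      have "a \<noteq> 0" using that by auto
      then show ?thesis by (simp add: r_def hom_coords_ratio)
    qed
    ultimately have "continuous_on {a. a $ i \<noteq> 0} (\<lambda>a. r (qline a))"
      by (rule continuous_on_eq)
    then show "continuous_map (top_of_set {a. a \<noteq> 0 \<and> qline a \<in> ?V}) euclidean (\<lambda>a. r (qline a))"
      unfolding pre by simp
  qed (use oV in blast)
  have fst_eq: "fst (Bl0_chart i) = Bl0 \<inter> (UNIV \<times> ?V)"
    by (auto simp: Bl0_chart_def Bl0_def)
  have oU: "openin (prod_topology euclidean HP_topology) (UNIV \<times> ?V)"
    using oV by (simp add: openin_prod_Times_iff)
  then have op: "openin Bl0_topology (fst (Bl0_chart i))"
    unfolding fst_eq Bl0_topology_def by (rule openin_subtopology_Int2)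
  have "continuous_map (prod_topology euclidean (subtopology HP_topology ?V)) (prod_topology euclidean euclidean)
      (\<lambda>z. (fst z, r (snd z)))"
    by (intro continuous_map_pairedI continuous_map_fst continuous_map_compose[OF continuous_map_snd r, unfolded o_def])
  moreover have "continuous_on UNIV (\<lambda>w :: 'a qvec \<times> 'a qvec. \<chi> k. if k = i then fst w $ i else snd w $ k)"
  proof (rule continuous_on_vec_lambda)
    show "continuous_on UNIV (\<lambda>w :: 'a qvec \<times> 'a qvec. if k = i then fst w $ i else snd w $ k)" for k
      by (cases "k = i") (auto intro!: continuous_intros)
  qed
  ultimately have "continuous_map (prod_topology euclidean (subtopology HP_topology ?V)) euclidean
      (\<lambda>z. \<chi> k. if k = i then fst z $ i else r (snd z) $ k)"
    using continuous_map_compose[of _ "prod_topology euclidean euclidean" "\<lambda>z. (fst z, r (snd z))" euclidean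
        "\<lambda>w. \<chi> k. if k = i then fst w $ i else snd w $ k"]
    by (simp add: o_def cong: if_cong)
  moreover have "snd (Bl0_chart i) z = (\<chi> k. if k = i then fst z $ i else r (snd z) $ k)" for z
    by (simp add: Bl0_chart_def r_def case_prod_unfold cong: if_cong)
  ultimately have c0: "continuous_map (prod_topology euclidean (subtopology HP_topology ?V)) euclidean (snd (Bl0_chart i))"
    by (simp add: continuous_map_eq)
  have pt: "prod_topology euclidean (subtopology HP_topology ?V) =
      subtopology (prod_topology euclidean HP_topology) (UNIV \<times> ?V)"
    by (simp add: prod_topology_subtopology)
  have c: "continuous_map (subtopology Bl0_topology (fst (Bl0_chart i))) euclidean (snd (Bl0_chart i))"
    unfolding Bl0_topology_def subtopology_subtopology fst_eq
    by (rule continuous_map_from_subtopology_mono[OF c0[unfolded pt]]) blast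
  have "openin Bl0_topology {x \<in> fst (Bl0_chart i). snd (Bl0_chart i) x \<in> N}" if "open N" for N
  proof -
    have "{x \<in> topspace (subtopology Bl0_topology (fst (Bl0_chart i))). snd (Bl0_chart i) x \<in> N} =
        {x \<in> fst (Bl0_chart i). snd (Bl0_chart i) x \<in> N}"
      using openin_subset[OF op] by auto
    then show ?thesis
      using openin_continuous_map_preimage[OF c, of N] that by (simp add: openin_open_subtopology[OF op])
  qed
  moreover have "inj_on (snd (Bl0_chart i)) (fst (Bl0_chart i))"
    by (rule inj_on_inverseI[of _ "Bl0_param i"]) (rule Bl0_param_chart)
  moreover have "open (snd (Bl0_chart i) ` V)" if V: "openin Bl0_topology V" "V \<subseteq> fst (Bl0_chart i)" for V
  proof -
    have "snd (Bl0_chart i) ` V = {y. Bl0_param i y \<in> V}"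
      using V(2) Bl0_chart_param[of i] Bl0_param_chart[of _ i] by (auto simp: image_iff) (metis)
    then show ?thesis
      using openin_continuous_map_preimage[OF continuous_map_Bl0_param V(1), of i] by simp
  qed
  ultimately show ?thesis unfolding chart_on_iff using op by blast
qed

lemma second_countable_Bl0: "second_countable (Bl0_topology :: ('n::finite qvec \<times> 'n qvec set) topology)"
proof (rule second_countable_UN[of "UNIV :: 'n set" _ "\<lambda>i. fst (Bl0_chart i)"])
  show "topspace Bl0_topology \<subseteq> (\<Union>i\<in>(UNIV :: 'n set). fst (Bl0_chart i))"
    using Bl0_chart_cover by auto
qed (auto intro: chart_onD(1)[OF chart_on_Bl0] second_countable_chart[OF chart_on_Bl0] countable_finite)

section \<open>Coordinate changes of the blow-up\<close>

lemma slice_component_nth: "slice_component W (\<lambda>q. q $ a)"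
  using slice_component_single[OF slice_preserving_ident, of W a 0] by simp

lemma smooth_slot_one: "open W \<Longrightarrow> smooth_on W (slot_one i)"
  unfolding slot_one_def
proof (rule smooth_on_vec)
  fix k assume W: "open W"
  show "smooth_on W (\<lambda>y. if k = i then 1 else y $ k)"
    by (cases "k = i") (simp_all add: smooth_on_const[OF W] smooth_on_nth[OF W smooth_on_id[OF W]])
qed

text \<open>Covers both directions between \<open>\<phi>\<^sub>0\<close> and \<open>\<phi>\<close>:
  each component depends on a single variable, the dilation factor is real, and the translation may
  be by arbitrary quaternions.\<close>

lemma slice_regular_affine: "slice_regular_on UNIV (\<lambda>q. r *\<^sub>R q + b)"
  unfolding slice_regular_on_components
proof (intro conjI allI)
  show "smooth_on UNIV (\<lambda>q :: 'a qvec. r *\<^sub>R q + b)"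
    by (intro smooth_on_add smooth_on_scaleR smooth_on_const smooth_on_id) auto
  show "slice_component UNIV (\<lambda>q. (r *\<^sub>R q + b) $ k)" for k
    using slice_component_single[OF slice_preserving_scaleR, of UNIV k r "b $ k"] by simp
qed

lemma slice_regular_ident: "slice_regular_on UNIV (\<lambda>q. q)"
  using slice_regular_affine[of 1 0] by simp

lemma smooth_blow_down: "smooth_on UNIV (blow_down i)"
  unfolding blow_down_def rscale_def
  by (intro smooth_on_vec smooth_on_mult smooth_on_nth smooth_slot_one smooth_on_id) auto

lemma blow_down_nth: "blow_down i y $ k = (if k = i then y $ i else y $ k * y $ i)"
  by (simp add: blow_down_def)

lemma slice_regular_blow_down: "slice_regular_on UNIV (blow_down i)"
  unfolding slice_regular_on_components
proof (intro conjI allI smooth_blow_down)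
  show "slice_component UNIV (\<lambda>q. blow_down i q $ k)" for k
    using slice_component_product[OF slice_preserving_ident slice_preserving_ident, of k i UNIV]
    by (cases "k = i") (simp_all add: blow_down_nth slice_component_nth)
qed

text \<open>The local inverse of \<open>blow_down i\<close>: the chart coordinates of the only point
  of the blow-up over a vector with \<open>q $ i \<noteq> 0\<close>.\<close>

definition blow_up :: "'n::finite \<Rightarrow> 'n qvec \<Rightarrow> 'n qvec" where
  "blow_up i q = (\<chi> k. if k = i then q $ i else q $ k * inverse (q $ i))"

lemma snd_Bl0_chart_blow_up: "q \<noteq> 0 \<Longrightarrow> snd (Bl0_chart i) (q, qline q) = blow_up i q"
  by (simp add: snd_Bl0_chart blow_up_def)

lemma open_nth_neq: "open {q :: 'n::finite qvec. q $ i \<noteq> 0}"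
  by (intro open_Collect_neq continuous_intros)

lemma smooth_blow_up: "smooth_on {q. q $ i \<noteq> 0} (blow_up i)"
  unfolding blow_up_def
proof (rule smooth_on_vec[OF open_nth_neq])
  fix k
  note o = open_nth_neq[of i]
  have "smooth_on {q :: 'a qvec. q $ i \<noteq> 0} (\<lambda>q. q $ k * inverse (q $ i))"
    by (intro smooth_on_mult[OF o] smooth_on_inverse[OF o] smooth_on_nth[OF o] smooth_on_id[OF o]) simp
  then show "smooth_on {q :: 'a qvec. q $ i \<noteq> 0} (\<lambda>q. if k = i then q $ i else q $ k * inverse (q $ i))"
    by (cases "k = i") (simp_all add: smooth_on_nth[OF o smooth_on_id[OF o]])
qed

lemma slice_regular_blow_up: "slice_regular_on {q. q $ i \<noteq> 0} (blow_up i)"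
  unfolding slice_regular_on_components
proof (intro conjI allI smooth_blow_up)
  show "slice_component {q. q $ i \<noteq> 0} (\<lambda>q. blow_up i q $ k)" for k
    using slice_component_product[OF slice_preserving_ident slice_preserving_inverse, of k i "{q. q $ i \<noteq> 0}"]
    by (cases "k = i") (simp_all add: blow_up_def slice_component_nth)
qed

definition Bl0_transition :: "'n::finite \<Rightarrow> 'n \<Rightarrow> 'n qvec \<Rightarrow> 'n qvec" where
  "Bl0_transition i j y =
     (\<chi> k. if k = j then blow_down i y $ j else slot_one i y $ k * inverse (slot_one i y $ j))"

lemma snd_Bl0_chart_param: "snd (Bl0_chart j) (Bl0_param i y) = Bl0_transition i j y"
  by (simp add: Bl0_param_def snd_Bl0_chart Bl0_transition_def)

lemma open_slot_one_neq: "open {y. slot_one i y $ j \<noteq> 0}"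
  by (intro open_Collect_neq continuous_intros continuous_slot_one)

lemma smooth_Bl0_transition: "smooth_on {y. slot_one i y $ j \<noteq> 0} (Bl0_transition i j)"
  unfolding Bl0_transition_def
proof (rule smooth_on_vec[OF open_slot_one_neq])
  fix k
  note o = open_slot_one_neq[of i j]
  have "smooth_on {y. slot_one i y $ j \<noteq> 0} (\<lambda>y. slot_one i y $ k * inverse (slot_one i y $ j))"
    by (intro smooth_on_mult[OF o] smooth_on_inverse[OF o] smooth_on_nth[OF o] smooth_slot_one[OF o]) simp
  then show "smooth_on {y. slot_one i y $ j \<noteq> 0}
      (\<lambda>y. if k = j then blow_down i y $ j else slot_one i y $ k * inverse (slot_one i y $ j))"
    using smooth_on_nth[OF o smooth_on_subset[OF smooth_blow_down[of i]], of j]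
    by (cases "k = j") (simp_all del: slot_one_nth)
qed

text \<open>For \<open>i \<noteq> j\<close> the components are \<open>y $ j * y $ i\<close> in slot
  \<open>j\<close>, \<open>inverse (y $ j)\<close> in slot \<open>i\<close>, and
  \<open>y $ k * inverse (y $ j)\<close> in the other slots. No component has more than two factors,
  and those depend on different variables, so the one- and two-variable lemmas cover all
  cases.\<close>

lemma slice_regular_Bl0_transition:
  "slice_regular_on {y. slot_one i y $ j \<noteq> 0} (Bl0_transition i j)"
  unfolding slice_regular_on_components
proof (intro conjI allI smooth_Bl0_transition)
  fix k
  let ?W = "{y. slot_one i y $ j \<noteq> 0}"
  note prod = slice_component_product[OF slice_preserving_ident slice_preserving_ident, of k i ?W]
  note quot = slice_component_product[OF slice_preserving_ident slice_preserving_inverse, of k j ?W]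
  note inv = slice_component_single[OF slice_preserving_inverse, of ?W j 0]
  consider "k = j" "k = i" | "k = j" "k \<noteq> i" | "k \<noteq> j" "i = j" | "k = i" "i \<noteq> j" | "k \<noteq> i" "k \<noteq> j" "i \<noteq> j"
    by blast
  then show "slice_component ?W (\<lambda>q. Bl0_transition i j q $ k)"
    by cases (use prod quot inv in
      \<open>simp_all add: Bl0_transition_def blow_down_nth slice_component_nth del: slot_one_nth\<close>,
      use prod quot inv in \<open>simp_all add: slice_component_nth\<close>)
qed

section \<open>The blow-up at a point\<close>

text \<open>Keeps the chart \<open>(U, \<phi>\<^sub>0)\<close> of the atlas apart from its
  normalization, which need not belong to \<open>A\<close>.\<close>

locale blowup_setup =
  fixes T :: "'a topology" and A :: "('a, 'n::{finite,linorder}) chart set" and p :: 'a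
    and U :: "'a set" and \<phi>\<^sub>0 :: "'a \<Rightarrow> 'n qvec" and r :: real
  assumes M: "quaternionic_regular_manifold T A"
    and c0_A: "(U, \<phi>\<^sub>0) \<in> A" and p_U: "p \<in> U" and r_pos: "r > 0"
    and ball_sub: "cball 0 1 \<subseteq> (\<lambda>x. r *\<^sub>R (\<phi>\<^sub>0 x - \<phi>\<^sub>0 p)) ` U"
begin

definition \<phi> :: "'a \<Rightarrow> 'n qvec" where "\<phi> x = r *\<^sub>R (\<phi>\<^sub>0 x - \<phi>\<^sub>0 p)"
definition c :: "('a, 'n) chart" where "c = (U, \<phi>)"
abbreviation c0 :: "('a, 'n) chart" where "c0 \<equiv> (U, \<phi>\<^sub>0)"
definition G :: "('a \<times> ('n qvec \<times> 'n qvec set)) set" where "G = blowup_gluing p c"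
abbreviation XL :: "'a topology" where "XL \<equiv> subtopology T (- {p})"
abbreviation XR :: "('n qvec \<times> 'n qvec set) topology" where
  "XR \<equiv> subtopology Bl0_topology {(q, L). q \<in> \<phi> ` U}"
definition X where "X = blowup_topology T p c"

lemma fst_c [simp]: "fst c = U" and snd_c [simp]: "snd c = \<phi>"
  by (simp_all add: c_def)

lemma X_eq: "X = glue_topology XL XR G"
  by (simp add: X_def blowup_topology_def G_def)

lemma T_Hausdorff: "Hausdorff_space T" and T_second: "second_countable T"
  and A_smooth: "smooth_atlas T A"
  using M by (simp_all add: quaternionic_regular_manifold_def regular_atlas_def)

lemma A_chart: "d \<in> A \<Longrightarrow> chart_on T d"
  and A_trans: "d \<in> A \<Longrightarrow> e \<in> A \<Longrightarrow> slice_regular_on (coord_dom d e id) (coord_map d e id)"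
  using M by (simp_all add: quaternionic_regular_manifold_def regular_atlas_def smooth_atlas_def)

lemma A_trans_smooth: "d \<in> A \<Longrightarrow> e \<in> A \<Longrightarrow> smooth_on (coord_dom d e id) (coord_map d e id)"
  using A_trans by (simp add: slice_regular_on_def)

lemma A_cover: "x \<in> topspace T \<Longrightarrow> \<exists>d\<in>A. x \<in> fst d"
  using A_smooth by (auto simp: smooth_atlas_def)

lemma subordinate_affine:
  assumes "openin S (fst e)" "b \<in> B" "\<And>x. x \<in> fst e \<Longrightarrow> f x \<in> fst b \<and> snd e x = r *\<^sub>R (snd b (f x) - \<phi>\<^sub>0 p)"
  shows "subordinate S f B e"
proof (rule subordinate_viaI[OF assms(1,2), where P = UNIV and Q = UNIV
      and \<tau> = "\<lambda>y. r *\<^sub>R y + - (r *\<^sub>R \<phi>\<^sub>0 p)" and \<sigma> = "\<lambda>y. inverse r *\<^sub>R y + \<phi>\<^sub>0 p"])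
  show "smooth_on UNIV (\<lambda>y. r *\<^sub>R y + - (r *\<^sub>R \<phi>\<^sub>0 p))" "smooth_on UNIV (\<lambda>y. inverse r *\<^sub>R y + \<phi>\<^sub>0 p)"
    using slice_regular_affine unfolding slice_regular_on_def by blast+
qed (use assms(3) r_pos in \<open>auto simp: scaleR_right_diff_distrib scaleR_right_distrib\<close>)

lemma c_chart: "chart_on T c"
proof (rule chart_on_subordinate[where f = id])
  show "subordinate T id A c"
    by (rule subordinate_affine[OF _ c0_A]) (use chart_onD(1)[OF A_chart[OF c0_A]] in \<open>auto simp: \<phi>_def\<close>)
qed (auto intro: A_chart)

lemma U_open: "openin T U" and \<phi>_inj: "inj_on \<phi> U"
  using chart_onD(1,2)[OF c_chart] by simp_all

lemma U_sub: "U \<subseteq> topspace T"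
  by (rule openin_subset[OF U_open])

lemma \<phi>_p [simp]: "\<phi> p = 0"
  by (simp add: \<phi>_def)

lemma \<phi>_eq_0: "x \<in> U \<Longrightarrow> \<phi> x = 0 \<longleftrightarrow> x = p"
  using inj_onD[OF \<phi>_inj, of x p] p_U by auto

lemma open_\<phi>_image: "openin T V \<Longrightarrow> V \<subseteq> U \<Longrightarrow> open (\<phi> ` V)"
  using chart_onD(4)[OF c_chart] by simp

lemma ball_sub': "norm q \<le> 1 \<Longrightarrow> q \<in> \<phi> ` U"
  using ball_sub by (auto simp: \<phi>_def[abs_def] subset_iff)

text \<open>In a general chart a closed ball of the coordinate space need not correspond to a closed
  set of the manifold. Here \<open>K\<close> lies in the closed unit ball, hence in the image of
  \<open>\<phi>\<close>; its preimage is compact, and compact sets of a Hausdorff space are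
  closed.\<close>

lemma closed_\<phi>_preimage:
  assumes "compact K" "K \<subseteq> cball 0 1"
  shows "closedin T {x \<in> U. \<phi> x \<in> K}"
proof -
  have K: "K \<subseteq> \<phi> ` U" using assms(2) ball_sub' by auto
  have "compactin T (inv_into U \<phi> ` K)"
    using continuous_map_chart_inverse[OF c_chart] assms(1) K
    by (intro image_compactin[where X = "top_of_set (\<phi> ` U)"]) (simp_all add: compactin_subtopology)
  moreover have "inv_into U \<phi> ` K = {x \<in> U. \<phi> x \<in> K}"
  proof (intro set_eqI iffI)
    show "x \<in> {x \<in> U. \<phi> x \<in> K}" if "x \<in> inv_into U \<phi> ` K" for x
      using that K by (auto simp: f_inv_into_f inv_into_into subset_iff)
    show "x \<in> inv_into U \<phi> ` K" if "x \<in> {x \<in> U. \<phi> x \<in> K}" for x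
      using that \<phi>_inj by (intro image_eqI[of _ _ "\<phi> x"]) auto
  qed
  ultimately show ?thesis using compactin_imp_closedin[OF T_Hausdorff] by simp
qed

lemma open_T_minus_p: "openin T (topspace T \<inter> - {p})"
  using closedin_Hausdorff_singleton[OF T_Hausdorff, of p] U_sub p_U
  by (auto simp: closedin_def Diff_eq)

lemma openin_XL: "openin XL V \<longleftrightarrow> openin T V \<and> p \<notin> V"
  using openin_subtopology_openin[OF open_T_minus_p, of V] by auto

lemma open_Bl0_fst: "open N \<Longrightarrow> openin Bl0_topology {z \<in> Bl0. fst z \<in> N}"
  using openin_continuous_map_preimage[OF continuous_map_fst_Bl0, of N] by simp

lemma open_Bl0_U: "openin Bl0_topology (topspace Bl0_topology \<inter> {(q, L). q \<in> \<phi> ` U})"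
proof -
  have "topspace Bl0_topology \<inter> {(q, L). q \<in> \<phi> ` U} = {z \<in> Bl0. fst z \<in> \<phi> ` U}" by auto
  then show ?thesis using open_Bl0_fst[OF open_\<phi>_image[OF U_open]] by simp
qed

lemma openin_XR: "openin XR V \<longleftrightarrow> openin Bl0_topology V \<and> (\<forall>z\<in>V. fst z \<in> \<phi> ` U)"
  using openin_subtopology_openin[OF open_Bl0_U, of V] by auto

lemma topspace_XL: "topspace XL = topspace T - {p}" and topspace_XR: "topspace XR = {z \<in> Bl0. fst z \<in> \<phi> ` U}"
  by auto

text \<open>A nonzero vector lies on exactly one line, so the gluing relation is the graph of a map
  on \<open>U - {p}\<close>.\<close>

lemma G_iff: "(x, z) \<in> G \<longleftrightarrow> x \<in> U \<and> x \<noteq> p \<and> z = (\<phi> x, qline (\<phi> x))"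
proof -
  have "L = qline (\<phi> x)" if "(\<phi> x, L) \<in> Bl0" "x \<in> U" "x \<noteq> p" for L
    using that \<phi>_eq_0[OF that(2)] qline_eq_memI[of "\<phi> x"] by (auto simp: Bl0_def HP_iff)
  moreover have "(\<phi> x, qline (\<phi> x)) \<in> Bl0" if "x \<in> U" "x \<noteq> p"
    using that \<phi>_eq_0[OF that(1)] by (simp add: Bl0_def qline_in_HP)
  ultimately show ?thesis
    unfolding G_def blowup_gluing_def c_def by auto
qed

lemma G_Bl0: "(x, (q, L)) \<in> G \<longleftrightarrow> x \<in> U \<and> x \<noteq> p \<and> (q, L) \<in> Bl0 \<and> q = \<phi> x"
  unfolding G_def blowup_gluing_def c_def by auto

lemma G_single: "single_valued G" "single_valued (G\<inverse>)"
  using \<phi>_inj by (auto simp: single_valued_def G_iff inj_on_def)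

abbreviation gl where "gl \<equiv> glue_left G"
abbreviation gr where "gr \<equiv> glue_right G"

lemmas glue_eq = glue_eq_iff[OF G_single]

lemma G_sub: "G \<subseteq> topspace XL \<times> topspace XR"
  using U_sub by (auto simp: G_Bl0)

lemma open_gl: "open_map XL X gl"
  unfolding X_eq
proof (rule open_map_glue_left[OF G_single])
  fix V assume "openin XL V"
  then have V: "openin T V" "p \<notin> V" by (simp_all add: openin_XL)
  have "open (\<phi> ` (V \<inter> U))" using V(1) by (intro open_\<phi>_image openin_Int U_open) auto
  moreover have "{y \<in> topspace XR. \<exists>x\<in>V. (x, y) \<in> G} = {z \<in> Bl0. fst z \<in> \<phi> ` (V \<inter> U)}"
    using V(2) by (auto simp: G_Bl0)
  ultimately show "openin XR {y \<in> topspace XR. \<exists>x\<in>V. (x, y) \<in> G}"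
    using open_Bl0_fst by (auto simp: openin_XR)
qed

lemma open_gr: "open_map XR X gr"
  unfolding X_eq
proof (rule open_map_glue_right[OF G_single])
  fix V assume "openin XR V"
  then have V: "openin Bl0_topology V" by (simp add: openin_XR)
  let ?U = "U - {p}"
  have oU: "openin T ?U"
  proof -
    have "?U = U \<inter> (topspace T \<inter> - {p})" using U_sub by auto
    then show ?thesis using U_open open_T_minus_p by (metis openin_Int)
  qed
  have top: "topspace (subtopology T ?U) = ?U" using U_sub by auto
  have c: "continuous_map (subtopology T ?U) euclidean \<phi>"
    using continuous_map_chart[OF c_chart, of ?U] by auto
  have "continuous_map (subtopology T ?U) Bl0_topology (\<lambda>x. (\<phi> x, qline (\<phi> x)))"
    by (rule continuous_map_Bl0[OF c c]) (use \<phi>_eq_0 in auto)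
  from openin_continuous_map_preimage[OF this V]
  have "openin T {x \<in> ?U. (\<phi> x, qline (\<phi> x)) \<in> V}"
    unfolding top by (simp add: openin_open_subtopology[OF oU])
  moreover have "{x \<in> topspace XL. \<exists>y\<in>V. (x, y) \<in> G} = {x \<in> ?U. (\<phi> x, qline (\<phi> x)) \<in> V}"
    using U_sub by (auto simp: G_iff)
  ultimately show "openin XL {x \<in> topspace XL. \<exists>y\<in>V. (x, y) \<in> G}"
    by (simp add: openin_XL)
qed

lemma cont_gl: "continuous_map XL X gl" and cont_gr: "continuous_map XR X gr"
  unfolding X_eq by (rule continuous_map_glue_left continuous_map_glue_right)+

lemma inj_gl: "inj_on gl S" and inj_gr: "inj_on gr R"
  by (simp_all add: inj_on_def glue_eq)

lemma topspace_X: "topspace X = gl ` (topspace T - {p}) \<union> gr ` {z \<in> Bl0. fst z \<in> \<phi> ` U}"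
  unfolding X_eq topspace_glue_topology topspace_XL topspace_XR ..

lemma open_gl_image: "openin T V \<Longrightarrow> p \<notin> V \<Longrightarrow> openin X (gl ` V)"
  using open_gl by (simp add: open_map_def openin_XL)

lemma open_gr_image: "openin Bl0_topology V \<Longrightarrow> (\<And>z. z \<in> V \<Longrightarrow> fst z \<in> \<phi> ` U) \<Longrightarrow> openin X (gr ` V)"
  using open_gr by (simp add: open_map_def openin_XR)

text \<open>The points not involved in the gluing are those outside \<open>U\<close> and those over
  0. The complement of the closed unit ball and the part of the blow-up over the open unit ball
  separate them.\<close>

lemma X_Hausdorff: "Hausdorff_space X"
  unfolding X_eq
proof (rule Hausdorff_glue_topology[OF G_single])
  show "Hausdorff_space XL" "Hausdorff_space XR"
    using T_Hausdorff Hausdorff_space_Bl0 by (auto intro: Hausdorff_space_subtopology)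
  show "open_map XL (glue_topology XL XR G) gl" "open_map XR (glue_topology XL XR G) gr"
    using open_gl open_gr by (simp_all add: X_eq)
  fix x z assume x: "x \<in> topspace XL" "x \<notin> Domain G" and z: "z \<in> topspace XR" "z \<notin> Range G"
  obtain q L where qL: "z = (q, L)" by (cases z)
  have xU: "x \<notin> U" using x by (auto simp: G_iff)
  have q0: "q = 0"
  proof (rule ccontr)
    assume "q \<noteq> 0"
    moreover obtain x' where x': "x' \<in> U" "q = \<phi> x'" using z(1) qL by auto
    ultimately have "(x', (q, L)) \<in> G" using z(1) qL by (auto simp: G_Bl0)
    then show False using z(2) qL by blast
  qed
  let ?U = "topspace T - {x \<in> U. \<phi> x \<in> cball 0 1}" and ?V = "{z \<in> Bl0. fst z \<in> ball 0 1}"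
  have "openin T ?U" by (intro openin_diff openin_topspace closed_\<phi>_preimage) auto
  then have 1: "openin XL ?U" unfolding openin_XL using p_U by simp
  have "fst z \<in> \<phi> ` U" if "z \<in> ?V" for z using that by (intro ball_sub') simp
  then have 2: "openin XR ?V" unfolding openin_XR using open_Bl0_fst[OF open_ball] by blast
  have 3: "x \<in> ?U" using x(1) xU by simp
  have 4: "z \<in> ?V" using z(1) qL q0 by simp
  have False if "g \<in> G" "g \<in> ?U \<times> ?V" for g
    using that by (cases g) (auto simp: G_iff)
  then have 5: "G \<inter> ?U \<times> ?V = {}" by blast
  show "\<exists>U' V'. openin XL U' \<and> openin XR V' \<and> x \<in> U' \<and> z \<in> V' \<and> G \<inter> U' \<times> V' = {}"
    by (rule exI[of _ ?U], rule exI[of _ ?V]) (intro conjI 1 2 3 4 5)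
qed (rule G_sub)

lemma X_second: "second_countable X"
proof (rule second_countable_UN[of UNIV _ "\<lambda>b. if b then gl ` topspace XL else gr ` topspace XR"])
  show "openin X (if b then gl ` topspace XL else gr ` topspace XR)" for b
    using open_gl[unfolded open_map_def, rule_format, OF openin_topspace]
      open_gr[unfolded open_map_def, rule_format, OF openin_topspace] by (cases b) simp_all
  show "second_countable (subtopology X (if b then gl ` topspace XL else gr ` topspace XR))" for b
    using second_countable_open_embedding[OF cont_gl open_gl second_countable_subtopology[OF T_second]]
      second_countable_open_embedding[OF cont_gr open_gr second_countable_subtopology[OF second_countable_Bl0]]
    by (cases b) (simp_all only: if_True if_False)
  show "topspace X \<subseteq> (\<Union>b\<in>UNIV. if b then gl ` topspace XL else gr ` topspace XR)"
    unfolding topspace_X topspace_XL topspace_XR by auto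
qed simp

end

section \<open>A regular atlas of the blow-up\<close>

context blowup_setup
begin

definition Lc :: "('a, 'n) chart \<Rightarrow> (('a + 'n qvec \<times> 'n qvec set) set, 'n) chart" where
  "Lc d = push_chart gl (restrict_chart (- {p}) d)"

definition Rc :: "'n \<Rightarrow> (('a + 'n qvec \<times> 'n qvec set) set, 'n) chart" where
  "Rc i = push_chart gr (restrict_chart {(q, L). q \<in> \<phi> ` U} (Bl0_chart i))"

lemma blowup_atlas_eq: "blowup_atlas A p c = Lc ` A \<union> range Rc"
  by (simp add: blowup_atlas_def Lc_def Rc_def G_def image_def)

lemma chart_on_Lc: "chart_on T d \<Longrightarrow> chart_on X (Lc d)"
  unfolding Lc_def by (rule chart_on_push[OF chart_on_restrict[OF _ open_T_minus_p] cont_gl open_gl inj_gl])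

lemma chart_on_Rc: "chart_on X (Rc i)"
  unfolding Rc_def by (rule chart_on_push[OF chart_on_restrict[OF chart_on_Bl0 open_Bl0_U] cont_gr open_gr inj_gr])

lemma gl_in_Lc: "gl x \<in> fst (Lc d) \<longleftrightarrow> x \<in> fst d \<and> x \<noteq> p"
  by (auto simp: Lc_def glue_eq)

lemma snd_Lc: "x \<in> fst d \<Longrightarrow> x \<noteq> p \<Longrightarrow> snd (Lc d) (gl x) = snd d x"
  unfolding Lc_def by (subst snd_push_chart) (auto simp: inj_gl)

lemma gr_in_Rc: "gr z \<in> fst (Rc i) \<longleftrightarrow> z \<in> fst (Bl0_chart i) \<and> fst z \<in> \<phi> ` U"
  by (auto simp: Rc_def glue_eq case_prod_unfold)

lemma snd_Rc: "z \<in> fst (Bl0_chart i) \<Longrightarrow> fst z \<in> \<phi> ` U \<Longrightarrow> snd (Rc i) (gr z) = snd (Bl0_chart i) z"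
  unfolding Rc_def by (subst snd_push_chart) (auto simp: inj_gr case_prod_unfold)

lemma LcE:
  assumes "w \<in> fst (Lc d)"
  obtains x where "x \<in> fst d" "x \<noteq> p" "w = gl x"
  using assms by (auto simp: Lc_def)

lemma RcE:
  assumes "w \<in> fst (Rc i)"
  obtains y where "w = gr (Bl0_param i y)" "blow_down i y \<in> \<phi> ` U" "snd (Rc i) w = y"
proof -
  obtain z where z: "z \<in> fst (Bl0_chart i)" "fst z \<in> \<phi> ` U" "w = gr z"
    using assms by (auto simp: Rc_def case_prod_unfold)
  let ?y = "snd (Bl0_chart i) z"
  have y: "Bl0_param i ?y = z" using z(1) by (rule Bl0_param_chart)
  then have "blow_down i ?y = fst z" by (metis Bl0_param_def fst_conv)
  then show thesis
    using z snd_Rc[OF z(1,2)] y by (intro that[of ?y]) simp_all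
qed

lemma gl_eq_gr: "x \<in> U \<Longrightarrow> x \<noteq> p \<Longrightarrow> gl x = gr (\<phi> x, qline (\<phi> x))"
  by (simp add: glue_eq G_iff)

lemma transition_LL:
  assumes "chart_on T d" "w \<in> fst (Lc d)" "w \<in> fst (Lc e)"
  shows "snd (Lc d) w \<in> coord_dom d e id \<and> snd (Lc e) w = coord_map d e id (snd (Lc d) w)"
proof -
  obtain x where x: "x \<in> fst d" "x \<noteq> p" "w = gl x" using assms(2) by (rule LcE)
  then have "x \<in> fst e" using assms(3) by (simp add: gl_in_Lc)
  then show ?thesis
    using x coord_map_apply[OF chart_onD(2)[OF assms(1)] x(1), of e id] coord_domI[of x d id e]
    by (simp add: snd_Lc)
qed

lemma transition_LR:
  assumes "w \<in> fst (Lc c)" "w \<in> fst (Rc i)"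
  shows "snd (Lc c) w \<in> {q. q $ i \<noteq> 0} \<and> snd (Rc i) w = blow_up i (snd (Lc c) w)"
proof -
  obtain x where x: "x \<in> U" "x \<noteq> p" "w = gl x" using assms(1) by (rule LcE) simp
  have n0: "\<phi> x \<noteq> 0" using x by (simp add: \<phi>_eq_0)
  have w: "w = gr (\<phi> x, qline (\<phi> x))" using x by (simp add: gl_eq_gr)
  have "(\<phi> x, qline (\<phi> x)) \<in> fst (Bl0_chart i)" using assms(2) by (simp add: w gr_in_Rc)
  moreover from this have "snd (Rc i) w = blow_up i (\<phi> x)"
    unfolding w using x n0 by (subst snd_Rc) (simp_all add: snd_Bl0_chart_blow_up)
  ultimately show ?thesis using x n0 by (simp add: fst_Bl0_chart snd_Lc)
qed

text \<open>Only points of \<open>U - {p}\<close> are glued to the right-hand piece. Every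
  transition between a chart of the manifold and a chart of the blow-up can thus be factored through
  \<open>\<phi>\<close>.\<close>

lemma Rc_subset_Lc:
  assumes "w \<in> fst (Lc d)" "w \<in> fst (Rc i)"
  shows "w \<in> fst (Lc c)"
proof -
  obtain x where x: "x \<in> fst d" "x \<noteq> p" "w = gl x" using assms(1) by (rule LcE)
  obtain y where "w = gr (Bl0_param i y)" using assms(2) by (rule RcE)
  then have "(x, Bl0_param i y) \<in> G" using x by (simp add: glue_eq)
  then show ?thesis using x by (simp add: gl_in_Lc G_iff)
qed

lemma transition_RL:
  assumes "w \<in> fst (Rc i)" "w \<in> fst (Lc c)"
  shows "snd (Lc c) w = blow_down i (snd (Rc i) w)"
proof -
  obtain y where y: "w = gr (Bl0_param i y)" "snd (Rc i) w = y" using assms(1) by (rule RcE)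
  obtain x where x: "x \<in> U" "x \<noteq> p" "w = gl x" using assms(2) by (rule LcE) simp
  have "(x, Bl0_param i y) \<in> G" using x(3) y(1) by (simp add: glue_eq)
  then have "\<phi> x = blow_down i y" by (simp add: G_iff Bl0_param_def)
  then show ?thesis using x y by (simp add: snd_Lc)
qed

lemma transition_RR:
  assumes "w \<in> fst (Rc i)" "w \<in> fst (Rc j)"
  shows "snd (Rc i) w \<in> {y. slot_one i y $ j \<noteq> 0} \<and> snd (Rc j) w = Bl0_transition i j (snd (Rc i) w)"
proof -
  obtain y where y: "w = gr (Bl0_param i y)" "blow_down i y \<in> \<phi> ` U" "snd (Rc i) w = y"
    using assms(1) by (rule RcE)
  have j: "Bl0_param i y \<in> fst (Bl0_chart j)" using assms(2) by (simp add: y(1) gr_in_Rc)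
  then have "slot_one i y $ j \<noteq> 0" unfolding Bl0_param_def by (subst (asm) fst_Bl0_chart) simp_all
  moreover have "snd (Rc j) w = Bl0_transition i j y"
    unfolding y(1) using j y(2) by (subst snd_Rc) (simp_all add: snd_Bl0_chart_param, simp add: Bl0_param_def)
  ultimately show ?thesis by (simp add: y(3))
qed

lemma smooth_atlas_insert_c: "smooth_atlas T (insert c A)"
proof (rule smooth_atlas_subordinate[OF A_smooth, of T id])
  show "subordinate T id A e" if "e \<in> insert c A" for e
  proof (cases "e = c")
    case True
    show ?thesis unfolding True
      by (rule subordinate_affine[OF _ c0_A]) (use U_open in \<open>auto simp: \<phi>_def\<close>)
  next
    case False
    then have "e \<in> A" using that by simp
    then show ?thesis by (intro subordinateI[of _ _ e]) (auto intro: chart_onD(1) A_chart)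
  qed
  show "topspace T \<subseteq> (\<Union>e\<in>insert c A. fst e)" using A_cover by auto
qed simp

lemma smooth_c:
  assumes "d \<in> A"
  shows "smooth_on (coord_dom c d id) (coord_map c d id)" "smooth_on (coord_dom d c id) (coord_map d c id)"
    "open (coord_dom c d id)" "open (coord_dom d c id)"
  using smooth_atlas_insert_c assms open_coord_dom[OF c_chart A_chart[OF assms], of id]
    open_coord_dom[OF A_chart[OF assms] c_chart, of id]
  by (auto simp: smooth_atlas_def id_def)

text \<open>The mixed transitions are compositions of a coordinate change to or from
  \<open>\<phi>\<close> with \<open>blow_up\<close> or \<open>blow_down\<close>. Smoothness survives
  such compositions; slice regularity may be lost, so this atlas serves only to fix the
  differentiable structure.\<close>

lemma smooth_atlas_X: "smooth_atlas X (blowup_atlas A p c)"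
proof -
  have chart: "chart_on X e" if "e \<in> Lc ` A \<union> range Rc" for e
    using that chart_on_Lc[OF A_chart] chart_on_Rc by auto
  have LL: "smooth_on (coord_dom (Lc d) (Lc e) id) (coord_map (Lc d) (Lc e) id)" if "d \<in> A" "e \<in> A" for d e
    by (rule smooth_coord_idI[OF chart_on_Lc[OF A_chart[OF that(1)]] chart_on_Lc[OF A_chart[OF that(2)]]
        A_trans_smooth[OF that] transition_LL[OF A_chart[OF that(1)]]])
  have RR: "smooth_on (coord_dom (Rc i) (Rc j) id) (coord_map (Rc i) (Rc j) id)" for i j
    by (rule smooth_coord_idI[OF chart_on_Rc chart_on_Rc smooth_Bl0_transition transition_RR])
  have LR: "smooth_on (coord_dom (Lc d) (Rc i) id) (coord_map (Lc d) (Rc i) id)" if d: "d \<in> A" for d i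
  proof -
    let ?D = "coord_dom d c id" and ?F = "coord_map d c id"
    let ?W = "?D \<inter> ?F -` {q. q $ i \<noteq> 0}"
    have W: "open ?W"
      by (rule continuous_open_preimage[OF smooth_on_imp_continuous_on[OF smooth_c(2)[OF d]] smooth_c(4)[OF d] open_nth_neq])
    have F: "smooth_on ?W (\<lambda>y. blow_up i (?F y))"
      by (rule smooth_on_compose[OF W open_nth_neq[of i] _ smooth_blow_up smooth_on_subset[OF smooth_c(2)[OF d]]]) auto
    show ?thesis
    proof (rule smooth_coord_idI[OF chart_on_Lc[OF A_chart[OF d]] chart_on_Rc F])
      fix w assume w: "w \<in> fst (Lc d)" "w \<in> fst (Rc i)"
      then have "w \<in> fst (Lc c)" using Rc_subset_Lc by simp
      then show "snd (Lc d) w \<in> ?W \<and> snd (Rc i) w = blow_up i (?F (snd (Lc d) w))"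
        using transition_LL[OF A_chart[OF d] w(1), of c] transition_LR[of w i] w by simp
    qed
  qed
  have RL: "smooth_on (coord_dom (Rc i) (Lc d) id) (coord_map (Rc i) (Lc d) id)" if d: "d \<in> A" for d i
  proof -
    let ?D = "coord_dom c d id" and ?F = "coord_map c d id"
    have W: "open (blow_down i -` ?D)"
      by (rule open_vimage[OF smooth_c(3)[OF d] continuous_blow_down])
    have F: "smooth_on (blow_down i -` ?D) (\<lambda>y. ?F (blow_down i y))"
      by (rule smooth_on_compose[OF W smooth_c(3)[OF d] _ smooth_c(1)[OF d] smooth_on_subset[OF smooth_blow_down]]) auto
    show ?thesis
    proof (rule smooth_coord_idI[OF chart_on_Rc chart_on_Lc[OF A_chart[OF d]] F])
      fix w assume w: "w \<in> fst (Rc i)" "w \<in> fst (Lc d)"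
      then have c: "w \<in> fst (Lc c)" using Rc_subset_Lc by simp
      then show "snd (Rc i) w \<in> blow_down i -` ?D \<and> snd (Lc d) w = ?F (blow_down i (snd (Rc i) w))"
        using transition_LL[OF c_chart c, of d] transition_RL[OF w(1) c] w by simp
    qed
  qed
  have cov: "topspace X \<subseteq> (\<Union>e\<in>Lc ` A \<union> range Rc. fst e)"
  proof
    fix w assume "w \<in> topspace X"
    then consider x where "x \<in> topspace T" "x \<noteq> p" "w = gl x" | z where "z \<in> Bl0" "fst z \<in> \<phi> ` U" "w = gr z"
      unfolding topspace_X by blast
    then show "w \<in> (\<Union>e\<in>Lc ` A \<union> range Rc. fst e)"
    proof cases
      case 1
      obtain d where "d \<in> A" "x \<in> fst d" using A_cover[OF 1(1)] by blast
      then show ?thesis using 1 gl_in_Lc[of x d] by auto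
    next
      case 2
      obtain i where "z \<in> fst (Bl0_chart i)" using Bl0_chart_cover[OF 2(1)] by blast
      then show ?thesis using 2 gr_in_Rc[of z i] by auto
    qed
  qed
  moreover have "fst e \<subseteq> topspace X" if "e \<in> Lc ` A \<union> range Rc" for e
    using openin_subset[OF chart_onD(1)[OF chart[OF that]]] .
  ultimately have cov': "(\<Union>e\<in>Lc ` A \<union> range Rc. fst e) = topspace X" by blast
  have "smooth_on (coord_dom e e' id) (coord_map e e' id)"
    if "e \<in> Lc ` A \<union> range Rc" "e' \<in> Lc ` A \<union> range Rc" for e e'
    using that by (elim UnE imageE) (simp_all add: LL RR LR RL)
  then show ?thesis
    unfolding smooth_atlas_def blowup_atlas_eq by (intro conjI ballI chart cov')
qed

section \<open>Layers around the exceptional divisor\<close>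

definition Out :: "real \<Rightarrow> ('a + 'n qvec \<times> 'n qvec set) set set" where
  "Out s = gl ` (topspace T - {x \<in> U. \<phi> x \<in> cball 0 s})"

definition In :: "real \<Rightarrow> ('a + 'n qvec \<times> 'n qvec set) set set" where
  "In s = gr ` {z \<in> Bl0. fst z \<in> ball 0 s}"

lemma openin_Out:
  assumes "0 \<le> s" "s \<le> 1"
  shows "openin X (Out s)"
proof -
  have "closedin T {x \<in> U. \<phi> x \<in> cball 0 s}"
    using assms(2) by (intro closed_\<phi>_preimage) auto
  then show ?thesis
    unfolding Out_def using p_U assms(1) by (intro open_gl_image openin_diff openin_topspace) auto
qed

lemma openin_In: "s \<le> 1 \<Longrightarrow> openin X (In s)"
  unfolding In_def by (rule open_gr_image[OF open_Bl0_fst[OF open_ball]]) (auto intro: ball_sub')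

lemma gl_in_Out: "gl x \<in> Out s \<longleftrightarrow> x \<in> topspace T \<and> \<not> (x \<in> U \<and> norm (\<phi> x) \<le> s)"
  by (auto simp: Out_def glue_eq)

lemma gl_in_In: "gl x \<in> In s \<longleftrightarrow> x \<in> U \<and> x \<noteq> p \<and> norm (\<phi> x) < s"
proof
  assume "gl x \<in> In s"
  then obtain z where z: "gl x = gr z" "norm (fst z) < s" by (auto simp: In_def)
  then show "x \<in> U \<and> x \<noteq> p \<and> norm (\<phi> x) < s" by (auto simp: glue_eq G_iff)
next
  assume x: "x \<in> U \<and> x \<noteq> p \<and> norm (\<phi> x) < s"
  then have "gl x = gr (\<phi> x, qline (\<phi> x))" "\<phi> x \<noteq> 0" by (simp_all add: gl_eq_gr \<phi>_eq_0)
  then show "gl x \<in> In s"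
    unfolding In_def using x by (intro image_eqI[of _ _ "(\<phi> x, qline (\<phi> x))"]) (simp_all add: Bl0_def qline_in_HP)
qed

lemma Out_In_disjoint:
  assumes "w \<in> Out s" "w \<in> In s" shows False
proof -
  obtain x where "w = gl x" using assms(1) by (auto simp: Out_def)
  then show False using assms by (auto simp: gl_in_Out gl_in_In)
qed

lemma Out_mono: "s \<le> t \<Longrightarrow> Out t \<subseteq> Out s"
  by (auto simp: Out_def)

text \<open>The radii alternate so that charts of non-consecutive layers are separated:
  \<open>In (1/2)\<close> is disjoint from \<open>Out (1/2)\<close>, and \<open>In (3/4)\<close>
  from \<open>Out (3/4)\<close>. The sphere of radius 1/2 is covered by the shell around it, the
  sphere of radius 3/4 by the chart \<open>c0\<close>.\<close>

definition C :: "(('a + 'n qvec \<times> 'n qvec set) set, 'n) chart set" where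
  "C = (\<lambda>d. restrict_chart (Out (3/4)) (Lc d)) ` A \<union> {restrict_chart (Out (1/2)) (Lc c0)} \<union>
     {restrict_chart (Out (1/4) \<inter> In (3/4)) (Lc c)} \<union> range (\<lambda>i. restrict_chart (In (1/2)) (Rc i))"

lemma C_cases:
  assumes "e \<in> C"
  obtains (outer) d s where "d \<in> A" "s = 3/4 \<or> s = 1/2 \<and> d = c0" "e = restrict_chart (Out s) (Lc d)"
  | (shell) "e = restrict_chart (Out (1/4) \<inter> In (3/4)) (Lc c)"
  | (inner) i where "e = restrict_chart (In (1/2)) (Rc i)"
  using assms c0_A unfolding C_def by blast

lemma subordinate_C:
  assumes "e \<in> C"
  shows "subordinate X id (blowup_atlas A p c) e"
  using assms
proof (cases rule: C_cases)
  case (outer d s)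
  then have "0 \<le> s" "s \<le> 1" by auto
  with outer show ?thesis
    by (intro subordinateI[of _ _ "Lc d"])
      (auto simp: blowup_atlas_eq intro!: openin_Int openin_Out chart_onD(1)[OF chart_on_Lc] A_chart)
next
  case shell
  show ?thesis
  \<comment> \<open>\<open>Lc c\<close> need not occur in the standard atlas; on the shell it is an
    affine function of \<open>Lc c0\<close>, which does.\<close>
  proof (rule subordinate_affine)
    show "openin X (fst e)"
      unfolding shell by (auto intro!: openin_Int openin_Out openin_In chart_onD(1)[OF chart_on_Lc] c_chart)
    show "Lc c0 \<in> blowup_atlas A p c" by (simp add: blowup_atlas_eq c0_A)
    fix w assume w: "w \<in> fst e"
    then have "w \<in> fst (Lc c)" by (simp add: shell)
    then obtain x where x: "x \<in> U" "x \<noteq> p" "w = gl x" by (rule LcE) simp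
    then show "id w \<in> fst (Lc c0) \<and> snd e w = r *\<^sub>R (snd (Lc c0) (id w) - \<phi>\<^sub>0 p)"
      by (simp add: shell gl_in_Lc snd_Lc \<phi>_def)
  qed
next
  case (inner i)
  then show ?thesis
    by (intro subordinateI[of _ _ "Rc i"])
      (auto simp: blowup_atlas_eq intro!: openin_Int openin_In chart_onD(1)[OF chart_on_Rc])
qed

lemma C_cover: "topspace X \<subseteq> (\<Union>e\<in>C. fst e)"
proof
  fix w assume w: "w \<in> topspace X"
  have inner: "w \<in> (\<Union>e\<in>C. fst e)" if z: "w = gr z" "z \<in> Bl0" "norm (fst z) < 1/2" for z
  proof -
    obtain i where i: "z \<in> fst (Bl0_chart i)" using Bl0_chart_cover[OF z(2)] by blast
    have "w \<in> fst (restrict_chart (In (1/2)) (Rc i))"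
      using z i ball_sub'[of "fst z"] by (auto simp: gr_in_Rc In_def)
    then show ?thesis unfolding C_def by blast
  qed
  have outer: "w \<in> (\<Union>e\<in>C. fst e)" if x: "w = gl x" "x \<in> topspace T" "x \<noteq> p" for x
  proof (cases "x \<in> U \<and> norm (\<phi> x) \<le> 3/4")
    case False
    obtain d where "d \<in> A" "x \<in> fst d" using A_cover[OF x(2)] by blast
    moreover from this have "w \<in> fst (restrict_chart (Out (3/4)) (Lc d))"
      using x False by (simp add: gl_in_Lc gl_in_Out)
    ultimately show ?thesis unfolding C_def by blast
  next
    case True
    \<comment> \<open>The three cases lead to the chart \<open>c0\<close>, to the shell and to a
      chart of the blow-up.\<close>
    consider "norm (\<phi> x) > 1/2" | "norm (\<phi> x) > 1/4" "norm (\<phi> x) \<le> 1/2" | "norm (\<phi> x) \<le> 1/4" by linarith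
    then show ?thesis
    proof cases
      case 1
      then have "w \<in> fst (restrict_chart (Out (1/2)) (Lc c0))"
        using x True by (simp add: gl_in_Lc gl_in_Out)
      then show ?thesis unfolding C_def by blast
    next
      case 2
      then have "w \<in> fst (restrict_chart (Out (1/4) \<inter> In (3/4)) (Lc c))"
        using x True by (simp add: gl_in_Lc gl_in_Out gl_in_In)
      then show ?thesis unfolding C_def by blast
    next
      case 3
      have "\<phi> x \<noteq> 0" using x True by (simp add: \<phi>_eq_0)
      then show ?thesis
        using x True 3 by (intro inner[of "(\<phi> x, qline (\<phi> x))"]) (simp_all add: gl_eq_gr Bl0_def qline_in_HP)
    qed
  qed
  from w consider x where "x \<in> topspace T" "x \<noteq> p" "w = gl x" | z where "z \<in> Bl0" "fst z \<in> \<phi> ` U" "w = gr z"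
    unfolding topspace_X by blast
  then show "w \<in> (\<Union>e\<in>C. fst e)"
  proof cases
    case 1
    then show ?thesis using outer by blast
  next
    case 2
    obtain x where x: "x \<in> U" "fst z = \<phi> x" using 2(2) by blast
    show ?thesis
    proof (cases "x = p")
      case True
      then show ?thesis using inner[OF 2(3,1)] x by simp
    next
      case False
      then have "(x, z) \<in> G" using x 2(1) by (cases z) (simp add: G_Bl0)
      then have "w = gl x" using 2(3) by (simp add: glue_eq)
      then show ?thesis using outer[of x] x(1) False U_sub by blast
    qed
  qed
qed

lemma smooth_atlas_C: "smooth_atlas X C"
  by (rule smooth_atlas_subordinate[OF smooth_atlas_X _ subordinate_C C_cover]) simp_all

lemma smooth_atlas_X_C: "smooth_atlas X (blowup_atlas A p c \<union> C)"
proof (rule smooth_atlas_subordinate[OF smooth_atlas_X, of X id])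
  show "subordinate X id (blowup_atlas A p c) e" if "e \<in> blowup_atlas A p c \<union> C" for e
  proof (cases "e \<in> C")
    case False
    then have e: "e \<in> blowup_atlas A p c" using that by simp
    then have "chart_on X e" using smooth_atlas_X by (simp add: smooth_atlas_def)
    then show ?thesis by (intro subordinateI[OF _ e] chart_onD(1)) simp_all
  qed (rule subordinate_C)
  show "topspace X \<subseteq> (\<Union>e\<in>blowup_atlas A p c \<union> C. fst e)"
    using C_cover by blast
qed simp

lemma C_chart: "e \<in> C \<Longrightarrow> chart_on X e"
  using smooth_atlas_C by (simp add: smooth_atlas_def)

text \<open>Each overlap involves a single known map: a transition function of \<open>A\<close>
  between outer charts, an affine map between \<open>c0\<close> and the shell,
  \<open>blow_up\<close> or \<open>blow_down\<close> between the shell and the inner charts, and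
  \<open>Bl0_transition\<close> between inner charts. All remaining pairs of different layers have
  disjoint domains.\<close>

lemma C_slice_regular:
  assumes e: "e \<in> C" and e': "e' \<in> C"
  shows "slice_regular_on (coord_dom e e' id) (coord_map e e' id)"
proof -
  let ?reg = "slice_regular_on (coord_dom e e' id) (coord_map e e' id)"
  have I: ?reg if "slice_regular_on W F"
    "\<And>w. w \<in> fst e \<Longrightarrow> w \<in> fst e' \<Longrightarrow> snd e w \<in> W \<and> snd e' w = F (snd e w)" for W F
    by (rule slice_coordI[OF C_chart[OF e] C_chart[OF e'] _ that(1)]) (use that(2) in \<open>simp_all add: id_def\<close>)
  have disj: ?reg if "\<And>w. w \<in> fst e \<Longrightarrow> w \<in> fst e' \<Longrightarrow> False"
    by (rule I[OF slice_regular_on_empty[of "\<lambda>q. q"]]) (use that in blast)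
  have LL: ?reg if "d \<in> A" "d' \<in> A" "e = restrict_chart S (Lc d)" "e' = restrict_chart S' (Lc d')" for d d' S S'
    by (rule I[OF A_trans[OF that(1,2)]], unfold that(3,4) snd_restrict_chart,
        rule transition_LL[OF A_chart[OF that(1)]]) simp_all
  \<comment> \<open>Both kinds of outer charts stay outside radius 1/2, hence away from the charts
    of the blow-up.\<close>
  have O: "w \<in> Out (1/2)" if "s = 3/4 \<or> s = 1/2 \<and> d = c0" "w \<in> Out s" for w s and d :: "('a, 'n) chart"
  proof -
    have "1/2 \<le> s" using that(1) by auto
    then show ?thesis using Out_mono that(2) by blast
  qed
  have aff: "snd (Lc c) w = r *\<^sub>R snd (Lc c0) w + - (r *\<^sub>R \<phi>\<^sub>0 p)"
    "snd (Lc c0) w = inverse r *\<^sub>R snd (Lc c) w + \<phi>\<^sub>0 p" if w: "w \<in> fst (Lc c)" for w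
  proof -
    obtain x where x: "x \<in> U" "x \<noteq> p" "w = gl x" using w by (rule LcE) simp
    show "snd (Lc c) w = r *\<^sub>R snd (Lc c0) w + - (r *\<^sub>R \<phi>\<^sub>0 p)"
      "snd (Lc c0) w = inverse r *\<^sub>R snd (Lc c) w + \<phi>\<^sub>0 p"
      using x r_pos by (simp_all add: snd_Lc \<phi>_def scaleR_right_diff_distrib)
  qed
  show ?thesis
    using e
  proof (cases rule: C_cases)
    case (outer d s)
    show ?thesis
      using e'
    proof (cases rule: C_cases)
      case outer': (outer d' s')
      show ?thesis by (rule LL[OF outer(1) outer'(1) outer(3) outer'(3)])
    next
      case shell
      show ?thesis
      proof (cases "s = 3/4")
        case True
        show ?thesis using outer(3)[unfolded True] shell by (intro disj) (auto dest: Out_In_disjoint)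
      next
        case False
        then have "d = c0" using outer(2) by simp
        then show ?thesis
          by (intro I[OF slice_regular_affine[of r "- (r *\<^sub>R \<phi>\<^sub>0 p)"]]) (use outer(3) shell aff in auto)
      qed
    next
      case (inner i)
      then show ?thesis using outer(3) by (intro disj) (auto dest: O[OF outer(2)] Out_In_disjoint)
    qed
  next
    case shell
    show ?thesis
      using e'
    proof (cases rule: C_cases)
      case (outer d s)
      show ?thesis
      proof (cases "s = 3/4")
        case True
        show ?thesis using outer(3)[unfolded True] shell by (intro disj) (auto dest: Out_In_disjoint)
      next
        case False
        then have "d = c0" using outer(2) by simp
        then show ?thesis
          by (intro I[OF slice_regular_affine[of "inverse r" "\<phi>\<^sub>0 p"]]) (use outer(3) shell aff in auto)
      qed
    next
      case shell': shell
      show ?thesis by (rule I[OF slice_regular_ident]) (use shell shell' in auto)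
    next
      case (inner i)
      show ?thesis by (rule I[OF slice_regular_blow_up[of i]]) (use shell inner transition_LR[of _ i] in auto)
    qed
  next
    case (inner i)
    show ?thesis
      using e'
    proof (cases rule: C_cases)
      case (outer d s)
      then show ?thesis using inner by (intro disj) (auto dest: O[OF outer(2)] Out_In_disjoint)
    next
      case shell
      show ?thesis by (rule I[OF slice_regular_blow_down[of i]]) (use shell inner transition_RL[of _ i] in auto)
    next
      case inner': (inner j)
      show ?thesis
        by (rule I[OF slice_regular_Bl0_transition[of i j]]) (use inner inner' transition_RR[of _ i j] in auto)
    qed
  qed
qed

lemma X_regular: "quaternionic_regular_manifold X C"
  unfolding quaternionic_regular_manifold_def regular_atlas_def
  using X_Hausdorff X_second smooth_atlas_C C_slice_regular by blast

lemma X_compatible: "smoothly_compatible X (blowup_atlas A p c) C"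
  unfolding smoothly_compatible_def using smooth_atlas_X smooth_atlas_C smooth_atlas_X_C by blast

end

section \<open>The inversion of projective space\<close>

definition hcons :: "quat \<Rightarrow> 'n::finite qvec \<Rightarrow> 'n option qvec" where
  "hcons w q = (\<chi> j. case j of None \<Rightarrow> w | Some k \<Rightarrow> q $ k)"

definition htail :: "'n::finite option qvec \<Rightarrow> 'n qvec" where
  "htail a = (\<chi> k. a $ Some k)"

lemma hcons_nth [simp]: "hcons w q $ None = w" "hcons w q $ Some k = q $ k"
  by (simp_all add: hcons_def)

lemma htail_nth [simp]: "htail a $ k = a $ Some k"
  by (simp add: htail_def)

lemma htail_hcons [simp]: "htail (hcons w q) = q"
  by (simp add: vec_eq_iff)

lemma qvec_option_eq_iff: "a = b \<longleftrightarrow> a $ None = b $ None \<and> htail a = htail b"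
  by (auto simp: vec_eq_iff split_option_all)

lemma htail_0 [simp]: "htail 0 = 0"
  by (simp add: vec_eq_iff)

lemma htail_rscale [simp]: "htail (rscale a l) = rscale (htail a) l"
  by (simp add: vec_eq_iff)

lemma continuous_on_htail: "continuous_on S htail"
  unfolding htail_def by (intro continuous_on_vec_lambda continuous_intros)

lemma hpoint_eq: "hpoint w q = qline (hcons w q)"
  by (simp add: hpoint_def hcons_def)

lemma hpoint_in_HP: "hpoint 1 q \<in> HP"
proof -
  have "hcons 1 q \<noteq> 0" by (auto simp: qvec_option_eq_iff)
  then show ?thesis by (simp add: hpoint_eq qline_in_HP)
qed

lemma qline_eq_hpoint: "a $ None \<noteq> 0 \<Longrightarrow> qline a = hpoint 1 (rscale (htail a) (inverse (a $ None)))"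
proof -
  assume w: "a $ None \<noteq> 0"
  then have "hcons 1 (rscale (htail a) (inverse (a $ None))) = rscale a (inverse (a $ None))"
    by (simp add: qvec_option_eq_iff)
  then show ?thesis using w by (simp add: hpoint_eq qline_rscale)
qed

lemma qline_eq_hpointD:
  assumes "qline a = hpoint 1 q"
  shows "a $ None \<noteq> 0" "q = rscale (htail a) (inverse (a $ None))"
proof -
  have "hcons 1 q \<noteq> 0" by (auto simp: qvec_option_eq_iff)
  then obtain l where l: "l \<noteq> 0" "hcons 1 q = rscale a l"
    using qline_eqD[of a "hcons 1 q"] assms by (auto simp: hpoint_eq)
  then have eq: "1 = a $ None * l" "q = rscale (htail a) l" by (simp_all add: qvec_option_eq_iff)
  then show n: "a $ None \<noteq> 0" by auto
  have "inverse (a $ None) = l" using eq(1) by (intro inverse_unique) simp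
  then show "q = rscale (htail a) (inverse (a $ None))" using eq(2) by simp
qed

lemma hpoint_1_inj: "hpoint 1 q = hpoint 1 q' \<Longrightarrow> q = q'"
  using qline_eq_hpointD(2)[of "hcons 1 q" q'] by (simp add: hpoint_eq)

lemma qline_in_hpoint_image:
  "qline a \<in> hpoint 1 ` S \<longleftrightarrow> a $ None \<noteq> 0 \<and> rscale (htail a) (inverse (a $ None)) \<in> S"
  using qline_eq_hpoint[of a] qline_eq_hpointD[of a] by (auto simp: image_iff)

lemma qline_in_hpoint_ball:
  "qline a \<in> hpoint 1 ` ball 0 1 \<longleftrightarrow> norm (htail a) < norm (a $ None)"
proof (cases "a $ None = 0")
  case False
  then show ?thesis
    by (simp add: qline_in_hpoint_image norm_rscale norm_inverse divide_inverse[symmetric])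
qed (simp add: qline_in_hpoint_image)

text \<open>The zero vector would satisfy the weak inequality on the right without representing a
  point \<open>[1, q]\<close>. In the strict version above it is excluded by the inequality
  itself.\<close>

lemma qline_in_hpoint_cball:
  assumes "a \<noteq> 0"
  shows "qline a \<in> hpoint 1 ` cball 0 1 \<longleftrightarrow> norm (htail a) \<le> norm (a $ None)"
proof (cases "a $ None = 0")
  case True
  then show ?thesis using assms by (auto simp: qline_in_hpoint_image qvec_option_eq_iff)
next
  case False
  then show ?thesis
    by (simp add: qline_in_hpoint_image norm_rscale norm_inverse divide_inverse[symmetric])
qed

text \<open>Inversion in the unit sphere. At 0 the division convention gives the value 0, so that it
  is an involution of the whole space.\<close>

definition kelvin :: "'n::finite qvec \<Rightarrow> 'n qvec" where
  "kelvin q = q /\<^sub>R (norm q)\<^sup>2"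

lemma norm_kelvin: "norm (kelvin q) = inverse (norm q)"
  by (simp add: kelvin_def power2_eq_square field_simps)

lemma kelvin_eq_0 [simp]: "kelvin q = 0 \<longleftrightarrow> q = 0"
  by (simp add: kelvin_def)

lemma kelvin_kelvin [simp]: "kelvin (kelvin q) = q"
  unfolding kelvin_def[of "kelvin q"] norm_kelvin by (cases "q = 0") (simp_all add: kelvin_def power2_eq_square field_simps)

lemma smooth_kelvin: "smooth_on (- {0}) (kelvin :: 'n::finite qvec \<Rightarrow> 'n qvec)"
proof -
  have o: "open (- {0 :: 'n qvec})" by auto
  have "smooth_on (- {0}) (\<lambda>q :: 'n qvec. inverse (inner q q) *\<^sub>R q)"
    by (intro smooth_on_scaleR[OF o] smooth_on_inverse[OF o] smooth_on_inner[OF o] smooth_on_id[OF o]) simp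
  then show ?thesis by (simp add: kelvin_def[abs_def] power2_norm_eq_inner)
qed

text \<open>The inversion \<open>[w, a] \<mapsto> (a w\<^sup>* / |a|\<^sup>2, [a])\<close>, which on \<open>[1, q]\<close> is \<open>q \<mapsto> q / |q|\<^sup>2\<close>, maps the
  complement of the ball in projective space to the part \<open>|q| \<le> 1\<close> of the blow-up.\<close>

definition inv_vec :: "'n::finite option qvec \<Rightarrow> 'n qvec" where
  "inv_vec a = rscale (htail a) (qcnj (a $ None) /\<^sub>R (norm (htail a))\<^sup>2)"

definition inversion :: "'n::finite option qvec set \<Rightarrow> 'n qvec \<times> 'n qvec set" where
  "inversion L = (inv_vec (hom_coords L), qline (htail (hom_coords L)))"

text \<open>For a right factor \<open>l\<close> of the coordinates, \<open>l * qcnj (w * l)\<close>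
  equals the real number \<open>(norm l)\<^sup>2\<close> times \<open>qcnj w\<close>, and this
  number cancels against the denominator. Without the conjugation the expression would not be
  defined on lines.\<close>

lemma inv_vec_rscale:
  assumes "l \<noteq> 0"
  shows "inv_vec (rscale a l) = inv_vec a"
proof -
  have "l * qcnj (a $ None * l) = (norm l)\<^sup>2 *\<^sub>R qcnj (a $ None)"
    by (simp add: qcnj_mult mult.assoc[symmetric] mult_qcnj)
  then show ?thesis
    using assms
    by (simp add: inv_vec_def rscale_rscale norm_rscale power_mult_distrib) (simp add: mult.assoc)
qed

lemma inversion_qline:
  assumes "a \<noteq> 0"
  shows "inversion (qline a) = (inv_vec a, qline (htail a))"
proof -
  obtain l where "l \<noteq> 0" "hom_coords (qline a) = rscale a l" by (rule hom_coords_qline[OF assms])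
  then show ?thesis by (simp add: inversion_def inv_vec_rscale qline_rscale)
qed

lemma norm_inv_vec: "norm (inv_vec a) = norm (a $ None) / norm (htail a)"
  by (simp add: inv_vec_def norm_rscale power2_eq_square field_simps)

lemma inversion_hpoint:
  "inversion (hpoint 1 q) = (kelvin q, qline q)"
proof -
  have "hcons 1 q \<noteq> 0" by (auto simp: qvec_option_eq_iff)
  then show ?thesis by (simp add: hpoint_eq inversion_qline inv_vec_def kelvin_def rscale_scaleR)
qed

definition HP_outer :: "'n::finite option qvec set set" where
  "HP_outer = HP - hpoint 1 ` ball 0 1"

lemma HP_outerE:
  assumes "L \<in> HP_outer"
  obtains a where "a \<noteq> 0" "htail a \<noteq> 0" "L = qline a" "norm (a $ None) \<le> norm (htail a)"
proof -
  obtain a where a: "a \<noteq> 0" "L = qline a" using assms by (auto simp: HP_outer_def HP_iff)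
  then have "norm (a $ None) \<le> norm (htail a)"
    using assms qline_in_hpoint_ball[of a] by (simp add: HP_outer_def)
  moreover from this have "htail a \<noteq> 0" using a(1) by (auto simp: qvec_option_eq_iff)
  ultimately show thesis using that a by blast
qed

lemma closedin_HP_outer: "closedin HP_topology HP_outer"
proof -
  have "{a :: 'a option qvec. a \<noteq> 0 \<and> qline a \<notin> HP_outer} = {a. norm (htail a) < norm (a $ None)}"
    using qline_in_hpoint_ball by (auto simp: HP_outer_def qline_in_HP)
  moreover have "open {a :: 'a option qvec. norm (htail a) < norm (a $ None)}"
    by (intro open_Collect_less continuous_intros continuous_on_htail)
  ultimately show ?thesis by (auto simp: closedin_HP_topology HP_outer_def)
qed

lemma norm_inversion: "L \<in> HP_outer \<Longrightarrow> norm (fst (inversion L)) \<le> 1"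
  by (erule HP_outerE) (simp add: inversion_qline norm_inv_vec)

lemma inversion_inj:
  assumes L: "L \<in> HP_outer" and L': "L' \<in> HP_outer" and eq: "inversion L = inversion L'"
  shows "L = L'"
proof -
  obtain a where a: "a \<noteq> 0" "htail a \<noteq> 0" "L = qline a" using L by (rule HP_outerE)
  obtain a' where a': "a' \<noteq> 0" "htail a' \<noteq> 0" "L' = qline a'" using L' by (rule HP_outerE)
  have "qline (htail a') = qline (htail a)" using eq a a' by (simp add: inversion_qline)
  then obtain l where l: "l \<noteq> 0" "htail a = rscale (htail a') l"
    using qline_eqD[OF _ a(2)] by blast
  \<comment> \<open>The representative of \<open>L'\<close> that has the same tail as
    \<open>a\<close>; it then remains to compare the first coordinates.\<close>
  let ?b = "rscale a' l"
  have "inv_vec a = inv_vec ?b" using eq a a' l(1) by (simp add: inversion_qline inv_vec_rscale)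
  then have "rscale (htail a) (qcnj (a $ None) /\<^sub>R (norm (htail a))\<^sup>2) =
      rscale (htail a) (qcnj (?b $ None) /\<^sub>R (norm (htail a))\<^sup>2)"
    unfolding inv_vec_def htail_rscale l(2)[symmetric] .
  then have "qcnj (a $ None) /\<^sub>R (norm (htail a))\<^sup>2 = qcnj (?b $ None) /\<^sub>R (norm (htail a))\<^sup>2"
    by (rule rscale_cancel) (rule a(2))
  then have "qcnj (a $ None) = qcnj (?b $ None)" using a(2) by simp
  then have "a $ None = ?b $ None" by (metis qcnj_qcnj)
  then have "a = ?b" using l(2) by (simp add: qvec_option_eq_iff)
  then show ?thesis using a a' l(1) by (simp add: qline_rscale)
qed

lemma inversion_surj:
  assumes z: "z \<in> Bl0" and n: "norm (fst z) \<le> 1"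
  obtains L where "L \<in> HP_outer" "inversion L = z"
proof -
  obtain q t where t: "z = (q, qline t)" "t \<noteq> 0" "q \<in> qline t" using z by (auto simp: Bl0_def HP_iff)
  then obtain l where l: "q = rscale t l" by (auto simp: mem_qline)
  \<comment> \<open>The first coordinate \<open>w\<close> is found by solving
    \<open>qcnj w /\<^sub>R (norm t)\<^sup>2 = l\<close>.\<close>
  let ?a = "hcons ((norm t)\<^sup>2 *\<^sub>R qcnj l) t"
  have a: "?a \<noteq> 0" using t(2) by (auto simp: qvec_option_eq_iff)
  have i: "inv_vec ?a = q" using t(2) by (simp add: inv_vec_def qcnj_scaleR l)
  then have "inversion (qline ?a) = z" using a t(1) by (simp add: inversion_qline)
  moreover have "norm (?a $ None) / norm (htail ?a) \<le> 1"
    using norm_inv_vec[of ?a] i n t(1) by simp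
  then have "qline ?a \<notin> hpoint 1 ` ball 0 1"
    using t(2) by (simp add: qline_in_hpoint_ball)
  then have "qline ?a \<in> HP_outer" using a by (simp add: HP_outer_def qline_in_HP)
  ultimately show thesis using that by blast
qed

lemma continuous_map_inversion: "continuous_map (subtopology HP_topology HP_outer) Bl0_topology inversion"
proof (rule continuous_map_from_HP_subtopology)
  let ?S = "{a :: 'a option qvec. a \<noteq> 0 \<and> qline a \<in> HP_outer}"
  \<comment> \<open>Outside the ball the tail is at least as long as the first coordinate, so it
    vanishes only together with the whole vector. The denominator of \<open>inv_vec\<close> is
    therefore not 0 on this set.\<close>
  have S: "htail a \<noteq> 0" if "a \<in> ?S" for a
    using that qline_in_hpoint_ball[of a] by (auto simp: HP_outer_def qvec_option_eq_iff)
  note ct = continuous_on_htail[of ?S]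
  have q: "continuous_on ?S (\<lambda>a. qcnj (a $ None))"
    by (rule bounded_linear.continuous_on[OF bounded_linear_qcnj continuous_on_component[OF continuous_on_id]])
  have n: "continuous_on ?S (\<lambda>a. inverse ((norm (htail a))\<^sup>2))"
    by (rule continuous_on_inverse[OF continuous_on_power[OF continuous_on_norm[OF ct]]])
      (use S in simp)
  have "continuous_on ?S inv_vec"
    unfolding inv_vec_def[abs_def] rscale_def
    by (rule continuous_on_vec_lambda,
        rule continuous_on_mult[OF continuous_on_component[OF ct] continuous_on_scaleR[OF n q]])
  then have "continuous_map (top_of_set ?S) Bl0_topology (\<lambda>a. (inv_vec a, qline (htail a)))"
    using ct S by (intro continuous_map_Bl0) (simp_all add: inv_vec_def)
  then show "continuous_map (top_of_set ?S) Bl0_topology (\<lambda>a. inversion (qline a))"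
    by (rule continuous_map_eq) (use S in \<open>simp add: inversion_qline\<close>)
qed (simp add: closedin_HP_outer)

section \<open>The inversion in the affine charts of projective space\<close>

lemma snd_HP_chart:
  "a \<noteq> 0 \<Longrightarrow> snd (HP_chart j) (qline a) = (\<chi> k. a $ (if j = Some k then None else Some k) * inverse (a $ j))"
  by (simp add: HP_chart_def hom_coords_ratio)

lemma fst_HP_chart: "a \<noteq> 0 \<Longrightarrow> qline a \<in> fst (HP_chart j) \<longleftrightarrow> a $ j \<noteq> 0"
  by (simp add: HP_chart_def hom_coords_nth_eq_0 qline_in_HP)

lemma openin_fst_HP_chart:
  "openin HP_topology (fst (HP_chart j) \<inter> - hpoint 1 ` cball 0 1)"
proof -
  have "{a :: 'a option qvec. a \<noteq> 0 \<and> qline a \<in> fst (HP_chart j) \<inter> - hpoint 1 ` cball 0 1} =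
      {a. a $ j \<noteq> 0 \<and> norm (a $ None) < norm (htail a)}" (is "?L = ?R")
  proof (intro set_eqI)
    show "a \<in> ?L \<longleftrightarrow> a \<in> ?R" for a
      by (cases "a = 0") (auto simp: fst_HP_chart qline_in_hpoint_cball)
  qed
  moreover have "open {a :: 'a option qvec. a $ j \<noteq> 0 \<and> norm (a $ None) < norm (htail a)}"
    by (intro open_Collect_conj open_Collect_less open_Collect_neq continuous_intros continuous_on_htail)
  moreover have "fst (HP_chart j) \<subseteq> HP" by (auto simp: HP_chart_def)
  ultimately show ?thesis by (auto simp: openin_HP_topology)
qed

text \<open>For the representative of a line with coordinate 1 in slot \<open>i\<close>, the
  inversion puts into that slot the conjugate of \<open>w\<close> divided by the squared norm of the
  tail; this map solves for \<open>w\<close>. The norm of \<open>slot_one i b\<close> does not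
  depend on \<open>b $ i\<close>, which is why \<open>from_HP\<close> inverts it by undoing a single
  slot.\<close>

definition to_HP :: "'n::finite \<Rightarrow> 'n qvec \<Rightarrow> 'n qvec" where
  "to_HP i b = (\<chi> k. if k = i then (norm (slot_one i b))\<^sup>2 *\<^sub>R qcnj (b $ i) else b $ k)"

definition from_HP :: "'n::finite \<Rightarrow> 'n qvec \<Rightarrow> 'n qvec" where
  "from_HP i y = (\<chi> k. if k = i then qcnj (y $ i) /\<^sub>R (norm (slot_one i y))\<^sup>2 else y $ k)"

lemma slot_one_to_HP: "slot_one i (to_HP i b) = slot_one i b"
  and slot_one_from_HP: "slot_one i (from_HP i y) = slot_one i y"
  by (simp_all add: vec_eq_iff to_HP_def from_HP_def)

lemma from_to_HP: "from_HP i (to_HP i b) = b" and to_from_HP: "to_HP i (from_HP i y) = y"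
proof -
  have "from_HP i (to_HP i b) $ k = b $ k" for k
    unfolding from_HP_def slot_one_to_HP by (simp add: to_HP_def qcnj_scaleR)
  then show "from_HP i (to_HP i b) = b" by (simp add: vec_eq_iff)
  have "to_HP i (from_HP i y) $ k = y $ k" for k
    unfolding to_HP_def slot_one_from_HP by (simp add: from_HP_def qcnj_scaleR)
  then show "to_HP i (from_HP i y) = y" by (simp add: vec_eq_iff)
qed

lemma smooth_to_HP: "smooth_on UNIV (to_HP i)"
  unfolding to_HP_def power2_norm_eq_inner
proof (rule smooth_on_vec)
  fix k
  have "smooth_on UNIV (\<lambda>b. inner (slot_one i b) (slot_one i b) *\<^sub>R qcnj (b $ i))"
    by (intro smooth_on_scaleR smooth_on_inner smooth_slot_one smooth_on_nth smooth_on_id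
        smooth_on_linear[OF _ bounded_linear_qcnj]) auto
  then show "smooth_on UNIV (\<lambda>b. if k = i then inner (slot_one i b) (slot_one i b) *\<^sub>R qcnj (b $ i) else b $ k)"
    by (cases "k = i") (simp_all add: smooth_on_nth[OF open_UNIV smooth_on_id[OF open_UNIV]])
qed simp

lemma smooth_from_HP: "smooth_on UNIV (from_HP i)"
  unfolding from_HP_def power2_norm_eq_inner
proof (rule smooth_on_vec)
  fix k
  have "smooth_on UNIV (\<lambda>b. inverse (inner (slot_one i b) (slot_one i b)) *\<^sub>R qcnj (b $ i))"
    by (intro smooth_on_scaleR smooth_on_inverse smooth_on_inner smooth_slot_one smooth_on_nth smooth_on_id
        smooth_on_linear[OF _ bounded_linear_qcnj]) auto
  then show "smooth_on UNIV (\<lambda>b. if k = i then qcnj (b $ i) /\<^sub>R inner (slot_one i b) (slot_one i b) else b $ k)"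
    by (cases "k = i") (simp_all add: smooth_on_nth[OF open_UNIV smooth_on_id[OF open_UNIV]])
qed simp

text \<open>Normalizing the tail by \<open>a $ Some i\<close> divides its squared norm by that of
  this coordinate. What is left is \<open>a $ None * qcnj (a $ Some i)\<close> over
  \<open>(norm (a $ Some i))\<^sup>2\<close>, which is the ratio
  \<open>a $ None * inverse (a $ Some i)\<close> because the inverse is the conjugate over the
  squared norm.\<close>

lemma HP_chart_eq_to_HP:
  assumes a: "a \<noteq> 0" and i: "a $ Some i \<noteq> 0"
  shows "snd (HP_chart (Some i)) (qline a) = to_HP i (snd (Bl0_chart i) (inversion (qline a)))"
proof -
  let ?t = "htail a" and ?b = "snd (Bl0_chart i) (inversion (qline a))"
  have t: "?t \<noteq> 0" using i by (metis htail_nth zero_index)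
  have b: "?b = (\<chi> k. if k = i then inv_vec a $ i else a $ Some k * inverse (a $ Some i))"
    using a t by (simp add: inversion_qline snd_Bl0_chart cong: if_cong)
  have s: "slot_one i ?b = rscale ?t (inverse (a $ Some i))"
    unfolding b using i by (simp add: vec_eq_iff)
  have bi: "?b $ i = a $ Some i * qcnj (a $ None) /\<^sub>R (norm ?t)\<^sup>2"
    unfolding b by (simp add: inv_vec_def)
  have ns: "(norm (slot_one i ?b))\<^sup>2 = (norm ?t)\<^sup>2 * inverse ((norm (a $ Some i))\<^sup>2)"
    unfolding s by (simp only: norm_rscale norm_inverse power_mult_distrib power_inverse)
  have qc: "qcnj (?b $ i) = inverse ((norm ?t)\<^sup>2) *\<^sub>R (a $ None * qcnj (a $ Some i))"
    unfolding bi by (simp only: qcnj_scaleR qcnj_mult qcnj_qcnj)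
  have "(norm (slot_one i ?b))\<^sup>2 *\<^sub>R qcnj (?b $ i) = a $ None * inverse (a $ Some i)"
    unfolding ns qc inverse_eq_qcnj[of "a $ Some i"] using t by simp
  then have "to_HP i ?b $ k = snd (HP_chart (Some i)) (qline a) $ k" for k
    unfolding to_HP_def snd_HP_chart[OF a] by (simp add: b)
  then show ?thesis by (simp add: vec_eq_iff)
qed

section \<open>The connected sum\<close>

context blowup_setup
begin

definition Gc :: "('a \<times> 'n option qvec set) set" where "Gc = csum_gluing c"
abbreviation YL :: "'a topology" where "YL \<equiv> subtopology T (- {x \<in> U. \<phi> x \<in> ball 0 1})"
abbreviation YR :: "'n option qvec set topology" where
  "YR \<equiv> subtopology HP_topology (- hpoint 1 ` ball 0 1)"
definition Y where "Y = csum_topology T c"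

abbreviation cl where "cl \<equiv> glue_left Gc"
abbreviation cr where "cr \<equiv> glue_right Gc"

lemma Y_eq: "Y = glue_topology YL YR Gc"
  by (simp add: Y_def csum_topology_def Gc_def)

lemma Gc_iff: "(x, L) \<in> Gc \<longleftrightarrow> x \<in> U \<and> norm (\<phi> x) = 1 \<and> L = hpoint 1 (\<phi> x)"
  by (auto simp: Gc_def csum_gluing_def c_def)

lemma Gc_single: "single_valued Gc" "single_valued (Gc\<inverse>)"
  using \<phi>_inj by (auto simp: single_valued_def Gc_iff dest!: hpoint_1_inj inj_onD)

lemmas glue_eq_c = glue_eq_iff[OF Gc_single]

lemma YR_eq: "YR = subtopology HP_topology HP_outer"
  using subtopology_restrict[of "HP_topology :: 'n option qvec set topology" "- hpoint 1 ` ball 0 1"]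
  by (simp add: HP_outer_def Diff_eq)

lemma topspace_YR: "topspace YR = HP_outer"
  by (auto simp: HP_outer_def)

lemma YL_neq_p: "x \<in> topspace YL \<Longrightarrow> x \<noteq> p"
  using p_U by auto

section \<open>The blow-up as a quotient of the pieces of the connected sum\<close>

definition csum_map :: "'a + 'n option qvec set \<Rightarrow> ('a + 'n qvec \<times> 'n qvec set) set" where
  "csum_map z = (case z of Inl x \<Rightarrow> gl x | Inr L \<Rightarrow> gr (inversion L))"

lemma csum_map_simps [simp]:
  "csum_map (Inl x) = gl x" "csum_map (Inr L) = gr (inversion L)"
  by (simp_all add: csum_map_def)

lemma continuous_left: "continuous_map YL X gl"
  by (rule continuous_map_from_subtopology_mono[OF cont_gl]) (use p_U in auto)

lemma continuous_right: "continuous_map YR X (\<lambda>L. gr (inversion L))"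
proof -
  have "continuous_map YR XR inversion"
    unfolding YR_eq
  proof (rule continuous_map_into_subtopology[OF continuous_map_inversion])
    show "inversion \<in> topspace (subtopology HP_topology HP_outer) \<rightarrow> {(q, L). q \<in> \<phi> ` U}"
      using ball_sub' norm_inversion by (auto simp: case_prod_unfold)
  qed
  from continuous_map_compose[OF this cont_gr] show ?thesis by (simp add: o_def)
qed

text \<open>The pieces of the connected sum contain their boundary spheres, so their images in the
  blow-up are closed rather than open, and the quotient property is obtained from closed sets. The
  left piece is closed in \<open>T\<close> and misses \<open>p\<close>; in the right-hand piece of
  the blow-up, the complement of the image of \<open>K\<close> lies over the open set of all
  \<open>\<phi> x\<close> with \<open>x \<in> U - K\<close>.\<close>

lemma closed_left:
  assumes "closedin YL K"
  shows "closedin X (gl ` K)"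
proof -
  have K: "K \<subseteq> topspace YL" using closedin_subset[OF assms] .
  have "openin T {x \<in> U. \<phi> x \<in> ball 0 1}"
    using chart_onD(3)[OF c_chart open_ball, of 0 1] by simp
  then have c1: "closedin T (topspace T - {x \<in> U. \<phi> x \<in> ball 0 1})"
    by (rule closedin_diff[OF closedin_topspace])
  have e1: "subtopology T (topspace T - {x \<in> U. \<phi> x \<in> ball 0 1}) = YL"
    using subtopology_restrict[of T "- {x \<in> U. \<phi> x \<in> ball 0 1}"] by (simp add: Diff_eq)
  have KT: "closedin T K"
    by (rule closedin_trans_full[OF _ c1]) (unfold e1, rule assms)
  have pK: "p \<notin> K" using K YL_neq_p by blast
  have KT': "K \<subseteq> topspace T" using closedin_subset[OF KT] .
  have "closedin XL K"
    using KT pK unfolding closedin_subtopology by (intro exI[of _ K]) auto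
  moreover have "{x \<in> topspace XL. gl x \<in> gl ` K} = K"
    using KT' pK by (auto simp: glue_eq image_iff)
  moreover have "closedin XR {z \<in> topspace XR. gr z \<in> gl ` K}"
  proof -
    have key: "gr z \<in> gl ` K \<longleftrightarrow> x \<in> K" if z: "z \<in> Bl0" "x \<in> U" "fst z = \<phi> x" for z x
    proof
      assume "gr z \<in> gl ` K"
      then obtain x' where "x' \<in> K" "(x', z) \<in> G" by (auto simp: glue_eq)
      then show "x \<in> K" using z \<phi>_inj by (auto simp: G_iff dest: inj_onD)
    next
      assume x: "x \<in> K"
      then have "(x, z) \<in> G" using z pK by (cases z) (auto simp: G_Bl0)
      then have "gr z = gl x" by (simp add: glue_eq)
      then show "gr z \<in> gl ` K" using x by blast
    qed
    have "topspace XR - {z \<in> topspace XR. gr z \<in> gl ` K} = {z \<in> Bl0. fst z \<in> \<phi> ` (U - K)}"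
      unfolding topspace_XR using key by blast
    moreover have "open (\<phi> ` (U - K))"
      by (rule open_\<phi>_image[OF openin_diff[OF U_open KT]]) blast
    moreover from this have "openin XR {z \<in> Bl0. fst z \<in> \<phi> ` (U - K)}"
      unfolding openin_XR using open_Bl0_fst by auto
    ultimately show ?thesis unfolding closedin_def by (metis (no_types, lifting) mem_Collect_eq subsetI)
  qed
  moreover have "gl ` K \<subseteq> topspace X"
    using KT' pK by (auto simp: topspace_X)
  ultimately show ?thesis unfolding X_eq closedin_glue_topology by simp
qed

text \<open>A closed subset of the complement of the ball is compact, since projective space is; so
  is its image, which is closed because the blow-up is Hausdorff.\<close>

lemma closed_right:
  assumes "closedin YR K"
  shows "closedin X ((\<lambda>L. gr (inversion L)) ` K)"
proof -
  have "closedin HP_topology K"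
    using assms closedin_HP_outer unfolding YR_eq by (rule closedin_trans_full)
  then have "compactin HP_topology K"
    using compact_space_HP closedin_compact_space by blast
  then have "compactin YR K"
    using closedin_subset[OF assms] by (auto simp: compactin_subtopology)
  then have "compactin X ((\<lambda>L. gr (inversion L)) ` K)"
    by (rule image_compactin[OF _ continuous_right])
  then show ?thesis by (rule compactin_imp_closedin[OF X_Hausdorff])
qed

lemma gr_inversion_surj:
  assumes "z \<in> Bl0" "norm (fst z) \<le> 1"
  shows "\<exists>L\<in>topspace YR. gr z = gr (inversion L)"
  using inversion_surj[OF assms] unfolding topspace_YR by metis

lemma X_points:
  assumes "w \<in> topspace X"
  shows "(\<exists>x\<in>topspace YL. w = gl x) \<or> (\<exists>L\<in>topspace YR. w = gr (inversion L))"
proof -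
  have left: ?thesis if x: "w = gl x" "x \<in> topspace T" "x \<noteq> p" for x
  proof (cases "x \<in> topspace YL")
    case False
    then have "x \<in> U" "norm (\<phi> x) < 1" using x by auto
    moreover from this have "(\<phi> x, qline (\<phi> x)) \<in> Bl0"
      using x(3) by (simp add: Bl0_def qline_in_HP \<phi>_eq_0)
    ultimately show ?thesis
      using gr_inversion_surj[of "(\<phi> x, qline (\<phi> x))"] x gl_eq_gr[of x] by simp
  qed (use x in blast)
  from assms consider x where "x \<in> topspace T" "x \<noteq> p" "w = gl x" | z where "z \<in> Bl0" "fst z \<in> \<phi> ` U" "w = gr z"
    unfolding topspace_X by blast
  then show ?thesis
  proof cases
    case 1
    then show ?thesis using left by blast
  next
    case 2
    show ?thesis
    proof (cases "norm (fst z) \<le> 1")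
      case True
      then show ?thesis using gr_inversion_surj[OF 2(1)] 2(3) by blast
    next
      case False
      obtain x where x: "x \<in> U" "fst z = \<phi> x" using 2(2) by blast
      then have "x \<noteq> p" using False by auto
      then have "(x, z) \<in> G" using x 2(1) by (cases z) (simp add: G_Bl0)
      then have "w = gl x" using 2(3) by (simp add: glue_eq)
      then show ?thesis using left x(1) \<open>x \<noteq> p\<close> U_sub by blast
    qed
  qed
qed

lemma hpoint_in_YR: "1 \<le> norm q \<Longrightarrow> hpoint 1 q \<in> topspace YR"
  using hpoint_1_inj[of q] hpoint_in_HP[of q] unfolding topspace_YR HP_outer_def by force

text \<open>On \<open>U\<close>, the left piece has \<open>norm (\<phi> x) \<ge> 1\<close>, while
  the inversion takes values of norm at most 1. The images can meet only over the unit sphere, and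
  there the inversion sends \<open>hpoint 1 q\<close> to the point over \<open>q\<close>, in
  accordance with the gluing.\<close>

lemma csum_map_fibres:
  assumes x: "x \<in> topspace YL" and L: "L \<in> topspace YR"
  shows "(x, L) \<in> Gc \<longleftrightarrow> gl x = gr (inversion L)"
proof
  assume "(x, L) \<in> Gc"
  then have *: "x \<in> U" "norm (\<phi> x) = 1" "L = hpoint 1 (\<phi> x)" by (simp_all add: Gc_iff)
  then have "inversion L = (\<phi> x, qline (\<phi> x))" by (simp add: inversion_hpoint kelvin_def)
  then show "gl x = gr (inversion L)" using * gl_eq_gr YL_neq_p[OF x] by simp
next
  assume "gl x = gr (inversion L)"
  then have xU: "x \<in> U" and i: "inversion L = (\<phi> x, qline (\<phi> x))" by (simp_all add: glue_eq G_iff)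
  have "L \<in> HP_outer" using L by (simp only: topspace_YR)
  then have "norm (\<phi> x) \<le> 1" using norm_inversion[of L] by (simp add: i)
  then have n: "norm (\<phi> x) = 1" using x xU by simp
  have "hpoint 1 (\<phi> x) \<in> HP_outer"
    using hpoint_in_YR[of "\<phi> x"] n by (simp only: topspace_YR order_refl)
  moreover have "inversion (hpoint 1 (\<phi> x)) = inversion L"
    unfolding i by (simp add: inversion_hpoint kelvin_def n)
  ultimately have "L = hpoint 1 (\<phi> x)" using inversion_inj \<open>L \<in> HP_outer\<close> by metis
  then show "(x, L) \<in> Gc" using xU n by (simp add: Gc_iff)
qed

text \<open>Closedness can be tested on the two summands separately, since the image of a closed set
  is the union of the images of its two parts.\<close>

lemma quotient_map_csum_map: "quotient_map (disjoint_sum_topology YL YR) X csum_map"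
proof (rule continuous_closed_imp_quotient_map)
  show cont: "continuous_map (disjoint_sum_topology YL YR) X csum_map"
    by (rule continuous_map_disjoint_sum) (simp_all only: csum_map_simps continuous_left continuous_right)
  show "closed_map (disjoint_sum_topology YL YR) X csum_map"
    unfolding closed_map_def
  proof (intro allI impI)
    fix K assume K: "closedin (disjoint_sum_topology YL YR) K"
    have sub: "K \<subseteq> topspace YL <+> topspace YR"
      using closedin_subset[OF K] by (simp only: topspace_disjoint_sum_topology)
    have "csum_map ` K = gl ` {x \<in> topspace YL. Inl x \<in> K} \<union>
        (\<lambda>L. gr (inversion L)) ` {L \<in> topspace YR. Inr L \<in> K}"
      using image_Plus_split[OF sub, of csum_map] by (simp only: csum_map_simps)
    then show "closedin X (csum_map ` K)"
      using closed_left[OF closedin_disjoint_sum_topologyD(1)[OF K]]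
        closed_right[OF closedin_disjoint_sum_topologyD(2)[OF K]] by (simp only: closedin_Un)
  qed
  show "csum_map ` topspace (disjoint_sum_topology YL YR) = topspace X"
  proof
    show "csum_map ` topspace (disjoint_sum_topology YL YR) \<subseteq> topspace X"
      using cont by (rule continuous_map_image_subset_topspace)
    show "topspace X \<subseteq> csum_map ` topspace (disjoint_sum_topology YL YR)"
    proof
      fix w assume "w \<in> topspace X"
      then consider x where "x \<in> topspace YL" "w = gl x" | L where "L \<in> topspace YR" "w = gr (inversion L)"
        using X_points by blast
      then show "w \<in> csum_map ` topspace (disjoint_sum_topology YL YR)"
        unfolding topspace_disjoint_sum_topology
      proof cases
        case 1
        show "w \<in> csum_map ` (topspace YL <+> topspace YR)"
          by (rule image_eqI[OF _ InlI[OF 1(1)]]) (simp only: csum_map_simps 1(2))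
      next
        case 2
        show "w \<in> csum_map ` (topspace YL <+> topspace YR)"
          by (rule image_eqI[OF _ InrI[OF 2(1)]]) (simp only: csum_map_simps 2(2))
      qed
    qed
  qed
qed

lemma Y_homeomorphic:
  obtains f g where "homeomorphic_maps Y X f g"
    "\<And>x. x \<in> topspace YL \<Longrightarrow> f (cl x) = gl x" "\<And>L. L \<in> topspace YR \<Longrightarrow> f (cr L) = gr (inversion L)"
proof (rule quotient_maps_homeomorphic[OF quotient_map_glue_class[of YL YR Gc] quotient_map_csum_map])
  fix z z' assume "z \<in> topspace (disjoint_sum_topology YL YR)" "z' \<in> topspace (disjoint_sum_topology YL YR)"
  then have z: "z \<in> topspace YL <+> topspace YR" and z': "z' \<in> topspace YL <+> topspace YR"
    by (simp_all only: topspace_disjoint_sum_topology)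
  have LR: "cl x = cr L \<longleftrightarrow> gl x = gr (inversion L)" "cr L = cl x \<longleftrightarrow> gr (inversion L) = gl x"
    if "x \<in> topspace YL" "L \<in> topspace YR" for x L
    using csum_map_fibres[OF that] by (auto simp only: glue_eq_c eq_commute[of "gr _" "gl _"])
  have RR: "cr L = cr L' \<longleftrightarrow> gr (inversion L) = gr (inversion L')"
    if "L \<in> topspace YR" "L' \<in> topspace YR" for L L'
    using inversion_inj that unfolding topspace_YR glue_eq_c glue_eq by blast
  have LL: "cl x = cl x' \<longleftrightarrow> gl x = gl x'" for x x'
    by (simp only: glue_eq_c glue_eq)
  show "glue_class Gc z = glue_class Gc z' \<longleftrightarrow> csum_map z = csum_map z'"
    using z z'
    by (elim PlusE) (simp_all only: csum_map_simps glue_left_def[of Gc, symmetric]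
        glue_right_def[of Gc, symmetric] LL LR RR)
next
  fix f g
  assume "homeomorphic_maps (glue_topology YL YR Gc) X f g"
    and f: "\<And>z. z \<in> topspace (disjoint_sum_topology YL YR) \<Longrightarrow> f (glue_class Gc z) = csum_map z"
  moreover have "f (cl x) = gl x" if "x \<in> topspace YL" for x
    using f[unfolded topspace_disjoint_sum_topology, OF InlI[OF that]]
    by (simp only: glue_left_def[of Gc] csum_map_simps)
  moreover have "f (cr L) = gr (inversion L)" if "L \<in> topspace YR" for L
    using f[unfolded topspace_disjoint_sum_topology, OF InrI[OF that]]
    by (simp only: glue_right_def[of Gc] csum_map_simps)
  ultimately show thesis by (intro that[of f g]) (simp_all only: Y_eq)
qed

section \<open>The charts of the connected sum, compared with those of the blow-up\<close>

lemma topspace_Y: "topspace Y = cl ` topspace YL \<union> cr ` topspace YR"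
  unfolding Y_eq topspace_glue_topology ..

text \<open>No point of \<open>W\<close> lies on the gluing sphere, so none is identified with a
  point of projective space: the preimages of the image in the two pieces are \<open>W\<close> and
  the empty set.\<close>

lemma openin_cl_image:
  assumes W: "openin T W" "W \<subseteq> topspace YL" and n: "\<And>x. x \<in> W \<Longrightarrow> x \<in> U \<Longrightarrow> norm (\<phi> x) \<noteq> 1"
  shows "openin Y (cl ` W)"
proof -
  have 1: "{x \<in> topspace YL. cl x \<in> cl ` W} = W"
    using W(2) by (auto simp only: glue_eq_c image_iff mem_Collect_eq)
  have 2: "openin YL W"
    unfolding openin_subtopology using W by (intro exI[of _ W]) auto
  have 3: "{L \<in> topspace YR. cr L \<in> cl ` W} = {}"
    using n by (auto simp: glue_eq_c Gc_iff)
  show ?thesis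
    unfolding Y_eq openin_glue_topology topspace_glue_topology 1 3
    by (intro conjI openin_empty 2) (use W(2) in blast)
qed

lemma openin_cr_image:
  assumes W: "openin HP_topology W" and n: "W \<inter> hpoint 1 ` cball 0 1 = {}"
  shows "openin Y (cr ` W)"
proof -
  have sub: "W \<subseteq> topspace YR"
    using n openin_subset[OF W] by (auto simp: HP_outer_def)
  have 1: "{L \<in> topspace YR. cr L \<in> cr ` W} = W"
    using sub by (auto simp only: glue_eq_c image_iff mem_Collect_eq)
  have 2: "openin YR W"
    unfolding openin_subtopology using W sub by (intro exI[of _ W]) auto
  have 3: "{x \<in> topspace YL. cl x \<in> cr ` W} = {}"
    using n by (auto simp: glue_eq_c Gc_iff)
  show ?thesis
    unfolding Y_eq openin_glue_topology topspace_glue_topology 1 3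
    by (intro conjI openin_empty 2) (use sub in blast)
qed

lemma csum_atlas_cases:
  assumes "e \<in> csum_atlas A c"
  obtains (left) d where "d \<in> A" "e = push_chart cl (restrict_chart (- {x \<in> U. \<phi> x \<in> cball 0 1}) d)"
  | (right) j where "e = push_chart cr (restrict_chart (- hpoint 1 ` cball 0 1) (HP_chart j))"
  | (collar) "e = (csum_collar c ` (\<phi> ` U - {0}), inv_into (\<phi> ` U - {0}) (csum_collar c))"
  using assms unfolding csum_atlas_def Gc_def by auto

lemma csum_collar_eq:
  assumes "x \<in> U"
  shows "csum_collar c (\<phi> x) = (if norm (\<phi> x) \<ge> 1 then cl x else cr (hpoint 1 (kelvin (\<phi> x))))"
  using \<phi>_inj assms by (simp add: csum_collar_def Gc_def kelvin_def)

context
  fixes f g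
  assumes fg: "homeomorphic_maps Y X f g"
    and f_cl: "\<And>x. x \<in> topspace YL \<Longrightarrow> f (cl x) = gl x"
    and f_cr: "\<And>L. L \<in> topspace YR \<Longrightarrow> f (cr L) = gr (inversion L)"
begin

text \<open>On the projective side the collar runs through \<open>hpoint 1 (kelvin q)\<close>, and
  the inversion applies \<open>kelvin\<close> once more. Both halves of the collar thus map to the
  point with coordinate \<open>q\<close>, so that no corner arises along the common sphere.\<close>

lemma f_collar:
  assumes "x \<in> U" "x \<noteq> p"
  shows "csum_collar c (\<phi> x) \<in> topspace Y \<and> f (csum_collar c (\<phi> x)) = gl x"
proof (cases "norm (\<phi> x) \<ge> 1")
  case True
  then have "x \<in> topspace YL" using assms U_sub by auto
  then show ?thesis using True assms f_cl by (simp add: csum_collar_eq topspace_Y)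
next
  case False
  have "\<phi> x \<noteq> 0" using assms by (simp add: \<phi>_eq_0)
  then have "1 \<le> norm (kelvin (\<phi> x))" using False by (simp add: norm_kelvin one_le_inverse)
  then have "hpoint 1 (kelvin (\<phi> x)) \<in> topspace YR" by (rule hpoint_in_YR)
  moreover have "qline (kelvin (\<phi> x)) = qline (\<phi> x)"
  proof -
    have "kelvin (\<phi> x) = rscale (\<phi> x) (inverse ((norm (\<phi> x))\<^sup>2) *\<^sub>R 1)"
      by (simp add: kelvin_def rscale_scaleR)
    then show ?thesis using \<open>\<phi> x \<noteq> 0\<close> by (simp add: qline_rscale)
  qed
  then have "gr (inversion (hpoint 1 (kelvin (\<phi> x)))) = gl x"
    using assms by (simp add: inversion_hpoint gl_eq_gr)
  ultimately show ?thesis using False assms f_cr by (simp add: csum_collar_eq topspace_Y)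
qed

text \<open>This contains the smoothness of the diffeomorphism and of its inverse. Relative to the
  charts of the blow-up, the charts of the manifold are unchanged, the chart \<open>[1, q]\<close>
  is \<open>kelvin\<close> applied to \<open>\<phi>\<close>, the other affine charts are given by
  \<open>to_HP\<close>, and the collar is \<open>\<phi>\<close> itself.\<close>

lemma subordinate_csum_atlas:
  assumes "e \<in> csum_atlas A c"
  shows "subordinate Y f (blowup_atlas A p c) e"
  using assms
proof (cases rule: csum_atlas_cases)
  case (left d)
  let ?W = "fst d \<inter> - {x \<in> U. \<phi> x \<in> cball 0 1}"
  have inj: "inj_on cl S" for S by (simp add: inj_on_def glue_eq_c)
  have d: "openin T (fst d)" using chart_onD(1)[OF A_chart[OF left(1)]] .
  have W: "openin T ?W"
    using openin_diff[OF d closed_\<phi>_preimage[OF compact_cball subset_refl]] by (simp only: Diff_eq)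
  have sub: "?W \<subseteq> topspace YL"
    using openin_subset[OF d] by auto
  show ?thesis
  proof (rule subordinateI)
    show "openin Y (fst e)"
      unfolding left fst_push_chart fst_restrict_chart by (rule openin_cl_image[OF W sub]) auto
    show "Lc d \<in> blowup_atlas A p c" using left(1) by (simp add: blowup_atlas_eq)
    fix w assume "w \<in> fst e"
    then obtain x where x: "x \<in> ?W" "w = cl x" unfolding left by auto
    then have xY: "x \<in> topspace YL" using sub by blast
    have "snd e w = snd d x"
      unfolding left x(2) by (subst snd_push_chart) (use x(1) inj in auto)
    then show "f w \<in> fst (Lc d) \<and> snd e w = snd (Lc d) (f w)"
      using x f_cl[OF xY] YL_neq_p[OF xY] by (simp add: gl_in_Lc snd_Lc)
  qed
next
  case (right j)
  let ?W = "fst (HP_chart j) \<inter> - hpoint 1 ` cball 0 1"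
  have inj: "inj_on cr S" for S by (simp add: inj_on_def glue_eq_c)
  have op: "openin Y (fst e)"
    unfolding right fst_push_chart fst_restrict_chart by (rule openin_cr_image[OF openin_fst_HP_chart]) auto
  have pt: "\<exists>a. a \<noteq> 0 \<and> htail a \<noteq> 0 \<and> a $ j \<noteq> 0 \<and> norm (a $ None) < norm (htail a) \<and> qline a \<in> topspace YR \<and>
      w = cr (qline a) \<and> snd e w = snd (HP_chart j) (qline a)" if w: "w \<in> fst e" for w
  proof -
    obtain L where L: "L \<in> ?W" "w = cr L" using w unfolding right by auto
    then have "L \<in> HP" by (auto simp: HP_chart_def)
    then obtain a where a: "a \<noteq> 0" "L = qline a" by (auto simp: HP_iff)
    have "a $ j \<noteq> 0" "norm (a $ None) < norm (htail a)"
      using L(1) a by (auto simp: fst_HP_chart qline_in_hpoint_cball)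
    moreover from this have "htail a \<noteq> 0" by auto
    moreover have "qline a \<in> topspace YR"
      using a calculation(2) unfolding topspace_YR by (simp add: HP_outer_def qline_in_HP qline_in_hpoint_ball)
    moreover have "snd e w = snd (HP_chart j) L"
      unfolding right L(2) by (subst snd_push_chart) (use L(1) inj in auto)
    ultimately show ?thesis using a L by blast
  qed
  show ?thesis
  proof (cases j)
    case None
    show ?thesis
    \<comment> \<open>The homeomorphism sends \<open>[1, q]\<close> to the point with
      \<open>\<phi>\<close>-coordinate \<open>kelvin q\<close>, and \<open>kelvin\<close> is its own
      inverse; the affine maps convert between \<open>\<phi>\<^sub>0\<close> and
      \<open>\<phi>\<close>. The sets \<open>P\<close> and \<open>Q\<close> omit the centre of the
      inversion.\<close>
    proof (rule subordinate_viaI[OF op, where b = "Lc c0" and P = "- {\<phi>\<^sub>0 p}" and Q = "- {0}"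
          and \<tau> = "\<lambda>y. kelvin (r *\<^sub>R y + - (r *\<^sub>R \<phi>\<^sub>0 p))" and \<sigma> = "\<lambda>q. inverse r *\<^sub>R kelvin q + \<phi>\<^sub>0 p"])
      show "Lc c0 \<in> blowup_atlas A p c" using c0_A by (simp add: blowup_atlas_eq)
      have aff: "smooth_on UNIV (\<lambda>y :: 'n qvec. t *\<^sub>R y + b)" for t b
        using slice_regular_affine unfolding slice_regular_on_def by blast
      show "smooth_on (- {\<phi>\<^sub>0 p}) (\<lambda>y. kelvin (r *\<^sub>R y + - (r *\<^sub>R \<phi>\<^sub>0 p)))"
        by (rule smooth_on_compose[OF _ _ _ smooth_kelvin smooth_on_subset[OF aff]])
          (use r_pos in \<open>auto simp: scaleR_right_diff_distrib[symmetric]\<close>)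
      show "smooth_on (- {0}) (\<lambda>q. inverse r *\<^sub>R kelvin q + \<phi>\<^sub>0 p)"
        by (rule smooth_on_compose[OF _ open_UNIV _ aff smooth_kelvin]) auto
      show "kelvin (r *\<^sub>R y + - (r *\<^sub>R \<phi>\<^sub>0 p)) \<in> - {0} \<and>
          inverse r *\<^sub>R kelvin (kelvin (r *\<^sub>R y + - (r *\<^sub>R \<phi>\<^sub>0 p))) + \<phi>\<^sub>0 p = y" if "y \<in> - {\<phi>\<^sub>0 p}" for y
        using that r_pos by (simp add: scaleR_right_diff_distrib[symmetric])
      show "inverse r *\<^sub>R kelvin q + \<phi>\<^sub>0 p \<in> - {\<phi>\<^sub>0 p} \<and>
          kelvin (r *\<^sub>R (inverse r *\<^sub>R kelvin q + \<phi>\<^sub>0 p) + - (r *\<^sub>R \<phi>\<^sub>0 p)) = q" if "q \<in> - {0}" for q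
        using that r_pos by (simp add: scaleR_right_distrib)
      fix w assume "w \<in> fst e"
      from pt[OF this] obtain a where a: "a \<noteq> 0" "htail a \<noteq> 0" "a $ None \<noteq> 0" "norm (a $ None) < norm (htail a)"
        "qline a \<in> topspace YR" "w = cr (qline a)" "snd e w = snd (HP_chart None) (qline a)"
        unfolding None by blast
      let ?q = "rscale (htail a) (inverse (a $ None))"
      have q: "qline a = hpoint 1 ?q" using a(3) by (rule qline_eq_hpoint)
      have q0: "?q \<noteq> 0" using a by (simp add: rscale_eq_0)
      have "norm ?q \<ge> 1"
        using a(3,4) by (simp add: norm_rscale norm_inverse divide_inverse[symmetric])
      then have "norm (kelvin ?q) \<le> 1" by (simp add: norm_kelvin inverse_le_1_iff)
      then obtain x where x: "x \<in> U" "kelvin ?q = \<phi> x" using ball_sub' by blast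
      then have xp: "x \<noteq> p" using q0 by auto
      have "?q = kelvin (\<phi> x)" using x(2) by (metis kelvin_kelvin)
      moreover have "kelvin (\<phi> x) = rscale (\<phi> x) (inverse ((norm (\<phi> x))\<^sup>2) *\<^sub>R 1)"
        by (simp add: kelvin_def rscale_scaleR)
      moreover have "\<phi> x \<noteq> 0" using x(1) xp by (simp add: \<phi>_eq_0)
      ultimately have ql: "qline ?q = qline (\<phi> x)" by (simp add: qline_rscale)
      have "f w = gr (inversion (qline a))" using a f_cr by simp
      also have "\<dots> = gl x" unfolding q inversion_hpoint x(2) ql using gl_eq_gr[OF x(1) xp] by simp
      finally have fw: "f w = gl x" .
      have "snd e w = ?q"
        unfolding a(7) snd_HP_chart[OF a(1)] by (simp add: vec_eq_iff)
      moreover have "r *\<^sub>R \<phi>\<^sub>0 x + - (r *\<^sub>R \<phi>\<^sub>0 p) = \<phi> x" by (simp add: \<phi>_def scaleR_right_diff_distrib)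
      moreover have "\<phi>\<^sub>0 x \<noteq> \<phi>\<^sub>0 p" using \<open>\<phi> x \<noteq> 0\<close> by (auto simp: \<phi>_def)
      ultimately show "f w \<in> fst (Lc c0) \<and> snd (Lc c0) (f w) \<in> - {\<phi>\<^sub>0 p} \<and>
          snd e w = kelvin (r *\<^sub>R snd (Lc c0) (f w) + - (r *\<^sub>R \<phi>\<^sub>0 p))"
        using x xp fw \<open>?q = kelvin (\<phi> x)\<close> by (simp add: gl_in_Lc snd_Lc)
    qed auto
  next
    case (Some i)
    show ?thesis
    proof (rule subordinate_viaI[OF op, where b = "Rc i" and P = UNIV and Q = UNIV
          and \<tau> = "to_HP i" and \<sigma> = "from_HP i"])
      show "Rc i \<in> blowup_atlas A p c" by (simp add: blowup_atlas_eq)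
      fix w assume "w \<in> fst e"
      from pt[OF this] obtain a where a: "a \<noteq> 0" "htail a \<noteq> 0" "a $ Some i \<noteq> 0"
        "qline a \<in> topspace YR" "w = cr (qline a)" "snd e w = snd (HP_chart (Some i)) (qline a)"
        unfolding Some by blast
      have fw: "f w = gr (inversion (qline a))" using a f_cr by simp
      have o: "qline a \<in> HP_outer" using a(4) by (simp only: topspace_YR)
      have "inversion (qline a) \<in> fst (Bl0_chart i)"
        using a by (simp add: inversion_qline fst_Bl0_chart inv_vec_def)
      moreover have "fst (inversion (qline a)) \<in> \<phi> ` U" by (rule ball_sub'[OF norm_inversion[OF o]])
      ultimately show "f w \<in> fst (Rc i) \<and> snd (Rc i) (f w) \<in> UNIV \<and> snd e w = to_HP i (snd (Rc i) (f w))"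
        using HP_chart_eq_to_HP[OF a(1,3)] a(6) by (simp add: fw gr_in_Rc snd_Rc)
    qed (simp_all add: smooth_to_HP smooth_from_HP from_to_HP to_from_HP)
  qed
next
  case collar
  let ?D = "\<phi> ` U - {0}"
  have pt: "\<exists>x. x \<in> U \<and> x \<noteq> p \<and> q = \<phi> x" if "q \<in> ?D" for q using that by auto
  have f: "continuous_map Y X f" and gf: "\<And>y. y \<in> topspace Y \<Longrightarrow> g (f y) = y"
    using fg by (auto simp: homeomorphic_maps_def)
  have inj: "inj_on (csum_collar c) ?D"
  proof (rule inj_onI)
    fix q q' assume q: "q \<in> ?D" "q' \<in> ?D" "csum_collar c q = csum_collar c q'"
    obtain x where x: "x \<in> U" "x \<noteq> p" "q = \<phi> x" using pt[OF q(1)] by blast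
    obtain x' where x': "x' \<in> U" "x' \<noteq> p" "q' = \<phi> x'" using pt[OF q(2)] by blast
    have "gl x = gl x'" using q(3) f_collar[OF x(1,2)] f_collar[OF x'(1,2)] x(3) x'(3) by simp
    then show "q = q'" using x x' by (simp add: glue_eq)
  qed
  have oU: "openin T (U - {p})"
    using openin_diff[OF U_open closedin_Hausdorff_singleton[OF T_Hausdorff]] p_U U_sub by blast
  \<comment> \<open>Openness of the collar neighbourhood is not proved piece by piece across the
    sphere: it is the preimage under the continuous map \<open>f\<close> of an open set of the
    blow-up.\<close>
  have "csum_collar c ` ?D = {y \<in> topspace Y. f y \<in> gl ` (U - {p})}"
  proof (intro set_eqI iffI)
    fix y assume "y \<in> csum_collar c ` ?D"
    then obtain q where q: "q \<in> ?D" "y = csum_collar c q" by blast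
    obtain x where "x \<in> U" "x \<noteq> p" "q = \<phi> x" using pt[OF q(1)] by blast
    then show "y \<in> {y \<in> topspace Y. f y \<in> gl ` (U - {p})}" using f_collar[of x] q(2) by simp
  next
    fix y assume y: "y \<in> {y \<in> topspace Y. f y \<in> gl ` (U - {p})}"
    then obtain x where x: "x \<in> U" "x \<noteq> p" "f y = gl x" by blast
    have fc: "csum_collar c (\<phi> x) \<in> topspace Y" "f (csum_collar c (\<phi> x)) = gl x"
      using f_collar[OF x(1,2)] by blast+
    have "y \<in> topspace Y" using y by blast
    from gf[OF this] have "y = csum_collar c (\<phi> x)" unfolding x(3) fc(2)[symmetric] gf[OF fc(1)] by (rule sym)
    moreover have "\<phi> x \<in> ?D" using x \<phi>_eq_0 by simp
    ultimately show "y \<in> csum_collar c ` ?D" by blast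
  qed
  moreover have "openin X (gl ` (U - {p}))" by (rule open_gl_image[OF oU]) simp
  ultimately have op: "openin Y (fst e)"
    unfolding collar using openin_continuous_map_preimage[OF f] by simp
  show ?thesis
  proof (rule subordinate_affine[OF op])
    show "Lc c0 \<in> blowup_atlas A p c" using c0_A by (simp add: blowup_atlas_eq)
    fix w assume "w \<in> fst e"
    then obtain q where q: "q \<in> ?D" "w = csum_collar c q" unfolding collar by auto
    obtain x where x: "x \<in> U" "x \<noteq> p" "q = \<phi> x" using pt[OF q(1)] by blast
    have "snd e w = q" unfolding collar q(2) using inv_into_f_f[OF inj q(1)] by simp
    moreover have "f w = gl x" using f_collar[OF x(1,2)] q(2) x(3) by simp
    ultimately show "f w \<in> fst (Lc c0) \<and> snd e w = r *\<^sub>R (snd (Lc c0) (f w) - \<phi>\<^sub>0 p)"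
      using x by (simp add: gl_in_Lc snd_Lc \<phi>_def)
  qed
qed

lemma csum_atlas_cover: "topspace Y \<subseteq> (\<Union>e\<in>csum_atlas A c. fst e)"
proof
  fix y assume "y \<in> topspace Y"
  \<comment> \<open>Both other families of charts leave out the gluing sphere, so its points need
    the collar chart.\<close>
  have collar: "y \<in> (\<Union>e\<in>csum_atlas A c. fst e)" if x: "x \<in> U" "norm (\<phi> x) = 1" "y = cl x" for x
  proof -
    have "\<phi> x \<in> \<phi> ` U - {0}" using x by auto
    moreover have "y = csum_collar c (\<phi> x)" using x by (simp add: csum_collar_eq)
    ultimately have "y \<in> csum_collar c ` (\<phi> ` U - {0})" by blast
    then show ?thesis unfolding csum_atlas_def by auto
  qed
  from \<open>y \<in> topspace Y\<close> consider x where "x \<in> topspace YL" "y = cl x" | L where "L \<in> topspace YR" "y = cr L"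
    unfolding topspace_Y by blast
  then show "y \<in> (\<Union>e\<in>csum_atlas A c. fst e)"
  proof cases
    case 1
    show ?thesis
    proof (cases "x \<in> U \<and> norm (\<phi> x) = 1")
      case False
      have xT: "x \<in> topspace T" and n: "\<not> (x \<in> U \<and> norm (\<phi> x) \<le> 1)"
        using 1(1) False by auto
      obtain d where d: "d \<in> A" "x \<in> fst d" using A_cover[OF xT] by blast
      let ?e = "push_chart cl (restrict_chart (- {x \<in> U. \<phi> x \<in> cball 0 1}) d)"
      have "?e \<in> csum_atlas A c" unfolding csum_atlas_def Gc_def using d(1) by auto
      moreover have "y \<in> fst ?e" using d(2) n 1(2) by auto
      ultimately show ?thesis by blast
    qed (use collar 1 in blast)
  next
    case 2
    then have o: "L \<in> HP_outer" by (simp only: topspace_YR)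
    show ?thesis
    proof (cases "L \<in> hpoint 1 ` cball 0 1")
      case True
      then obtain q where q: "L = hpoint 1 q" "norm q \<le> 1" by auto
      have "q \<notin> ball 0 1" using o q(1) by (auto simp: HP_outer_def)
      then have q1: "norm q = 1" using q(2) by simp
      obtain x where x: "x \<in> U" "q = \<phi> x" using ball_sub'[OF q(2)] by blast
      then have "cl x = cr L" using q q1 by (simp add: glue_eq_c Gc_iff)
      then show ?thesis using collar[of x] x q1 2(2) by simp
    next
      case False
      obtain a where a: "a \<noteq> 0" "L = qline a" using o by (rule HP_outerE)
      then obtain j where j: "a $ j \<noteq> 0" by (auto simp: vec_eq_iff)
      let ?e = "push_chart cr (restrict_chart (- hpoint 1 ` cball 0 1) (HP_chart j))"
      have "?e \<in> csum_atlas A c" unfolding csum_atlas_def Gc_def by auto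
      moreover have "y \<in> fst ?e" using False 2(2) a j by (auto simp: fst_HP_chart)
      ultimately show ?thesis by blast
    qed
  qed
qed

text \<open>Both atlases are subordinate, through the same homeomorphism, to the union of the
  standard and the regular atlas of the blow-up. That union is a smooth atlas, which makes the two
  atlases compatible with each other.\<close>

lemma smoothly_compatible_Y: "smoothly_compatible Y (csum_atlas A c) (pull_chart Y f ` C)"
proof -
  let ?B = "pull_chart Y f ` C"
  let ?X = "blowup_atlas A p c \<union> C"
  have hf: "homeomorphic_map Y X f" using fg homeomorphic_map_maps by blast
  have s1: "subordinate Y f ?X e" if "e \<in> csum_atlas A c" for e
    by (rule subordinate_mono[OF subordinate_csum_atlas[OF that]]) blast
  have s2: "subordinate Y f ?X e" if "e \<in> ?B" for e
    by (rule subordinate_mono[OF quaternionic_regular_pullback(3)[OF fg X_regular that]]) blast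
  have cov: "topspace Y \<subseteq> (\<Union>e\<in>?B. fst e)"
    using quaternionic_regular_pullback(1)[OF fg X_regular]
    by (auto simp: quaternionic_regular_manifold_def regular_atlas_def smooth_atlas_def)
  note sub = smooth_atlas_subordinate[OF smooth_atlas_X_C hf]
  show ?thesis
    unfolding smoothly_compatible_def
  proof (intro conjI)
    show "smooth_atlas Y (csum_atlas A c)" by (rule sub[OF s1 csum_atlas_cover])
    show "smooth_atlas Y ?B" by (rule sub[OF s2 cov])
    show "smooth_atlas Y (csum_atlas A c \<union> ?B)"
    proof (rule sub)
      show "subordinate Y f ?X e" if "e \<in> csum_atlas A c \<union> ?B" for e
        using that s1 s2 by (elim UnE)
      show "topspace Y \<subseteq> (\<Union>e\<in>csum_atlas A c \<union> ?B. fst e)" using cov by blast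
    qed
  qed
qed

end

lemma blowup_csum_diffeomorphic:
  "\<exists>B C. quaternionic_regular_manifold Y B \<and> smoothly_compatible Y (csum_atlas A c) B \<and>
     quaternionic_regular_manifold X C \<and> smoothly_compatible X (blowup_atlas A p c) C \<and>
     quaternionic_diffeomorphic Y B X C"
proof -
  obtain f g where fg: "homeomorphic_maps Y X f g"
    "\<And>x. x \<in> topspace YL \<Longrightarrow> f (cl x) = gl x" "\<And>L. L \<in> topspace YR \<Longrightarrow> f (cr L) = gr (inversion L)"
    by (rule Y_homeomorphic) blast
  show ?thesis
    using quaternionic_regular_pullback(1,2)[OF fg(1) X_regular] smoothly_compatible_Y[OF fg]
      X_regular X_compatible by blast
qed

end

theorem theorem1p3:
  fixes T :: "'a topology"
    and A :: "('a, 'n::{finite,linorder}) chart set"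
    and p :: 'a
    and c :: "('a, 'n) chart"
  assumes M: "quaternionic_regular_manifold T A"
    and p: "p \<in> topspace T"
    and c: "normalized_chart A p c"
  shows "\<exists>B C. quaternionic_regular_manifold (csum_topology T c) B \<and>
               smoothly_compatible (csum_topology T c) (csum_atlas A c) B \<and>
               quaternionic_regular_manifold (blowup_topology T p c) C \<and>
               smoothly_compatible (blowup_topology T p c) (blowup_atlas A p c) C \<and>
               quaternionic_diffeomorphic (csum_topology T c) B (blowup_topology T p c) C"
proof -
  obtain U \<phi>\<^sub>0 r where U: "(U, \<phi>\<^sub>0) \<in> A" "p \<in> U" "r > 0"
    and c': "c = (U, \<lambda>x. r *\<^sub>R (\<phi>\<^sub>0 x - \<phi>\<^sub>0 p))" and b: "cball 0 1 \<subseteq> snd c ` U"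
    using c unfolding normalized_chart_def by blast
  interpret S: blowup_setup T A p U \<phi>\<^sub>0 r
    by unfold_locales (use M U b c' in simp_all)
  have "S.c = c" by (simp add: S.c_def c' S.\<phi>_def[abs_def])
  then show ?thesis
    using S.blowup_csum_diffeomorphic by (simp add: S.X_def S.Y_def)
qed

end
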